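(* Let $w:B_1^+\to\mathbb{R}$ be a solution of the variable coefficient thin obstacle problem $$\partial_i a^{ij}\partial_j w=0\ \text{ in }B_1^+,\qquad w\ge0,\ \ -\partial_{n+1}w\ge0,\ \ w\,\partial_{n+1}w=0\ \text{ on }B_1',$$ under the standing assumptions listed in the context. Then for all $x_0\in\Gamma_w\cap B_{1/2}'$ with $\kappa_{x_0}<\infty$ there exist a radius $r_{x_0}>0$ and a constant $C_{x_0}>0$, depending on $x_0,\gamma,\kappa_{x_0},n,\|\nabla a^{ij}\|_{L^p(B_1^+)},w$, such that for all $0<r\le r_{x_0}$ $$\int_{B_{2r}^+(x_0)}w^2\,dx\le C_{x_0}\int_{B_r^+(x_0)}w^2\,dx.$$
   Context: $n\ge1$, Einstein summation. $B_r^+(x_0)=\{x\in\mathbb{R}^{n+1}:x_{n+1}\ge0,\ |x-x_0|<r\}$ for $x_0=(x_0',0)$, $B_r^+=B_r^+(0)$, $B_r'=B_r^+\cap\{x_{n+1}=0\}$, $A_{r,R}^+(x_0)=B_R^+(x_0)\setminus B_r^+(x_0)$. The free boundary is $\Gamma_w=\partial_{B_1'}\{x\in B_1':w(x)>0\}$ (boundary relative to $B_1'$). Standing assumptions: (A0) $\|w\|_{L^2(B_1^+)}=1$; (A1) $a^{i,n+1}(x',0)=0$ on $\{x_{n+1}=0\}$ for $i=1,\dots,n$; (A2) $a^{ij}$ is symmetric and uniformly elliptic with eigenvalues in $[1/2,2]$; (A3) $a^{ij}\in W^{1,p}(B_1^+)$ for some $p\in(n+1,\infty]$, and $\gamma=1-\frac{n+1}{p}$;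 (A4) $a^{ij}(0)=\delta^{ij}$; (W) $w\in C^{1,\alpha}$ (locally up to $B_1'$) for some $\alpha\in(0,\frac12]$. The equation is understood weakly. Vanishing order: $$\kappa_{x_0}=\limsup_{r\to0_+}\frac{\ln\Big(\frac{1}{|A^+_{r/2,r}(x_0)|}\int_{A^+_{r/2,r}(x_0)}w^2\Big)^{1/2}}{\ln r}\in[-\infty,\infty].$$ *)

theory Defs
  imports "HOL-Probability.Essential_Supremum"
begin

text \<open>
  Points of \<open>R^(n+1)\<close> are vectors indexed by \<open>'n option\<close> with \<open>n = CARD('n) \<ge> 1\<close>: the coordinates
  \<open>Some i\<close> are the \<open>n\<close> tangential ones and \<open>None\<close> plays the role of the index \<open>n+1\<close>.
\<close>

type_synonym 'n space = "(real, 'n option) vec"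
type_synonym 'n coeff = "'n space \<Rightarrow> ((real, 'n option) vec, 'n option) vec"

definition half_ball :: "('n::finite) space \<Rightarrow> real \<Rightarrow> 'n space set" where
  "half_ball x0 r = {x. 0 \<le> x $ None \<and> norm (x - x0) < r}"

definition flat_ball :: "real \<Rightarrow> ('n::finite) space set" where
  "flat_ball r = half_ball 0 r \<inter> {x. x $ None = 0}"

definition half_annulus :: "('n::finite) space \<Rightarrow> real \<Rightarrow> real \<Rightarrow> 'n space set" where
  "half_annulus x0 r R = half_ball x0 R - half_ball x0 r"

definition free_boundary :: "(('n::finite) space \<Rightarrow> real) \<Rightarrow> 'n space set" where
  "free_boundary w = (top_of_set (flat_ball 1)) frontier_of {x \<in> flat_ball 1. w x > 0}"

text \<open>
  The logarithm with \<open>ln 0 = -\<infinity>\<close> (the library's real \<open>ln\<close> has the junk value \<open>0\<close> there), so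
  that a function vanishing near \<open>x0\<close> has vanishing order \<open>+\<infinity>\<close>.
\<close>

definition ln_ext :: "real \<Rightarrow> ereal" where
  "ln_ext t = (if t \<le> 0 then -\<infinity> else ereal (ln t))"

definition vanishing_order :: "(('n::finite) space \<Rightarrow> real) \<Rightarrow> 'n space \<Rightarrow> ereal" where
  "vanishing_order w x0 = Limsup (at_right 0) (\<lambda>r.
     ln_ext (sqrt ((1 / measure lebesgue (half_annulus x0 (r/2) r)) *
                   (LINT x:half_annulus x0 (r/2) r|lebesgue. (w x)\<^sup>2)))
     / ereal (ln r))"

text \<open>
  The derivative is taken within \<open>S\<close>; for \<open>S\<close> a half ball this gives one-sided derivatives on the
  flat part of the boundary (the derivative within a half ball is unique at each of its points).
\<close>

definition partial :: "'n option \<Rightarrow> ('n::finite) space set \<Rightarrow> ('n space \<Rightarrow> real) \<Rightarrow> 'n space \<Rightarrow> real" where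
  "partial k S f x = frechet_derivative f (at x within S) (axis k 1)"

text \<open>\<open>C^{1,\<alpha>}\<close> locally on \<open>S\<close>, i.e. with a Hoelder bound on each compact subset of \<open>S\<close>.\<close>

definition C1_holder_loc :: "real \<Rightarrow> ('n::finite) space set \<Rightarrow> ('n space \<Rightarrow> real) \<Rightarrow> bool" where
  "C1_holder_loc \<alpha> S f \<longleftrightarrow>
     f differentiable_on S \<and>
     (\<forall>K. compact K \<and> K \<subseteq> S \<longrightarrow>
        (\<exists>L. \<forall>k. \<forall>x\<in>K. \<forall>y\<in>K. \<bar>partial k S f x - partial k S f y\<bar> \<le> L * dist x y powr \<alpha>))"

primrec Ck :: "nat \<Rightarrow> (('n::finite) space \<Rightarrow> real) \<Rightarrow> bool" where
  "Ck 0 f \<longleftrightarrow> continuous_on UNIV f"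
| "Ck (Suc m) f \<longleftrightarrow> f differentiable_on UNIV \<and> (\<forall>k. Ck m (partial k UNIV f))"

definition test_function :: "('n::finite) space set \<Rightarrow> ('n space \<Rightarrow> real) \<Rightarrow> bool" where
  "test_function U \<phi> \<longleftrightarrow>
     (\<forall>m. Ck m \<phi>) \<and> compact (closure {x. \<phi> x \<noteq> 0}) \<and> closure {x. \<phi> x \<noteq> 0} \<subseteq> U"

definition locally_integrable :: "('n::finite) space set \<Rightarrow> ('n space \<Rightarrow> real) \<Rightarrow> bool" where
  "locally_integrable U f \<longleftrightarrow> (\<forall>K. compact K \<and> K \<subseteq> U \<longrightarrow> set_integrable lebesgue K f)"

definition has_weak_partial ::
  "'n option \<Rightarrow> ('n::finite) space set \<Rightarrow> ('n space \<Rightarrow> real) \<Rightarrow> ('n space \<Rightarrow> real) \<Rightarrow> bool" where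
  "has_weak_partial k U f g \<longleftrightarrow>
     locally_integrable U f \<and> locally_integrable U g \<and>
     (\<forall>\<phi>. test_function U \<phi> \<longrightarrow>
        (LINT x:U|lebesgue. f x * partial k UNIV \<phi> x) = - (LINT x:U|lebesgue. g x * \<phi> x))"

text \<open>A representative; weak derivatives are unique up to null sets.\<close>

definition weak_partial :: "'n option \<Rightarrow> ('n::finite) space set \<Rightarrow> ('n space \<Rightarrow> real) \<Rightarrow> 'n space \<Rightarrow> real" where
  "weak_partial k U f = (SOME g. has_weak_partial k U f g)"

definition in_Lp :: "'a measure \<Rightarrow> ereal \<Rightarrow> ('a \<Rightarrow> real) \<Rightarrow> bool" where
  "in_Lp M p f \<longleftrightarrow> f \<in> borel_measurable M \<and>
     (if p = \<infinity> then esssup M (\<lambda>x. ereal \<bar>f x\<bar>) < \<infinity>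
      else integrable M (\<lambda>x. \<bar>f x\<bar> powr real_of_ereal p))"

definition Lp_norm :: "'a measure \<Rightarrow> ereal \<Rightarrow> ('a \<Rightarrow> real) \<Rightarrow> real" where
  "Lp_norm M p f =
     (if p = \<infinity> then real_of_ereal (esssup M (\<lambda>x. ereal \<bar>f x\<bar>))
      else (LINT x|M. \<bar>f x\<bar> powr real_of_ereal p) powr (1 / real_of_ereal p))"

definition W1p :: "('n::finite) space set \<Rightarrow> ereal \<Rightarrow> ('n space \<Rightarrow> real) \<Rightarrow> bool" where
  "W1p U p f \<longleftrightarrow> in_Lp (lebesgue_on U) p f \<and>
     (\<forall>k. \<exists>g. has_weak_partial k U f g \<and> in_Lp (lebesgue_on U) p g)"

definition grad_coeff_norm :: "('n::finite) space set \<Rightarrow> ereal \<Rightarrow> 'n coeff \<Rightarrow> real" where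
  "grad_coeff_norm U p a = Lp_norm (lebesgue_on U) p
     (\<lambda>x. sqrt (\<Sum>i\<in>UNIV. \<Sum>j\<in>UNIV. \<Sum>k\<in>UNIV. (weak_partial k U (\<lambda>y. a y $ i $ j) x)\<^sup>2))"

text \<open>
  For \<open>p > n+1\<close> the elements of \<open>W^{1,p}\<close> of the half ball have a continuous representative, and
  \<open>a\<close> is that representative: the continuity clause gives the pointwise conditions at \<open>0\<close> and on
  the null set \<open>x $ None = 0\<close> their meaning.
\<close>

definition admissible_coeff :: "ereal \<Rightarrow> ('n::finite) coeff \<Rightarrow> bool" where
  "admissible_coeff p a \<longleftrightarrow>
     (\<forall>x\<in>flat_ball 1. \<forall>i. a x $ Some i $ None = 0) \<and>
     (\<forall>x\<in>half_ball 0 1. transpose (a x) = a x \<and>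
        (\<forall>\<mu> v. v \<noteq> 0 \<and> a x *v v = \<mu> *\<^sub>R v \<longrightarrow> 1/2 \<le> \<mu> \<and> \<mu> \<le> 2)) \<and>
     (\<forall>i j. W1p (interior (half_ball 0 1)) p (\<lambda>x. a x $ i $ j)) \<and>
     continuous_on (half_ball 0 1) a \<and>
     a 0 = mat 1"

text \<open>
  The equation is tested with functions compactly supported in the open half ball; as \<open>w\<close> is
  \<open>C^1\<close> up to the flat boundary, the boundary conditions are pointwise.
\<close>

definition thin_obstacle_solution :: "('n::finite) coeff \<Rightarrow> ('n space \<Rightarrow> real) \<Rightarrow> bool" where
  "thin_obstacle_solution a w \<longleftrightarrow>
     (\<forall>\<phi>. test_function (interior (half_ball 0 1)) \<phi> \<longrightarrow>
        (LINT x:half_ball 0 1|lebesgue.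
           (\<Sum>i\<in>UNIV. \<Sum>j\<in>UNIV. a x $ i $ j * partial j (half_ball 0 1) w x * partial i UNIV \<phi> x)) = 0) \<and>
     (\<forall>x\<in>flat_ball 1.
        w x \<ge> 0 \<and>
        - partial None (half_ball 0 1) w x \<ge> 0 \<and>
        w x * partial None (half_ball 0 1) w x = 0)"

end

theory Submission
  imports Defs
begin

text \<open>
  The inequality does not mention the coefficients, so one admissible \<open>a\<close> may be fixed. Let \<open>A = a x0\<close>,
  \<open>q y = y \<bullet> (A\<inverse> y)\<close>, \<open>\<eta> = (1 - q)\<^sub>+\<^sup>2\<close>, \<open>\<psi> = 4 (1 - q)\<^sub>+\<close> and \<open>u\<^sub>t(y) = w(x0 + e\<^sup>t y)\<close>. Since \<open>A \<nabla>\<eta> = - \<psi> y\<close> and \<open>u\<^sub>s\<close> is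
  nonnegative on the flat boundary, testing the equation of \<open>u\<^sub>t\<close> with \<open>\<eta> u\<^sub>s\<close> gives, for constant coefficients,
  \<open>\<integral> \<psi> u\<^sub>s \<partial>\<^sub>t u\<^sub>t \<le> \<integral> \<eta> A \<nabla>u\<^sub>t \<bullet> \<nabla>u\<^sub>s\<close>, with equality for \<open>s = t\<close>: the blow-ups move along a backward gradient flow.
  With \<open>G t = \<integral> \<psi> u\<^sub>t\<^sup>2\<close> the right-hand side is at most \<open>(G' s + G' t) / 4\<close>, and this alone forces \<open>G\<close> to be
  log-convex. The argument uses first derivatives only and is therefore stable: by Morrey's estimate the
  coefficients are \<open>O(r\<^sup>\<gamma>)\<close>-close to \<open>A\<close> at scale \<open>r\<close>, and by the Caccioppoli inequality log-convexity holds up to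
  errors \<open>O(r\<^sup>\<gamma>\<^sup>/\<^sup>2)\<close> relative to \<open>G\<close> at a comparable larger scale. These errors are summable over geometric scales, so a
  bound on the growth of \<open>G\<close> at one small scale persists at all smaller ones, and finite vanishing order
  provides such a scale.
\<close>

section \<open>Elliptic quadratic forms\<close>

text \<open>Why the flow inequality alone gives log-convexity: let F(s, t) be the
  \<open>\<psi>\<close>-weighted product of \<open>u s\<close> and \<open>u t\<close>, so that F(t,
  t) = G t. Integrating the bound on its derivative in the second variable over [t - h, t] compares
  G t with F(t, t - h), and Cauchy-Schwarz with a weight \<rho> removes F. For \<rho> = exp (- N h)
  the result says that the derivative of exp (- 2 N t) G t is at least its own backward difference
  quotient, up to higher order in h; holding for all N, this is log-convexity. The errors shape the
  rest. Gradients on the support of \<open>\<psi>\<close> are only controlled by a mass on a larger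
  set, so the error at one scale is relative to G at a larger scale and could dominate if G decayed
  fast. It can be absorbed once two consecutive ratios of G are bounded, which is why the argument
  along geometric scales carries two ratios at a time and first has to find a scale where both are
  bounded.\<close>

lemma sym_matrix_inner:
  fixes A :: "real^'m^'m"
  assumes "transpose A = A"
  shows "(A *v x) \<bullet> y = x \<bullet> (A *v y)"
  by (metis assms dot_lmul_matrix vector_transpose_matrix)

text \<open>A null vector minimises the form, so the first variation 2 t |A v|^2 in the direction A
  v has to vanish.\<close>

lemma psd_form_zero_imp_kernel:
  fixes A :: "real^'m^'m"
  assumes sym: "transpose A = A"
    and psd: "\<And>x. 0 \<le> x \<bullet> (A *v x)"
    and z: "v \<bullet> (A *v v) = 0"
  shows "A *v v = 0"
proof -
  define u where "u = A *v v"
  have "u \<bullet> u = 0"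
  proof (rule ccontr)
    assume "u \<bullet> u \<noteq> 0"
    then have pos: "u \<bullet> u > 0" by simp
    define c where "c = u \<bullet> (A *v u)"
    have c0: "c \<ge> 0" using psd by (simp add: c_def)
    \<comment> \<open>The quadratic in t is minimal at - (u \<bullet> u) / c; the 1 in the
      denominator covers c = 0 and keeps the value negative.\<close>
    define t where "t = - (u \<bullet> u) / (c + 1)"
    have "(v + t *\<^sub>R u) \<bullet> (A *v (v + t *\<^sub>R u)) = v \<bullet> (A *v v) + t * (v \<bullet> (A *v u)) + t * (u \<bullet> (A *v v)) + t\<^sup>2 * c"
      by (simp add: matrix_vector_right_distrib matrix_vector_mult_scaleR inner_add_left inner_add_right c_def power2_eq_square algebra_simps)
    also have "v \<bullet> (A *v u) = u \<bullet> u" using sym_matrix_inner[OF sym, of v u] by (simp add: u_def inner_commute)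
    also have "u \<bullet> (A *v v) = u \<bullet> u" by (simp add: u_def)
    finally have "0 \<le> 2 * t * (u \<bullet> u) + t\<^sup>2 * c" using psd[of "v + t *\<^sub>R u"] z by simp
    also have "\<dots> = (u \<bullet> u)\<^sup>2 * (- 2 / (c+1) + c / (c+1)\<^sup>2)"
      by (simp add: t_def power2_eq_square algebra_simps)
    also have "- 2 / (c+1) + c / (c+1)\<^sup>2 = (- c - 2) / (c+1)\<^sup>2"
      using c0 by (simp add: power2_eq_square divide_simps)
    finally have "0 \<le> (u \<bullet> u)\<^sup>2 * ((- c - 2) / (c+1)\<^sup>2)" .
    moreover have "(- c - 2) / (c+1)\<^sup>2 < 0" using c0 by (intro divide_neg_pos) auto
    ultimately show False using pos by (smt (verit) mult_pos_neg zero_less_power)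
  qed
  then show ?thesis by (simp add: u_def)
qed

lemma matrix_minus_scaled_id: "(A - m *\<^sub>R mat 1) *v x = A *v x - m *\<^sub>R (x::real^'m)"
  by (simp add: matrix_vector_mult_diff_rdistrib scaleR_matrix_vector_assoc[symmetric])

text \<open>The minimum m of the Rayleigh quotient is an eigenvalue: A - m I is positive
  semidefinite and its form vanishes at a minimiser, which therefore lies in the kernel.\<close>

lemma min_eigenvector:
  fixes A :: "real^'m^'m"
  assumes sym: "transpose A = A"
  obtains v m where "v \<noteq> 0" "A *v v = m *\<^sub>R v" "\<And>x. m * (x \<bullet> x) \<le> x \<bullet> (A *v x)"
proof -
  have "sphere (0::real^'m) 1 \<noteq> {}" by simp
  moreover have "continuous_on (sphere (0::real^'m) 1) (\<lambda>x. x \<bullet> (A *v x))"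
    by (intro continuous_intros matrix_vector_mult_linear_continuous_on)
  ultimately obtain v where v: "norm v = 1" and mn: "\<And>x. norm x = 1 \<Longrightarrow> v \<bullet> (A *v v) \<le> x \<bullet> (A *v x)"
    using continuous_attains_inf[of "sphere (0::real^'m) 1" "\<lambda>x. x \<bullet> (A *v x)"] by auto
  define m where "m = v \<bullet> (A *v v)"
  have low: "m * (x \<bullet> x) \<le> x \<bullet> (A *v x)" for x
  proof (cases "x = 0")
    case False
    have "m \<le> (x /\<^sub>R norm x) \<bullet> (A *v (x /\<^sub>R norm x))" unfolding m_def by (rule mn) (simp add: False)
    also have "\<dots> = (x \<bullet> (A *v x)) / (x \<bullet> x)"
      by (simp add: matrix_vector_mult_scaleR dot_square_norm power2_eq_square divide_simps)
    finally show ?thesis using False by (simp add: pos_le_divide_eq)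
  qed auto
  define A' where "A' = A - m *\<^sub>R mat 1"
  have A': "A' *v x = A *v x - m *\<^sub>R x" for x by (simp add: A'_def matrix_minus_scaled_id)
  have "transpose A' = A'"
    using sym unfolding A'_def transpose_def vec_eq_iff mat_def by (auto simp: eq_commute)
  moreover have "0 \<le> x \<bullet> (A' *v x)" for x using low[of x] by (simp add: A' inner_diff_right)
  moreover have "v \<bullet> (A' *v v) = 0" using v by (simp add: A' inner_diff_right m_def dot_square_norm)
  ultimately have "A' *v v = 0" by (rule psd_form_zero_imp_kernel)
  then have "A *v v = m *\<^sub>R v" by (simp add: A')
  moreover have "v \<noteq> 0" using v by auto
  ultimately show ?thesis using low that by blast
qed

text \<open>Ellipticity of the coefficients is assumed for eigenvalues but used for quadratic forms.
  The extremal values of the form on the sphere are eigenvalues; the largest one is found by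
  minimising for - A.\<close>

lemma eigenvalue_bounds_imp_form_bounds:
  fixes A :: "real^'m^'m"
  assumes sym: "transpose A = A"
    and ev: "\<And>\<mu> v. v \<noteq> 0 \<Longrightarrow> A *v v = \<mu> *\<^sub>R v \<Longrightarrow> l \<le> \<mu> \<and> \<mu> \<le> L"
  shows "l * (x \<bullet> x) \<le> x \<bullet> (A *v x)" "x \<bullet> (A *v x) \<le> L * (x \<bullet> x)"
proof -
  obtain v m where v: "v \<noteq> 0" "A *v v = m *\<^sub>R v" "\<And>x. m * (x \<bullet> x) \<le> x \<bullet> (A *v x)"
    using min_eigenvector[OF sym] by metis
  have "l \<le> m" using ev v by blast
  then show "l * (x \<bullet> x) \<le> x \<bullet> (A *v x)"
    using v(3)[of x] by (meson inner_ge_zero mult_right_mono order_trans)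
  have neg: "(- A) *v x = - (A *v x)" for x
    by (simp add: matrix_vector_mult_def vec_eq_iff sum_negf)
  have symn: "transpose (- A) = - A" using sym by (simp add: transpose_def vec_eq_iff)
  obtain v' m' where v': "v' \<noteq> 0" "(- A) *v v' = m' *\<^sub>R v'" "\<And>x. m' * (x \<bullet> x) \<le> x \<bullet> ((- A) *v x)"
    using min_eigenvector[OF symn] by metis
  have "A *v v' = (- m') *\<^sub>R v'" using v'(2) by (simp add: neg) (metis minus_equation_iff)
  then have "- m' \<le> L" using ev v' by blast
  then have "- m' * (x \<bullet> x) \<le> L * (x \<bullet> x)" by (meson inner_ge_zero mult_right_mono)
  then show "x \<bullet> (A *v x) \<le> L * (x \<bullet> x)"
    using v'(3)[of x] by (simp add: neg)
qed

lemma psd_Cauchy_Schwarz: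
  fixes A :: "real^'m^'m"
  assumes sym: "transpose A = A" and psd: "\<And>x. 0 \<le> x \<bullet> (A *v x)"
  shows "2 * ((A *v x) \<bullet> y) \<le> (A *v x) \<bullet> x + (A *v y) \<bullet> y"
proof -
  have "0 \<le> (x - y) \<bullet> (A *v (x - y))" by (rule psd)
  also have "\<dots> = (A *v x) \<bullet> x + (A *v y) \<bullet> y - 2 * ((A *v x) \<bullet> y)"
    using sym_matrix_inner[OF sym, of x y]
    by (simp add: matrix_vector_mult_diff_distrib inner_diff_left inner_diff_right inner_commute)
  finally show ?thesis by simp
qed

text \<open>Cauchy-Schwarz for the form, applied to x and A x / L; with the weight 1 / L half of the
  left-hand side absorbs the term |A x|^2 / L.\<close>

lemma form_bound_imp_norm_bound:
  fixes A :: "real^'m^'m"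
  assumes sym: "transpose A = A" and psd: "\<And>x. 0 \<le> x \<bullet> (A *v x)"
    and up: "\<And>x. x \<bullet> (A *v x) \<le> L * (x \<bullet> x)" and L: "L > 0"
  shows "(A *v x) \<bullet> (A *v x) \<le> L * (x \<bullet> (A *v x))" "norm (A *v x) \<le> L * norm x"
proof -
  let ?y = "A *v x"
  have "2 * (?y \<bullet> ((1/L) *\<^sub>R ?y)) \<le> ?y \<bullet> x + (A *v ((1/L) *\<^sub>R ?y)) \<bullet> ((1/L) *\<^sub>R ?y)"
    by (rule psd_Cauchy_Schwarz[OF sym psd])
  also have "(A *v ((1/L) *\<^sub>R ?y)) \<bullet> ((1/L) *\<^sub>R ?y) = (1/L)\<^sup>2 * (?y \<bullet> (A *v ?y))"
    by (simp add: matrix_vector_mult_scaleR power2_eq_square inner_commute)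
  also have "\<dots> \<le> (1/L)\<^sup>2 * (L * (?y \<bullet> ?y))" by (intro mult_left_mono up) simp
  also have "\<dots> = (1/L) * (?y \<bullet> ?y)" using L by (simp add: power2_eq_square)
  finally have "(1/L) * (?y \<bullet> ?y) \<le> ?y \<bullet> x" by simp
  then show *: "?y \<bullet> ?y \<le> L * (x \<bullet> ?y)" using L by (simp add: divide_simps inner_commute mult.commute)
  have "norm ?y * norm ?y \<le> L * (norm x * norm ?y)"
    using * Cauchy_Schwarz_ineq2[of x ?y] L
    by (smt (verit) dot_square_norm mult_left_mono power2_eq_square norm_cauchy_schwarz)
  then show "norm ?y \<le> L * norm x"
    by (cases "norm ?y = 0") (use L in \<open>auto simp: mult.assoc[symmetric]\<close>)
qed

text \<open>Ellipticity with constants 1/2 and 2 survives inversion: with z = B x, the lower bound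
  for B is |A z|^2 \<le> 2 z \<bullet> A z, and the norm bound is the lower bound for A at
  z.\<close>

lemma elliptic_inverse:
  fixes A :: "real^'m^'m"
  assumes sym: "transpose A = A"
    and lo: "\<And>x. (x \<bullet> x) / 2 \<le> x \<bullet> (A *v x)" and up: "\<And>x. x \<bullet> (A *v x) \<le> 2 * (x \<bullet> x)"
  obtains B where "transpose B = B" "\<And>x. A *v (B *v x) = x" "\<And>x. (x \<bullet> x) / 2 \<le> x \<bullet> (B *v x)"
    "\<And>x. norm (B *v x) \<le> 2 * norm x"
proof -
  have psd: "0 \<le> x \<bullet> (A *v x)" for x using lo[of x] by (smt (verit) divide_nonneg_nonneg inner_ge_zero)
  have "inj ((*v) A)"
  proof (subst vec.inj_iff_eq_0, intro allI impI)
    fix x assume "A *v x = 0"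
    then show "x = 0" using lo[of x] by simp (smt (verit) inner_gt_zero_iff)
  qed
  then have inv: "invertible A"
    using matrix_left_invertible_injective invertible_left_inverse by blast
  obtain B where B: "A ** B = mat 1" "B ** A = mat 1"
    using inv unfolding invertible_def by blast
  have AB: "A *v (B *v x) = x" for x
    by (simp add: matrix_vector_mul_assoc B)
  have "transpose B = transpose B ** (A ** B)" by (simp add: B)
  also have "\<dots> = (transpose B ** transpose A) ** B" by (simp add: matrix_mul_assoc sym)
  also have "\<dots> = B" by (simp add: matrix_transpose_mul[symmetric] B)
  finally have symB: "transpose B = B" .
  have lowB: "(x \<bullet> x) / 2 \<le> x \<bullet> (B *v x)" for x
    using form_bound_imp_norm_bound(1)[OF sym psd up, of "B *v x"] by (simp add: AB inner_commute)
  have "norm (B *v x) \<le> 2 * norm x" for x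
  proof -
    have "norm (B *v x) * norm (B *v x) / 2 \<le> norm (B *v x) * norm x"
      using lo[of "B *v x"] norm_cauchy_schwarz[of "B *v x" x] by (simp add: AB dot_square_norm power2_eq_square)
    then have "norm (B *v x) * norm (B *v x) \<le> norm (B *v x) * (2 * norm x)" by simp
    then show ?thesis by (cases "norm (B *v x) = 0") (auto dest: mult_left_le_imp_le)
  qed
  then show ?thesis using that symB AB lowB by blast
qed

section \<open>Smooth bump functions\<close>

lemma partial_UNIV_eq:
  assumes "(f has_derivative f') (at x)"
  shows "partial k UNIV f x = f' (axis k 1)"
  unfolding partial_def using frechet_derivative_at[OF assms] by simp

lemma Ck_SucI:
  assumes "\<And>x. (f has_derivative f' x) (at x)" "\<And>k. Ck m (\<lambda>x. f' x (axis k 1))"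
  shows "Ck (Suc m) f"
proof -
  have "partial k UNIV f = (\<lambda>x. f' x (axis k 1))" for k
    using partial_UNIV_eq[OF assms(1)] by blast
  then show ?thesis
    using assms by (auto simp: differentiable_on_def differentiable_def)
qed

lemma Ck_SucD:
  assumes "Ck (Suc m) f"
  obtains f' where "\<And>x. (f has_derivative f' x) (at x)" "\<And>k. Ck m (\<lambda>x. f' x (axis k 1))"
proof
  show d: "(f has_derivative frechet_derivative f (at x)) (at x)" for x
    using assms by (simp add: differentiable_on_def frechet_derivative_works)
  show "Ck m (\<lambda>x. frechet_derivative f (at x) (axis k 1))" for k
  proof -
    have "(\<lambda>x. frechet_derivative f (at x) (axis k 1)) = partial k UNIV f"
      by (rule ext) (simp add: partial_def)
    then show ?thesis using assms by simp
  qed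
qed

lemma Ck_Suc_imp: "Ck (Suc m) f \<Longrightarrow> Ck m f"
proof (induction m arbitrary: f)
  case 0
  then show ?case by (simp add: differentiable_imp_continuous_on)
next
  case (Suc m)
  then show ?case by (metis Ck.simps(2))
qed

lemma Ck_const: "Ck m (\<lambda>x. c)"
proof (induction m arbitrary: c)
  case (Suc m)
  show ?case by (rule Ck_SucI[where f'="\<lambda>x h. 0"]) (use Suc in auto)
qed simp

lemma Ck_add: "Ck m f \<Longrightarrow> Ck m g \<Longrightarrow> Ck m (\<lambda>x. f x + g x)"
proof (induction m arbitrary: f g)
  case 0
  then show ?case by (auto intro: continuous_intros)
next
  case (Suc m)
  obtain f' where f': "\<And>x. (f has_derivative f' x) (at x)" "\<And>k. Ck m (\<lambda>x. f' x (axis k 1))"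
    using Ck_SucD[OF Suc.prems(1)] by metis
  obtain g' where g': "\<And>x. (g has_derivative g' x) (at x)" "\<And>k. Ck m (\<lambda>x. g' x (axis k 1))"
    using Ck_SucD[OF Suc.prems(2)] by metis
  show ?case
    by (rule Ck_SucI[where f'="\<lambda>x h. f' x h + g' x h"]) (auto intro!: derivative_intros f' g' Suc.IH)
qed

lemma Ck_mult: "Ck m f \<Longrightarrow> Ck m g \<Longrightarrow> Ck m (\<lambda>x. f x * g x)"
proof (induction m arbitrary: f g)
  case 0
  then show ?case by (auto intro: continuous_intros)
next
  case (Suc m)
  obtain f' where f': "\<And>x. (f has_derivative f' x) (at x)" "\<And>k. Ck m (\<lambda>x. f' x (axis k 1))"
    using Ck_SucD[OF Suc.prems(1)] by metis
  obtain g' where g': "\<And>x. (g has_derivative g' x) (at x)" "\<And>k. Ck m (\<lambda>x. g' x (axis k 1))"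
    using Ck_SucD[OF Suc.prems(2)] by metis
  show ?case
    by (rule Ck_SucI[where f'="\<lambda>x h. f x * g' x h + f' x h * g x"])
      (auto intro!: derivative_intros f' g' Suc.IH Ck_add Ck_Suc_imp[OF Suc.prems(1)] Ck_Suc_imp[OF Suc.prems(2)])
qed

lemma Ck_inner: "Ck m (\<lambda>x. x \<bullet> c)"
proof (cases m)
  case (Suc n)
  have "Ck (Suc n) (\<lambda>x. x \<bullet> c)"
    by (rule Ck_SucI[where f'="\<lambda>x h. h \<bullet> c"]) (auto intro!: derivative_eq_intros Ck_const)
  then show ?thesis using Suc by simp
qed (auto intro!: continuous_intros)

lemma Ck_affine: "Ck m f \<Longrightarrow> Ck m (\<lambda>x. f (c *\<^sub>R x + b))"
proof (induction m arbitrary: f)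
  case 0
  then show ?case by (auto intro!: continuous_on_compose2[of UNIV f] continuous_intros)
next
  case (Suc m)
  obtain f' where f': "\<And>x. (f has_derivative f' x) (at x)" "\<And>k. Ck m (\<lambda>x. f' x (axis k 1))"
    using Ck_SucD[OF Suc.prems(1)] by metis
  have lin: "f' y (c *\<^sub>R h) = c * f' y h" for y h
    using f'(1)[of y] by (simp add: has_derivative_def linear_cmul bounded_linear.linear)
  show ?case
  proof (rule Ck_SucI[where f'="\<lambda>x h. c * f' (c *\<^sub>R x + b) h"])
    show "((\<lambda>x. f (c *\<^sub>R x + b)) has_derivative (\<lambda>h. c * f' (c *\<^sub>R x + b) h)) (at x)" for x
      by (rule has_derivative_eq_rhs[OF has_derivative_compose[of _ "\<lambda>h. c *\<^sub>R h", OF _ f'(1)]])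
        (auto intro!: derivative_eq_intros simp: lin)
    show "Ck m (\<lambda>x. c * f' (c *\<^sub>R x + b) (axis k 1))" for k
      by (intro Ck_mult Ck_const Suc.IH f'(2))
  qed
qed

text \<open>The flat function exp (- 1/s) with a polynomial factor in 1/s. The factor makes the
  family closed under differentiation, p turning into x^2 (p - p'), so smoothness of all members is
  one induction in which p varies.\<close>

definition flat_exp :: "real poly \<Rightarrow> real \<Rightarrow> real" where
  "flat_exp p s = (if s > 0 then poly p (1 / s) * exp (- (1 / s)) else 0)"

lemma poly_times_exp_minus_tendsto_0: "((\<lambda>x. poly p x * exp (- x)) \<longlongrightarrow> (0::real)) at_top"
proof -
  have "((\<lambda>x. \<Sum>i\<le>degree p. coeff p i * (x ^ i / exp x)) \<longlongrightarrow> (\<Sum>i\<le>degree p. coeff p i * 0)) at_top"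
    by (intro tendsto_intros tendsto_power_div_exp_0)
  then show ?thesis
    by (simp add: poly_altdef exp_minus sum_distrib_right divide_inverse mult.assoc)
qed

lemma flat_exp_tendsto_0: "(flat_exp p \<longlongrightarrow> 0) (at 0)"
proof (rule filterlim_split_at)
  have "((\<lambda>s. poly p (inverse s) * exp (- inverse s)) \<longlongrightarrow> 0) (at_right 0)"
    using poly_times_exp_minus_tendsto_0 filterlim_inverse_at_top_right by (rule filterlim_compose)
  moreover have "\<forall>\<^sub>F s in at_right 0. poly p (inverse s) * exp (- inverse s) = flat_exp p s"
    by (auto simp: eventually_at_right_field flat_exp_def inverse_eq_divide intro!: exI[of _ 1])
  ultimately show "(flat_exp p \<longlongrightarrow> 0) (at_right 0)" by (rule Lim_transform_eventually)
  have "\<forall>\<^sub>F s in at_left 0. 0 = flat_exp p s"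
    by (auto simp: eventually_at_left_field flat_exp_def intro!: exI[of _ "-1"])
  with tendsto_const show "(flat_exp p \<longlongrightarrow> 0) (at_left 0)" by (rule Lim_transform_eventually)
qed

lemma flat_exp_has_derivative:
  "(flat_exp p has_real_derivative flat_exp ([:0, 0, 1:] * (p - pderiv p)) s) (at s)"
proof -
  consider "s < 0" | "s = 0" | "s > 0" by linarith
  then show ?thesis
  proof cases
    case 1
    have "((\<lambda>_. 0) has_real_derivative 0) (at s)" by simp
    then have "(flat_exp p has_real_derivative 0) (at s)"
      by (rule has_field_derivative_transform_within_open[of _ _ _ "{..<0}"])
        (use 1 in \<open>auto simp: flat_exp_def\<close>)
    with 1 show ?thesis by (simp add: flat_exp_def)
  next
    case 2
    \<comment> \<open>At 0 the difference quotient stays in the family: dividing by h multiplies the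
      polynomial by x.\<close>
    have "flat_exp p h / h = flat_exp (pCons 0 p) h" for h
      by (auto simp: flat_exp_def)
    then show ?thesis unfolding 2 has_field_derivative_iff
      using flat_exp_tendsto_0[of "pCons 0 p"] by (simp add: flat_exp_def[of _ 0])
  next
    case 3
    have "((\<lambda>s. poly p (1/s) * exp (- (1/s))) has_real_derivative
        poly p (1/s) * (exp (- (1/s)) * (1/s^2)) + (poly (pderiv p) (1/s) * (- (1/s^2))) * exp (- (1/s))) (at s)"
      using 3 by (auto intro!: derivative_eq_intros DERIV_chain2[of "poly p", OF poly_DERIV] simp: power2_eq_square)
    then have "(flat_exp p has_real_derivative
        poly p (1/s) * (exp (- (1/s)) * (1/s^2)) + (poly (pderiv p) (1/s) * (- (1/s^2))) * exp (- (1/s))) (at s)"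
      by (rule has_field_derivative_transform_within_open[of _ _ _ "{0<..}"])
        (use 3 in \<open>auto simp: flat_exp_def\<close>)
    then show ?thesis using 3 by (simp add: flat_exp_def power2_eq_square algebra_simps)
  qed
qed

definition bump :: "(real^'n) \<Rightarrow> real \<Rightarrow> real^'n \<Rightarrow> real" where
  "bump z \<delta> x = flat_exp 1 (\<delta>\<^sup>2 - (x - z) \<bullet> (x - z))"

definition bump_grad :: "(real^'n) \<Rightarrow> real \<Rightarrow> real^'n \<Rightarrow> real^'n" where
  "bump_grad z \<delta> x = (- 2 * flat_exp [:0, 0, 1:] (\<delta>\<^sup>2 - (x - z) \<bullet> (x - z))) *\<^sub>R (x - z)"

lemma flat_exp_dist_has_derivative:
  "((\<lambda>x. flat_exp p (\<delta>\<^sup>2 - (x - z) \<bullet> (x - z))) has_derivative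
    (\<lambda>h. flat_exp ([:0, 0, 1:] * (p - pderiv p)) (\<delta>\<^sup>2 - (x - z) \<bullet> (x - z)) * (- 2 * ((x - z) \<bullet> h)))) (at x)"
  by (rule has_derivative_compose[of _ "\<lambda>h. - 2 * ((x - z) \<bullet> h)",
        OF _ flat_exp_has_derivative[unfolded has_field_derivative_def]])
    (auto intro!: derivative_eq_intros simp: inner_commute)

lemma Ck_flat_exp_dist: "Ck m (\<lambda>x. flat_exp p (\<delta>\<^sup>2 - (x - z) \<bullet> (x - z)))"
proof (induction m arbitrary: p)
  case 0
  have "(\<lambda>x. flat_exp p (\<delta>\<^sup>2 - (x - z) \<bullet> (x - z))) differentiable_on UNIV"
    unfolding differentiable_on_def differentiable_def
    using flat_exp_dist_has_derivative[of p \<delta> z] by blast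
  then show ?case by (simp add: differentiable_imp_continuous_on)
next
  case (Suc m)
  have "(\<lambda>x. - 2 * ((x - z) \<bullet> c)) = (\<lambda>x. (- 2) * (x \<bullet> c) + 2 * (z \<bullet> c))" for c
    by (simp add: inner_diff_left algebra_simps)
  then have "Ck m (\<lambda>x. - 2 * ((x - z) \<bullet> c))" for c
    using Ck_add[OF Ck_mult[OF Ck_const[of m "-2"] Ck_inner[of m c]] Ck_const[of m "2 * (z \<bullet> c)"]] by simp
  then show ?case
    by (intro Ck_SucI[OF flat_exp_dist_has_derivative] Ck_mult[OF Suc.IH])
qed

lemma Ck_bump: "Ck m (bump z \<delta>)"
  unfolding bump_def using Ck_flat_exp_dist by auto

lemma bump_has_derivative: "(bump z \<delta> has_derivative (\<lambda>h. bump_grad z \<delta> x \<bullet> h)) (at x)"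
  using flat_exp_dist_has_derivative[of 1 \<delta> z x] unfolding bump_def bump_grad_def
  by (simp add: fun_eq_iff mult_ac)

lemma sq_dist_less_iff: "\<delta> > 0 \<Longrightarrow> 0 < \<delta>\<^sup>2 - (x - z) \<bullet> (x - z) \<longleftrightarrow> norm (x - z) < \<delta>"
  for x z :: "real^'n"
proof -
  assume d: "\<delta> > 0"
  have "(x - z) \<bullet> (x - z) = (norm (x - z))\<^sup>2" by (rule dot_square_norm)
  then show ?thesis
    using d power_mono[of \<delta> "norm (x - z)" 2] power_strict_mono[of "norm (x - z)" \<delta> 2] by (smt (verit) norm_ge_zero zero_less_numeral)
qed

lemma bump_eq_0_iff: "\<delta> > 0 \<Longrightarrow> bump z \<delta> x = 0 \<longleftrightarrow> norm (x - z) \<ge> \<delta>"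
  by (auto simp: bump_def flat_exp_def sq_dist_less_iff[simplified] not_less)

lemma bump_nonneg: "bump z \<delta> x \<ge> 0"
  by (simp add: bump_def flat_exp_def)

lemma bump_grad_eq_0: "\<delta> > 0 \<Longrightarrow> norm (x - z) \<ge> \<delta> \<Longrightarrow> bump_grad z \<delta> x = 0"
  by (auto simp: bump_grad_def flat_exp_def sq_dist_less_iff[simplified] not_less)

lemma continuous_on_flat_exp [continuous_intros]:
  "continuous_on S g \<Longrightarrow> continuous_on S (\<lambda>x. flat_exp p (g x))"
  by (rule continuous_on_compose2[of UNIV "flat_exp p"])
    (auto intro!: continuous_at_imp_continuous_on DERIV_isCont flat_exp_has_derivative)

lemma continuous_on_bump [continuous_intros]:
  "continuous_on S f \<Longrightarrow> continuous_on S g \<Longrightarrow> continuous_on S (\<lambda>x. bump (g x) \<delta> (f x))"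
  unfolding bump_def by (intro continuous_intros)

lemma continuous_on_bump_grad [continuous_intros]:
  "continuous_on S f \<Longrightarrow> continuous_on S g \<Longrightarrow> continuous_on S (\<lambda>x. bump_grad (g x) \<delta> (f x))"
  unfolding bump_grad_def by (intro continuous_intros)

lemma test_function_if_support:
  assumes "\<And>m. Ck m \<phi>" "\<And>x. x \<notin> K \<Longrightarrow> \<phi> x = 0" "compact K" "K \<subseteq> U"
  shows "test_function U \<phi>"
proof -
  have "closure {x. \<phi> x \<noteq> 0} \<subseteq> K"
    using assms by (intro closure_minimal) (auto simp: compact_imp_closed)
  moreover from this have "compact (closure {x. \<phi> x \<noteq> 0})"
    using assms(3) by (meson bounded_subset closed_closure compact_eq_bounded_closed)
  ultimately show ?thesis
    using assms unfolding test_function_def by blast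
qed

section \<open>Weak equations tested with continuously differentiable functions\<close>

lemma lborel_integral_eq_cbox_integral:
  fixes f :: "'a::euclidean_space \<Rightarrow> real"
  assumes "continuous_on (cbox a b) f" "\<And>x. x \<notin> cbox a b \<Longrightarrow> f x = 0"
  shows "integrable lborel f" "integral\<^sup>L lborel f = integral (cbox a b) f"
proof -
  have eq: "(\<lambda>x. indicator (cbox a b) x *\<^sub>R f x) = f"
    using assms(2) by (auto simp: indicator_def fun_eq_iff)
  show i: "integrable lborel f"
    using borel_integrable_compact[OF compact_cbox assms(1)] by (simp only: eq)
  have "set_integrable lborel (cbox a b) f" unfolding set_integrable_def eq by (rule i)
  from set_borel_integral_eq_integral(2)[OF this] show "integral\<^sup>L lborel f = integral (cbox a b) f"
    unfolding set_lebesgue_integral_def eq .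
qed

lemma lborel_integral_translate:
  fixes f :: "'a::euclidean_space \<Rightarrow> real"
  assumes "f \<in> borel_measurable borel"
  shows "(\<integral>x. f (c + x) \<partial>lborel) = integral\<^sup>L lborel f"
  using integral_distr[of "(+) c" lborel borel f] assms by (simp add: lborel_distr_plus)

lemma derivative_zero_outside_closed:
  fixes g :: "real^'m \<Rightarrow> real^'m"
  assumes "\<And>x. (F has_derivative (\<lambda>h. g x \<bullet> h)) (at x)" "closed K" "\<And>x. x \<notin> K \<Longrightarrow> F x = (0::real)" "x \<notin> K"
  shows "g x = 0"
proof -
  have "((\<lambda>_. 0) has_derivative (\<lambda>h. g x \<bullet> h)) (at x)"
    by (rule has_derivative_transform_within_open[OF assms(1), of "- K"]) (use assms in auto)
  then have "(\<lambda>h. g x \<bullet> h) = (\<lambda>_. 0)" using has_derivative_unique[OF _ has_derivative_const] by blast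
  then show ?thesis by (metis inner_eq_zero_iff)
qed

text \<open>Translation invariance: the integral of F (x + t e) does not depend on t, and its
  derivative at t = 0 is the integral of G \<bullet> e.\<close>

lemma integral_gradient_eq_0:
  fixes G :: "real^'m \<Rightarrow> real^'m" and F :: "real^'m \<Rightarrow> real"
  assumes dF: "\<And>x. (F has_derivative (\<lambda>h. G x \<bullet> h)) (at x)" and contG: "continuous_on UNIV G"
    and supp: "\<And>x. x \<notin> cbox a b \<Longrightarrow> F x = 0"
  shows "integral (cbox a b) (\<lambda>x. G x \<bullet> e) = 0"
proof -
  \<comment> \<open>Enlarged by norm e, the box contains the supports of all translates with
    \<bar>t\<bar> \<le> 1, so one domain of integration serves for all these t.\<close>
  define a' where "a' = a - (\<chi> i. norm e)"
  define b' where "b' = b + (\<chi> i. norm e)"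
  have contF: "continuous_on UNIV F"
    using dF by (meson continuous_at_imp_continuous_on has_derivative_continuous)
  have sub: "cbox a b \<subseteq> cbox a' b'"
    by (auto simp: mem_box_cart a'_def b'_def intro: order_trans add_increasing2 diff_left_mono) (smt (verit) norm_ge_zero)+
  have out: "F (x + t *\<^sub>R e) = 0" if "x \<notin> cbox a' b'" "\<bar>t\<bar> \<le> 1" for x t
  proof (rule supp, rule notI)
    assume in1: "x + t *\<^sub>R e \<in> cbox a b"
    have "\<bar>(t *\<^sub>R e) $ i\<bar> \<le> norm e" for i
    proof -
      have "\<bar>(t *\<^sub>R e) $ i\<bar> \<le> norm (t *\<^sub>R e)" by (rule component_le_norm_cart)
      also have "\<dots> \<le> norm e" using that(2) by (simp add: mult_left_le_one_le)
      finally show ?thesis .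
    qed
    then have "x \<in> cbox a' b'"
      using in1 by (auto simp: mem_box_cart a'_def b'_def abs_le_iff) (smt (verit))+
    then show False using that by simp
  qed
  let ?U = "{-1..1::real}"
  have "((\<lambda>t. integral (cbox a' b') (\<lambda>x. F (x + t *\<^sub>R e))) has_field_derivative
      integral (cbox a' b') (\<lambda>x. G (x + 0 *\<^sub>R e) \<bullet> e)) (at 0 within ?U)"
  proof (rule leibniz_rule_field_derivative)
    show "((\<lambda>t. F (x + t *\<^sub>R e)) has_real_derivative G (x + t *\<^sub>R e) \<bullet> e) (at t within ?U)" for t x
      unfolding has_field_derivative_def
      by (rule has_derivative_eq_rhs[OF has_derivative_compose[of _ "\<lambda>h. h *\<^sub>R e", OF _ dF]])
        (auto intro!: derivative_eq_intros)
    show "(\<lambda>x. F (x + t *\<^sub>R e)) integrable_on cbox a' b'" for t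
      by (intro integrable_continuous continuous_on_compose2[OF contF] continuous_intros) auto
    show "continuous_on (?U \<times> cbox a' b') (\<lambda>(t, x). G (x + t *\<^sub>R e) \<bullet> e)"
      unfolding case_prod_beta
      by (intro continuous_intros continuous_on_compose2[OF contG]) auto
  qed auto
  moreover have "at (0::real) within ?U = at 0" by (rule at_within_interior) simp
  ultimately have d: "((\<lambda>t. integral (cbox a' b') (\<lambda>x. F (x + t *\<^sub>R e))) has_field_derivative
      integral (cbox a' b') (\<lambda>x. G x \<bullet> e)) (at 0)" by simp
  have "integral (cbox a' b') (\<lambda>x. F (x + t *\<^sub>R e)) = integral\<^sup>L lborel F" if "t \<in> {-1<..<1}" for t
  proof -
    have "integral (cbox a' b') (\<lambda>x. F (x + t *\<^sub>R e)) = (\<integral>x. F (x + t *\<^sub>R e) \<partial>lborel)"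
      using that by (intro lborel_integral_eq_cbox_integral(2)[symmetric]
         continuous_on_compose2[OF contF] continuous_intros out) auto
    also have "\<dots> = (\<integral>x. F (t *\<^sub>R e + x) \<partial>lborel)" by (simp add: add.commute)
    also have "\<dots> = integral\<^sup>L lborel F"
      by (rule lborel_integral_translate) (intro borel_measurable_continuous_onI contF)
    finally show ?thesis .
  qed
  then have "((\<lambda>t. integral\<^sup>L lborel F) has_field_derivative integral (cbox a' b') (\<lambda>x. G x \<bullet> e)) (at 0)"
    by (intro has_field_derivative_transform_within_open[OF d, of "{-1<..<1}"]) auto
  then have 0: "integral (cbox a' b') (\<lambda>x. G x \<bullet> e) = 0"
    using DERIV_unique DERIV_const by blast
  have Gz: "G x = 0" if "x \<notin> cbox a b" for x
    using derivative_zero_outside_closed[OF dF _ supp] that by auto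
  have "integral (cbox a b) (\<lambda>x. G x \<bullet> e) = (\<integral>x. G x \<bullet> e \<partial>lborel)"
    using Gz by (intro lborel_integral_eq_cbox_integral(2)[symmetric] continuous_intros continuous_on_subset[OF contG]) auto
  also have "\<dots> = integral (cbox a' b') (\<lambda>x. G x \<bullet> e)"
  proof (rule lborel_integral_eq_cbox_integral(2))
    show "continuous_on (cbox a' b') (\<lambda>x. G x \<bullet> e)"
      by (intro continuous_intros continuous_on_subset[OF contG]) auto
    show "G x \<bullet> e = 0" if "x \<notin> cbox a' b'" for x
    proof -
      have "x \<notin> cbox a b" using sub that by (meson subsetD)
      then show ?thesis using Gz by simp
    qed
  qed
  finally show ?thesis using 0 by simp
qed

lemma bump_commute: "bump z \<delta> x = bump x \<delta> z"
  unfolding bump_def by (metis dot_square_norm norm_minus_commute)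

lemma bump_grad_commute: "bump_grad z \<delta> x = - bump_grad x \<delta> z"
proof -
  have "(x - z) \<bullet> (x - z) = (z - x) \<bullet> (z - x)" by (metis dot_square_norm norm_minus_commute)
  then show ?thesis by (simp add: bump_grad_def) (metis minus_diff_eq scaleR_minus_right)
qed

text \<open>The bumps are not normalised; their common mass is divided out where they approximate
  the identity.\<close>

definition bump_mass :: "'m::finite itself \<Rightarrow> real \<Rightarrow> real" where
  "bump_mass _ \<delta> = (\<integral>x. bump (0::real^'m) \<delta> x \<partial>lborel)"

lemma bump_integral:
  fixes z :: "real^'m"
  assumes "\<delta> > 0" "cball z \<delta> \<subseteq> cbox a b"
  shows "integral (cbox a b) (bump z \<delta>) = bump_mass TYPE('m) \<delta>"
proof -
  have cont: "continuous_on A (bump w \<delta>)" for A and w :: "real^'m"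
    by (intro continuous_intros)
  have "integral (cbox a b) (bump z \<delta>) = (\<integral>x. bump z \<delta> x \<partial>lborel)"
    using assms by (intro lborel_integral_eq_cbox_integral(2)[symmetric] cont)
      (use assms in \<open>auto simp: bump_eq_0_iff dist_norm norm_minus_commute subset_iff intro: ccontr\<close>)
  also have "\<dots> = (\<integral>x. bump 0 \<delta> (- z + x) \<partial>lborel)" by (simp add: bump_def)
  also have "\<dots> = bump_mass TYPE('m) \<delta>"
    unfolding bump_mass_def by (rule lborel_integral_translate) (intro borel_measurable_continuous_onI cont)
  finally show ?thesis .
qed

lemma bump_mass_pos:
  assumes "\<delta> > 0"
  shows "bump_mass TYPE('m::finite) \<delta> > 0"
proof -
  define c :: "real^'m" where "c = (\<chi> i. \<delta>)"
  have "cball (0::real^'m) \<delta> \<subseteq> cbox (- c) c"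
  proof
    fix x :: "real^'m" assume "x \<in> cball 0 \<delta>"
    then have "\<bar>x $ i\<bar> \<le> \<delta>" for i using component_le_norm_cart[of x i] by simp
    then show "x \<in> cbox (- c) c" by (auto simp: mem_box_cart c_def abs_le_iff minus_le_iff)
  qed
  then have eq: "integral (cbox (- c) c) (bump (0::real^'m) \<delta>) = bump_mass TYPE('m) \<delta>"
    by (rule bump_integral[OF assms])
  have "integral (cbox (- c) c) (bump (0::real^'m) \<delta>) \<ge> 0"
    by (intro integral_nonneg integrable_continuous continuous_intros) (auto simp: bump_nonneg)
  moreover have "integral (cbox (- c) c) (bump (0::real^'m) \<delta>) \<noteq> 0"
  proof
    assume "integral (cbox (- c) c) (bump (0::real^'m) \<delta>) = 0"
    moreover have "box (- c) c \<noteq> {}" using assms by (auto simp: interval_ne_empty_cart c_def)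
    ultimately have "\<forall>x\<in>cbox (- c) c. bump 0 \<delta> x = 0"
      by (subst (asm) integral_cbox_eq_0_iff) (auto intro!: continuous_intros simp: bump_nonneg)
    moreover have "0 \<in> cbox (- c) c" using assms by (simp add: mem_box_cart c_def)
    ultimately show False using assms bump_eq_0_iff[of \<delta> 0 0] by auto
  qed
  ultimately show ?thesis using eq by linarith
qed

text \<open>Mollification without forming a mollified test function: the equation is tested with
  single bumps centred at z, multiplied by \<phi> z and integrated over z. Integration by parts in z
  moves the gradient onto \<phi>, and shrinking the bumps then uses only the uniform continuity of
  V.\<close>

lemma weak_equation_C1:
  fixes V :: "('n::finite) space \<Rightarrow> 'n space"
  assumes contV: "continuous_on (cbox a b) V"
    and weak: "\<And>\<psi>. test_function (box a b) \<psi> \<Longrightarrow>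
      integral (cbox a b) (\<lambda>x. \<Sum>i\<in>UNIV. V x $ i * partial i UNIV \<psi> x) = 0"
    and d\<phi>: "\<And>x. (\<phi> has_derivative (\<lambda>h. g x \<bullet> h)) (at x)" and contg: "continuous_on UNIV g"
    and K: "compact K" "K \<subseteq> box a b" and supp: "\<And>x. x \<notin> K \<Longrightarrow> \<phi> x = 0"
  shows "integral (cbox a b) (\<lambda>x. V x \<bullet> g x) = 0"
proof -
  let ?B = "cbox a b"
  have cont\<phi>: "continuous_on UNIV \<phi>"
    using d\<phi> by (meson continuous_at_imp_continuous_on has_derivative_continuous)
  have g0: "g x = 0" if "x \<notin> K" for x
    using derivative_zero_outside_closed[OF d\<phi> compact_imp_closed[OF K(1)] supp that] .
  obtain d0 where "d0 > 0" and sub: "(\<Union>x\<in>K. cball x d0) \<subseteq> box a b"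
    by (rule compact_subset_open_imp_cball_epsilon_subset[OF K(1) open_box K(2)])
  then have d0: "d0 > 0" "\<And>z. z \<in> K \<Longrightarrow> cball z d0 \<subseteq> box a b" by auto
  have cg: "continuous_on S (\<lambda>x. g (h x))" if "continuous_on S h" for S and h :: "'b::topological_space \<Rightarrow> 'n space"
    using continuous_on_compose2[OF contg that] by auto
  have cp: "continuous_on S (\<lambda>x. \<phi> (h x))" if "continuous_on S h" for S and h :: "'b::topological_space \<Rightarrow> 'n space"
    using continuous_on_compose2[OF cont\<phi> that] by auto
  have cV: "continuous_on S (\<lambda>x. V (h x))" if "continuous_on S h" "\<And>x. x \<in> S \<Longrightarrow> h x \<in> ?B"
    for S and h :: "'b::topological_space \<Rightarrow> 'n space"
    using continuous_on_compose2[OF contV that(1)] that(2) by auto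
  let ?I = "integral ?B (\<lambda>x. V x \<bullet> g x)"
  have main: "\<bar>?I\<bar> \<le> \<epsilon> * integral ?B (\<lambda>x. norm (g x))" if e: "\<epsilon> > 0" for \<epsilon>
  proof -
    have "uniformly_continuous_on ?B V" using contV compact_cbox by (rule compact_uniformly_continuous)
    then obtain d1 where d1: "d1 > 0" "\<And>x z. x \<in> ?B \<Longrightarrow> z \<in> ?B \<Longrightarrow> dist x z < d1 \<Longrightarrow> dist (V x) (V z) < \<epsilon>"
      by (rule uniformly_continuous_onE[OF _ e]) (metis dist_commute)
    define \<delta> where "\<delta> = min d0 d1"
    have \<delta>: "\<delta> > 0" "\<delta> \<le> d0" "\<delta> \<le> d1" using d0 d1 by (auto simp: \<delta>_def)
    define c where "c = bump_mass TYPE('n option) \<delta>"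
    have c: "c > 0" unfolding c_def by (rule bump_mass_pos[OF \<delta>(1)])
    have cbl: "cball z \<delta> \<subseteq> box a b" if "z \<in> K" for z using d0(2)[OF that] \<delta>(2) by auto
    have test: "test_function (box a b) (bump z \<delta>)" if "z \<in> K" for z
      by (rule test_function_if_support[where K="cball z \<delta>"])
        (use Ck_bump cbl that \<delta>(1) in \<open>auto simp: bump_eq_0_iff dist_norm norm_minus_commute\<close>)
    have T: "integral ?B (\<lambda>x. V x \<bullet> bump_grad z \<delta> x) = 0" if "z \<in> K" for z
    proof -
      have "(\<lambda>x. \<Sum>i\<in>UNIV. V x $ i * partial i UNIV (bump z \<delta>) x) = (\<lambda>x. V x \<bullet> bump_grad z \<delta> x)"
        by (simp add: partial_UNIV_eq[OF bump_has_derivative] inner_axis inner_vec_def[of "V _"])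
      then show ?thesis using weak[OF test[OF that]] by simp
    qed
    have "integral ?B (\<lambda>z. integral ?B (\<lambda>x. \<phi> z * (V x \<bullet> bump_grad z \<delta> x))) = integral ?B (\<lambda>z. 0)"
    proof (rule integral_cong)
      fix z
      show "integral ?B (\<lambda>x. \<phi> z * (V x \<bullet> bump_grad z \<delta> x)) = 0"
        using T[of z] supp[of z] by (cases "z \<in> K") auto
    qed
    then have "0 = integral ?B (\<lambda>z. integral ?B (\<lambda>x. \<phi> z * (V x \<bullet> bump_grad z \<delta> x)))" by simp
    also have "\<dots> = integral ?B (\<lambda>x. integral ?B (\<lambda>z. \<phi> z * (V x \<bullet> bump_grad z \<delta> x)))"
      by (rule integral_swap_continuous)
        (unfold case_prod_beta cbox_Pair_eq, intro continuous_intros cp cV, auto)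
    also have "\<dots> = integral ?B (\<lambda>x. integral ?B (\<lambda>z. (V x \<bullet> g z) * bump z \<delta> x))"
    proof (rule integral_cong)
      fix x
      \<comment> \<open>The bump depends on x - z only, so its gradients in x and in z differ by a
        sign, and the integral of the full z-gradient of the product with \<phi> vanishes.\<close>
      have "integral ?B (\<lambda>z. (\<phi> z *\<^sub>R bump_grad x \<delta> z + bump x \<delta> z *\<^sub>R g z) \<bullet> V x) = 0"
      proof (rule integral_gradient_eq_0)
        show "((\<lambda>z. \<phi> z * bump x \<delta> z) has_derivative
            (\<lambda>h. (\<phi> z *\<^sub>R bump_grad x \<delta> z + bump x \<delta> z *\<^sub>R g z) \<bullet> h)) (at z)" for z
          by (rule has_derivative_eq_rhs[OF has_derivative_mult[OF d\<phi> bump_has_derivative]])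
            (auto simp: inner_add_left)
        show "continuous_on UNIV (\<lambda>z. \<phi> z *\<^sub>R bump_grad x \<delta> z + bump x \<delta> z *\<^sub>R g z)"
          by (intro continuous_intros cont\<phi> contg)
        show "\<phi> z * bump x \<delta> z = 0" if "z \<notin> cbox a b" for z
        proof -
          have "z \<notin> K" using that K(2) box_subset_cbox by blast
          then show ?thesis using supp by simp
        qed
      qed
      moreover have "(\<lambda>z. (\<phi> z *\<^sub>R bump_grad x \<delta> z + bump x \<delta> z *\<^sub>R g z) \<bullet> V x)
          = (\<lambda>z. (V x \<bullet> g z) * bump z \<delta> x - \<phi> z * (V x \<bullet> bump_grad z \<delta> x))"
      proof (rule ext)
        fix z
        show "(\<phi> z *\<^sub>R bump_grad x \<delta> z + bump x \<delta> z *\<^sub>R g z) \<bullet> V x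
          = (V x \<bullet> g z) * bump z \<delta> x - \<phi> z * (V x \<bullet> bump_grad z \<delta> x)"
          unfolding bump_commute[of x \<delta> z] bump_grad_commute[of x \<delta> z]
          by (simp add: inner_add_left inner_diff_right inner_commute mult.commute)
      qed
      moreover have "integral ?B (\<lambda>z. (V x \<bullet> g z) * bump z \<delta> x - \<phi> z * (V x \<bullet> bump_grad z \<delta> x))
        = integral ?B (\<lambda>z. (V x \<bullet> g z) * bump z \<delta> x) - integral ?B (\<lambda>z. \<phi> z * (V x \<bullet> bump_grad z \<delta> x))"
        by (intro integral_diff integrable_continuous continuous_intros cp cg)
      ultimately show "integral ?B (\<lambda>z. \<phi> z * (V x \<bullet> bump_grad z \<delta> x)) = integral ?B (\<lambda>z. (V x \<bullet> g z) * bump z \<delta> x)"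
        by simp
    qed
    also have "\<dots> = integral ?B (\<lambda>z. integral ?B (\<lambda>x. (V x \<bullet> g z) * bump z \<delta> x))"
      by (rule integral_swap_continuous)
        (unfold case_prod_beta cbox_Pair_eq, intro continuous_intros cg cV, auto)
    finally have zero: "integral ?B (\<lambda>z. integral ?B (\<lambda>x. (V x \<bullet> g z) * bump z \<delta> x)) = 0" by simp
    have int1: "(\<lambda>z. integral ?B (\<lambda>x. (V x \<bullet> g z) * bump z \<delta> x)) integrable_on ?B"
      by (intro integrable_continuous integral_continuous_on_param)
        (unfold case_prod_beta, intro continuous_intros cg cV, auto)
    have int2: "(\<lambda>z. c * (V z \<bullet> g z)) integrable_on ?B"
      by (intro integrable_continuous continuous_intros cg cV) auto
    have "norm (integral ?B (\<lambda>z. c * (V z \<bullet> g z) - integral ?B (\<lambda>x. (V x \<bullet> g z) * bump z \<delta> x)))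
        \<le> integral ?B (\<lambda>z. \<epsilon> * c * norm (g z))"
    proof (rule integral_norm_bound_integral)
      show "(\<lambda>z. c * (V z \<bullet> g z) - integral ?B (\<lambda>x. (V x \<bullet> g z) * bump z \<delta> x)) integrable_on ?B"
        by (rule integrable_diff[OF int2 int1])
      show "(\<lambda>z. \<epsilon> * c * norm (g z)) integrable_on ?B"
        by (intro integrable_continuous continuous_intros cg)
      fix z assume zB: "z \<in> ?B"
      show "norm (c * (V z \<bullet> g z) - integral ?B (\<lambda>x. (V x \<bullet> g z) * bump z \<delta> x)) \<le> \<epsilon> * c * norm (g z)"
      proof (cases "z \<in> K")
        case True
        have cc: "integral ?B (bump z \<delta>) = c"
          unfolding c_def using cbl[OF True] box_subset_cbox by (intro bump_integral \<delta>(1)) blast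
        have "c * (V z \<bullet> g z) = integral ?B (\<lambda>x. (V z \<bullet> g z) * bump z \<delta> x)"
          using cc by simp
        then have "c * (V z \<bullet> g z) - integral ?B (\<lambda>x. (V x \<bullet> g z) * bump z \<delta> x)
          = integral ?B (\<lambda>x. (V z \<bullet> g z) * bump z \<delta> x - (V x \<bullet> g z) * bump z \<delta> x)"
          by (subst integral_diff) (auto intro!: integrable_continuous continuous_intros cV)
        also have "norm \<dots> \<le> integral ?B (\<lambda>x. \<epsilon> * norm (g z) * bump z \<delta> x)"
        proof (rule integral_norm_bound_integral)
          fix x assume xB: "x \<in> ?B"
          show "norm ((V z \<bullet> g z) * bump z \<delta> x - (V x \<bullet> g z) * bump z \<delta> x) \<le> \<epsilon> * norm (g z) * bump z \<delta> x"
          proof (cases "norm (x - z) < \<delta>")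
            case True
            then have "norm (V z - V x) \<le> \<epsilon>"
              using d1(2)[OF zB xB] \<delta>(3) by (simp add: dist_norm norm_minus_commute)
            then have "\<bar>(V z - V x) \<bullet> g z\<bar> \<le> \<epsilon> * norm (g z)"
              by (intro order_trans[OF Cauchy_Schwarz_ineq2] mult_right_mono) auto
            then have "\<bar>(V z - V x) \<bullet> g z\<bar> * bump z \<delta> x \<le> \<epsilon> * norm (g z) * bump z \<delta> x"
              by (intro mult_right_mono bump_nonneg)
            then show ?thesis
              by (simp add: inner_diff_left left_diff_distrib[symmetric] abs_mult bump_nonneg)
          next
            case False
            then show ?thesis using bump_eq_0_iff[OF \<delta>(1), of z x] by simp
          qed
        next
          show "(\<lambda>x. (V z \<bullet> g z) * bump z \<delta> x - (V x \<bullet> g z) * bump z \<delta> x) integrable_on ?B"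
            by (intro integrable_continuous continuous_intros cV)
          show "(\<lambda>x. \<epsilon> * norm (g z) * bump z \<delta> x) integrable_on ?B"
            by (intro integrable_continuous continuous_intros)
        qed
        also have "\<dots> = \<epsilon> * c * norm (g z)" using cc by simp
        finally show ?thesis .
      qed (simp add: g0)
    qed
    also have "integral ?B (\<lambda>z. c * (V z \<bullet> g z) - integral ?B (\<lambda>x. (V x \<bullet> g z) * bump z \<delta> x)) = c * ?I"
      using zero by (subst integral_diff[OF int2 int1]) simp
    also have "integral ?B (\<lambda>z. \<epsilon> * c * norm (g z)) = \<epsilon> * c * integral ?B (\<lambda>z. norm (g z))" by simp
    finally have "c * \<bar>?I\<bar> \<le> c * (\<epsilon> * integral ?B (\<lambda>z. norm (g z)))"
      using c by (simp add: abs_mult mult_ac)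
    then show ?thesis using c by simp
  qed
  show ?thesis
  proof (rule ccontr)
    assume nz: "?I \<noteq> 0"
    define J where "J = integral ?B (\<lambda>x. norm (g x))"
    have J: "J \<ge> 0" unfolding J_def
      by (intro integral_nonneg integrable_continuous continuous_intros cg) auto
    \<comment> \<open>\<open>main\<close> with the value |I| / (2 (J + 1)) for \<epsilon>, which
      makes its right-hand side smaller than |I|; the 1 covers J = 0.\<close>
    have "\<bar>?I\<bar> \<le> \<bar>?I\<bar> / (2 * (J + 1)) * J" unfolding J_def
      by (rule main) (use nz J in \<open>auto simp: J_def intro!: divide_pos_pos\<close>)
    also have "\<dots> = \<bar>?I\<bar> * (J / (2 * (J + 1)))" by simp
    also have "\<dots> < \<bar>?I\<bar> * 1" using nz J by (intro mult_strict_left_mono) (auto simp: field_simps)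
    finally show False by linarith
  qed
qed

section \<open>A C^1 cutoff near the flat boundary\<close>

lemma DERIV_max_0_square: "((\<lambda>s. (max 0 s)\<^sup>2) has_real_derivative 2 * max 0 s) (at (s::real))"
proof -
  consider "s < 0" | "s = 0" | "s > 0" by linarith
  then show ?thesis
  proof cases
    case 1
    have "((\<lambda>_. 0) has_real_derivative 0) (at s)" by simp
    then have "((\<lambda>s. (max 0 s)\<^sup>2) has_real_derivative 0) (at s)"
      by (rule has_field_derivative_transform_within_open[of _ _ _ "{..<0}"]) (use 1 in auto)
    with 1 show ?thesis by simp
  next
    case 2
    have "((\<lambda>h. \<bar>h\<bar>) \<longlongrightarrow> 0) (at (0::real))" by (rule tendsto_eq_intros refl)+ simp
    then have "((\<lambda>h. (max 0 h)\<^sup>2 / h) \<longlongrightarrow> 0) (at (0::real))"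
      by (rule Lim_null_comparison[rotated])
        (auto simp: max_def power2_eq_square eventually_at_filter intro!: always_eventually)
    then show ?thesis unfolding 2 has_field_derivative_iff by simp
  next
    case 3
    have "((\<lambda>s. s\<^sup>2) has_real_derivative 2 * s) (at s)" by (auto intro!: derivative_eq_intros)
    then have "((\<lambda>s. (max 0 s)\<^sup>2) has_real_derivative 2 * s) (at s)"
      by (rule has_field_derivative_transform_within_open[of _ _ _ "{0<..}"]) (use 3 in auto)
    with 3 show ?thesis by simp
  qed
qed

text \<open>The C^1 transition from 0 to 1 on [0, 1] whose second derivative is 4 on the first half
  and - 4 on the second. C^1 is enough, since \<open>weak_equation_C1\<close> admits such test
  functions.\<close>

definition smooth_step :: "real \<Rightarrow> real" where
  "smooth_step s = 2 * (max 0 s)\<^sup>2 - 4 * (max 0 (s - 1/2))\<^sup>2 + 2 * (max 0 (s - 1))\<^sup>2"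

definition smooth_step' :: "real \<Rightarrow> real" where
  "smooth_step' s = 4 * max 0 s - 8 * max 0 (s - 1/2) + 4 * max 0 (s - 1)"

lemma smooth_step_deriv: "(smooth_step has_real_derivative smooth_step' s) (at s)"
proof -
  have *: "((\<lambda>s. (max 0 (s - c))\<^sup>2) has_real_derivative 2 * max 0 (s - c)) (at s)" for c
    using DERIV_shift[of "\<lambda>s. (max 0 s)\<^sup>2" "2 * max 0 (s - c)" s "- c"] DERIV_max_0_square[of "s - c"] by simp
  show ?thesis unfolding smooth_step_def[abs_def] smooth_step'_def
    by (rule DERIV_cong[OF DERIV_add[OF DERIV_diff[OF DERIV_cmult[OF DERIV_max_0_square] DERIV_cmult[OF *]] DERIV_cmult[OF *]]]) simp
qed

lemma smooth_step_simps:
  "s \<le> 0 \<Longrightarrow> smooth_step s = 0" "s \<le> 0 \<Longrightarrow> smooth_step' s = 0" "1 \<le> s \<Longrightarrow> smooth_step s = 1" "1 \<le> s \<Longrightarrow> smooth_step' s = 0"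
  by (simp_all add: smooth_step_def smooth_step'_def max_def power2_eq_square algebra_simps)

lemma smooth_step_bounds: "0 \<le> smooth_step s" "smooth_step s \<le> 1" "0 \<le> smooth_step' s" "smooth_step' s \<le> 2"
proof -
  consider "s \<le> 0" | "0 \<le> s" "s \<le> 1/2" | "1/2 \<le> s" "s \<le> 1" | "1 \<le> s" by linarith
  then have "0 \<le> smooth_step s \<and> smooth_step s \<le> 1 \<and> 0 \<le> smooth_step' s \<and> smooth_step' s \<le> 2"
  proof cases
    case 2
    then have e: "smooth_step s = 2 * s\<^sup>2" "smooth_step' s = 4 * s" by (auto simp: smooth_step_def smooth_step'_def)
    have "s\<^sup>2 \<le> (1/2)\<^sup>2" using 2 by (intro power_mono) auto
    with 2 e show ?thesis by (auto simp: power2_eq_square)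
  next
    case 3
    then have e: "smooth_step s = 1 - 2 * (1 - s)\<^sup>2" "smooth_step' s = 4 * (1 - s)"
      by (auto simp: smooth_step_def smooth_step'_def power2_eq_square algebra_simps)
    have "(1 - s)\<^sup>2 \<le> (1/2)\<^sup>2" using 3 by (intro power_mono) auto
    with 3 e show ?thesis by (auto simp: power2_eq_square)
  qed (auto simp: smooth_step_simps)
  then show "0 \<le> smooth_step s" "smooth_step s \<le> 1" "0 \<le> smooth_step' s" "smooth_step' s \<le> 2" by auto
qed

lemma continuous_on_smooth_step [continuous_intros]:
  assumes "continuous_on S f"
  shows "continuous_on S (\<lambda>x. smooth_step (f x))" "continuous_on S (\<lambda>x. smooth_step' (f x))"
proof -
  have "continuous_on UNIV smooth_step"
    by (intro continuous_at_imp_continuous_on ballI DERIV_isCont[OF smooth_step_deriv])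
  then show "continuous_on S (\<lambda>x. smooth_step (f x))" by (rule continuous_on_compose2) (use assms in auto)
  have "continuous_on UNIV smooth_step'" 
    unfolding smooth_step'_def[abs_def] by (intro continuous_on_add continuous_on_diff continuous_on_mult continuous_on_max
        continuous_on_const continuous_on_id)
  then show "continuous_on S (\<lambda>x. smooth_step' (f x))" by (rule continuous_on_compose2) (use assms in auto)
qed

text \<open>A cutoff alters the tested equation only near the flat face. The strip of height e has
  volume proportional to e, which compensates the factor 1/e in the gradient of the cutoff.\<close>

lemma integral_le_on_strip:
  fixes lo hi :: "'n::finite space" and f :: "'n space \<Rightarrow> real"
  assumes "lo $ None = 0" "\<And>i. lo $ i < hi $ i" "0 < e" "e \<le> hi $ None"
    and int: "f integrable_on cbox lo hi"
    and M: "\<And>x. x \<in> cbox lo hi \<Longrightarrow> x $ None \<le> e \<Longrightarrow> f x \<le> M"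
    and z: "\<And>x. x \<in> cbox lo hi \<Longrightarrow> x $ None > e \<Longrightarrow> f x \<le> 0"
  shows "integral (cbox lo hi) f \<le> M * (e * (\<Prod>i\<in>UNIV - {None}. hi $ i - lo $ i))"
proof -
  define hi' where "hi' = (\<chi> i. if i = None then e else hi $ i)"
  have mem: "x \<in> cbox lo hi' \<longleftrightarrow> x \<in> cbox lo hi \<and> x $ None \<le> e" for x
  proof
    assume x: "x \<in> cbox lo hi'"
    have "x $ i \<le> hi $ i" for i
      using x assms(4) unfolding mem_box_cart hi'_def by (cases "i = None") (force dest: spec[of _ i])+
    moreover have "x $ None \<le> e" using x unfolding mem_box_cart hi'_def by (force dest: spec[of _ None])
    ultimately show "x \<in> cbox lo hi \<and> x $ None \<le> e" using x unfolding mem_box_cart by blast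
  next
    assume "x \<in> cbox lo hi \<and> x $ None \<le> e"
    then show "x \<in> cbox lo hi'" unfolding mem_box_cart hi'_def by simp
  qed
  have sub: "cbox lo hi' \<subseteq> cbox lo hi" using mem by (meson subsetI)
  have ne: "cbox lo hi' \<noteq> {}" using assms by (auto simp: interval_ne_empty_cart hi'_def intro: less_imp_le)
  have "((\<lambda>x. if x \<in> cbox lo hi' then M else 0) has_integral (measure lborel (cbox lo hi') *\<^sub>R M)) (cbox lo hi)"
    by (simp add: has_integral_restrict[OF sub]) (metis has_integral_const real_scaleR_def)
  moreover have "f x \<le> (if x \<in> cbox lo hi' then M else 0)" if "x \<in> cbox lo hi" for x
    using M z that mem by (cases "x $ None \<le> e") auto
  ultimately have "integral (cbox lo hi) f \<le> measure lborel (cbox lo hi') *\<^sub>R M"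
    using has_integral_le[OF integrable_integral[OF int]] by blast
  also have "measure lborel (cbox lo hi') = (\<Prod>i\<in>UNIV. hi' $ i - lo $ i)"
    using ne by (rule content_cbox_cart)
  also have "\<dots> = e * (\<Prod>i\<in>UNIV - {None}. hi $ i - lo $ i)"
    by (subst prod.remove[of _ None]) (auto simp: hi'_def assms(1) intro!: prod.cong split: if_splits)
  finally show ?thesis by (simp add: mult_ac)
qed

text \<open>
  Test with \<open>\<phi>\<close> times a cutoff vanishing for \<open>x $ None \<le> e\<close>. The gradient of the cutoff has size \<open>1/e\<close> on a
  strip of measure \<open>O(e)\<close>, and there \<open>\<phi> * V $ None\<close> is almost nonpositive by continuity.
\<close>

lemma weak_inequality_up_to_boundary:
  fixes V :: "('n::finite) space \<Rightarrow> 'n space" and lo hi :: "'n space"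
  assumes lohi: "lo $ None = 0" "\<And>i. lo $ i < hi $ i"
    and contV: "continuous_on (cbox lo hi) V"
    and weak: "\<And>\<psi>. test_function (box lo hi) \<psi> \<Longrightarrow>
      integral (cbox lo hi) (\<lambda>x. \<Sum>i\<in>UNIV. V x $ i * partial i UNIV \<psi> x) = 0"
    and d\<phi>: "\<And>x. x \<in> cbox lo hi \<Longrightarrow> (\<phi> has_derivative (\<lambda>h. g x \<bullet> h)) (at x within cbox lo hi)"
    and contg: "continuous_on (cbox lo hi) g"
    and K: "compact K" "\<And>x. x \<in> K \<Longrightarrow> x $ None > 0 \<Longrightarrow> x \<in> box lo hi"
    and supp: "\<And>x. x \<in> cbox lo hi \<Longrightarrow> x \<notin> K \<Longrightarrow> \<phi> x = 0" "\<And>x. x \<in> cbox lo hi \<Longrightarrow> x \<notin> K \<Longrightarrow> g x = 0"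
    and flat: "\<And>x. x \<in> cbox lo hi \<Longrightarrow> x $ None = 0 \<Longrightarrow> \<phi> x * V x $ None \<le> 0"
  shows "0 \<le> integral (cbox lo hi) (\<lambda>x. V x \<bullet> g x)"
proof -
  let ?B = "cbox lo hi" and ?N = "None :: 'n option"
  let ?I = "integral ?B (\<lambda>x. V x \<bullet> g x)"
  have inB: "x \<in> ?B" if "x \<in> box lo hi" for x using that box_subset_cbox by (rule subsetD[rotated])
  have cont\<phi>: "continuous_on ?B \<phi>"
    using d\<phi> by (meson continuous_on_eq_continuous_within has_derivative_continuous)
  \<comment> \<open>Testing with the cutoff times \<phi> produces c' * P besides c * (V \<bullet>
    g); P is the flux through the flat face that remains in the limit.\<close>
  define P where "P x = \<phi> x * V x $ None" for x
  have contP: "continuous_on ?B P" unfolding P_def by (intro continuous_intros cont\<phi> contV)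
  define R where "R = (\<Prod>i\<in>UNIV - {?N}. hi $ i - lo $ i)"
  have R: "R > 0" unfolding R_def using lohi by (intro prod_pos) auto
  obtain M where M: "\<And>x. x \<in> ?B \<Longrightarrow> \<bar>V x \<bullet> g x\<bar> \<le> M"
  proof -
    have "bounded ((\<lambda>x. V x \<bullet> g x) ` ?B)"
      by (intro compact_imp_bounded compact_continuous_image compact_cbox continuous_intros contV contg)
    then show ?thesis using that by (auto simp: bounded_iff)
  qed
  have lo_mem: "lo \<in> ?B" using lohi by (auto simp: mem_box_cart intro: less_imp_le)
  then have M0: "M \<ge> 0" using M by (meson abs_ge_zero order_trans)
  \<comment> \<open>The cutoff is incomplete on a strip of height 2 e, where c' \<le> 2 / e. The
    flux therefore costs at most 4 \<delta> R whatever e is, and the rest is O(e).\<close>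
  have key: "- ?I \<le> (M + 2 * \<delta> / e) * (2 * e * R)"
    if \<delta>: "\<delta> > 0" and e: "e > 0" "2 * e \<le> hi $ None"
      and P: "\<And>x. x \<in> ?B \<Longrightarrow> x $ None \<le> 2 * e \<Longrightarrow> P x \<le> \<delta>" for \<delta> e
  proof -
    define c where "c x = smooth_step (x $ ?N / e - 1)" for x :: "'n space"
    define c' where "c' x = smooth_step' (x $ ?N / e - 1) / e" for x :: "'n space"
    have dc: "(c has_derivative (\<lambda>h. c' x * h $ ?N)) (at x within S)" for x S
    proof -
      have "((\<lambda>x. (1 / e) * (x \<bullet> axis ?N 1) - 1) has_derivative (\<lambda>h. (1 / e) * (h \<bullet> axis ?N 1))) (at x within S)"
        by (rule has_derivative_eq_rhs, (rule derivative_intros)+) simp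
      from has_derivative_compose[OF this smooth_step_deriv[unfolded has_field_derivative_def]]
      show ?thesis by (simp add: c_def[abs_def] c'_def inner_axis)
    qed
    have cc: "continuous_on S c" "continuous_on S c'" for S
      unfolding c_def[abs_def] c'_def[abs_def] using e by (intro continuous_intros; simp)+
    define \<phi>e where "\<phi>e x = (if x \<in> ?B then c x * \<phi> x else 0)" for x
    define ge where "ge x = (if x \<in> ?B then c x *\<^sub>R g x + (c' x * \<phi> x) *\<^sub>R axis ?N 1 else 0)" for x
    define Ke where "Ke = K \<inter> ?B \<inter> {x. e \<le> x $ ?N}"
    have Ke: "compact Ke" unfolding Ke_def Int_assoc
      by (intro compact_Int_closed K(1) closed_Int closed_cbox closed_Collect_le continuous_intros)
    have Ke_box: "Ke \<subseteq> box lo hi" using K(2) e by (auto simp: Ke_def)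
    have c_small: "c x = 0" "c' x = 0" if "x $ ?N < e" for x
      using that e by (auto simp: c_def c'_def smooth_step_simps)
    have out: "\<phi>e x = 0" "ge x = 0" if "x \<notin> Ke" for x
      using that supp[of x] c_small[of x] by (auto simp: \<phi>e_def ge_def Ke_def not_le)
    have "integral ?B (\<lambda>x. V x \<bullet> ge x) = 0"
    proof (rule weak_equation_C1[OF contV weak _ _ Ke Ke_box out(1)])
      show "(\<phi>e has_derivative (\<lambda>h. ge x \<bullet> h)) (at x)" for x
      proof (cases "x \<in> box lo hi")
        case True
        then have xB: "x \<in> ?B" by (rule inB)
        have "at x within ?B = at x"
          by (rule at_within_interior) (use True in \<open>simp add: interior_cbox\<close>)
        then have d: "(\<phi> has_derivative (\<lambda>h. g x \<bullet> h)) (at x)" using d\<phi>[OF xB] by simp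
        have eq: "c x * (g x \<bullet> h) + c' x * h $ ?N * \<phi> x = ge x \<bullet> h" for h
          using xB by (simp add: ge_def inner_add_left inner_axis' mult_ac)
        have m: "((\<lambda>x. c x * \<phi> x) has_derivative (\<lambda>h. ge x \<bullet> h)) (at x)"
          using has_derivative_mult[OF dc d] by (simp only: eq)
        show ?thesis
        proof (rule has_derivative_transform_within_open[OF m open_box True])
          show "c y * \<phi> y = \<phi>e y" if "y \<in> box lo hi" for y
            using inB[OF that] by (simp add: \<phi>e_def)
        qed
      next
        case False
        then have "x \<in> - Ke" using Ke_box by blast
        have "((\<lambda>_. 0) has_derivative (\<lambda>h. 0)) (at x)" by simp
        then have "(\<phi>e has_derivative (\<lambda>h. 0)) (at x)"
          by (rule has_derivative_transform_within_open[of _ _ _ _ "- Ke"])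
            (use \<open>x \<in> - Ke\<close> out in \<open>simp_all add: open_Compl[OF compact_imp_closed[OF Ke]]\<close>)
        then show ?thesis using out(2) \<open>x \<in> - Ke\<close> by simp
      qed
      have "continuous_on (?B \<union> - box lo hi) ge" unfolding ge_def[abs_def]
      proof (rule continuous_on_cases)
        show "continuous_on ?B (\<lambda>x. c x *\<^sub>R g x + (c' x * \<phi> x) *\<^sub>R axis ?N 1)"
          by (intro continuous_intros cc contg cont\<phi>)
        have "c x *\<^sub>R g x + (c' x * \<phi> x) *\<^sub>R axis ?N 1 = 0" if "x \<in> ?B" "x \<notin> box lo hi" for x
        proof -
          have "x \<notin> Ke" using that Ke_box by blast
          from out(2)[OF this] that(1) show ?thesis by (simp add: ge_def)
        qed
        then show "\<forall>x. x \<in> ?B \<and> x \<notin> ?B \<or> x \<in> - box lo hi \<and> x \<in> ?B \<longrightarrow>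
            c x *\<^sub>R g x + (c' x * \<phi> x) *\<^sub>R axis ?N 1 = 0" by simp
        show "closed (- box lo hi)" using open_box by (rule closed_Compl)
      qed (rule closed_cbox continuous_on_const)+
      moreover have "?B \<union> - box lo hi = UNIV" using inB by blast
      ultimately show "continuous_on UNIV ge" by simp
    qed
    moreover have "integral ?B (\<lambda>x. V x \<bullet> ge x) = integral ?B (\<lambda>x. c x * (V x \<bullet> g x) + c' x * P x)"
      by (rule integral_cong) (simp add: ge_def inner_add_right inner_axis P_def)
    moreover have i1: "(\<lambda>x. V x \<bullet> g x) integrable_on ?B"
      by (intro integrable_continuous continuous_intros contV contg)
    moreover have i2: "(\<lambda>x. c x * (V x \<bullet> g x) + c' x * P x) integrable_on ?B"
      by (intro integrable_continuous continuous_intros contV contg cc contP)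
    ultimately have "- ?I = integral ?B (\<lambda>x. c x * (V x \<bullet> g x) + c' x * P x - V x \<bullet> g x)"
      by (subst integral_diff[OF i2 i1]) simp
    also have "\<dots> \<le> (M + 2 * \<delta> / e) * (2 * e * R)"
      unfolding R_def
    proof (rule integral_le_on_strip[OF lohi _ e(2)])
      show "(\<lambda>x. c x * (V x \<bullet> g x) + c' x * P x - V x \<bullet> g x) integrable_on ?B"
        by (rule integrable_diff[OF i2 i1])
      show "c x * (V x \<bullet> g x) + c' x * P x - V x \<bullet> g x \<le> M + 2 * \<delta> / e"
        if x: "x \<in> ?B" "x $ None \<le> 2 * e" for x
      proof -
        have "(1 - c x) * (- (V x \<bullet> g x)) \<le> 1 * M"
        proof -
          have "(1 - c x) * (- (V x \<bullet> g x)) \<le> (1 - c x) * M"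
            using M[OF x(1)] smooth_step_bounds(2) by (intro mult_left_mono) (auto simp: c_def abs_le_iff)
          also have "\<dots> \<le> 1 * M"
            using smooth_step_bounds(1) M0 by (intro mult_right_mono) (auto simp: c_def)
          finally show ?thesis .
        qed
        moreover have "c' x * P x \<le> (2 / e) * \<delta>"
        proof -
          have "c' x * P x \<le> c' x * \<delta>"
            using P[OF x] smooth_step_bounds e by (intro mult_left_mono) (auto simp: c'_def)
          also have "\<dots> \<le> (2 / e) * \<delta>"
            using smooth_step_bounds e \<delta> by (intro mult_right_mono) (auto simp: c'_def divide_right_mono)
          finally show ?thesis .
        qed
        ultimately show ?thesis by (simp add: algebra_simps)
      qed
      show "c x * (V x \<bullet> g x) + c' x * P x - V x \<bullet> g x \<le> 0" if x: "x \<in> ?B" "x $ None > 2 * e" for x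
      proof -
        have "1 \<le> x $ None / e - 1" using x e by (simp add: field_simps)
        then show ?thesis by (simp add: c_def c'_def smooth_step_simps)
      qed
    qed (use e in simp)
    finally show ?thesis .
  qed
  have small: "- ?I \<le> \<delta>" if \<delta>: "\<delta> > 0" for \<delta>
  proof -
    \<comment> \<open>Chosen so that the flux term 4 d R in \<open>key\<close> equals \<delta> /
      2.\<close>
    define d where "d = \<delta> / (8 * R)"
    have d: "d > 0" using \<delta> R by (simp add: d_def)
    \<comment> \<open>The compact set where P is not small misses the flat face, because P \<le> 0
      there, and so it stays above some height e0.\<close>
    define T where "T = {x \<in> ?B. d \<le> P x}"
    have Tc: "compact T"
    proof -
      have "closed T" unfolding T_def
        by (intro continuous_on_closed_Collect_le continuous_intros contP closed_cbox)
      moreover have "bounded T" by (rule bounded_subset[OF bounded_cbox]) (auto simp only: T_def)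
      ultimately show ?thesis by (simp only: compact_eq_bounded_closed)
    qed
    obtain e0 where e0: "e0 > 0" "\<And>x. x \<in> T \<Longrightarrow> e0 < x $ ?N"
    proof (cases "T = {}")
      case True
      then show ?thesis using that[of 1] by auto
    next
      case False
      have cT: "continuous_on T (\<lambda>x. x $ ?N)" by (intro continuous_intros)
      from continuous_attains_inf[OF Tc False cT]
      obtain y where "y \<in> T" "\<forall>x\<in>T. y $ ?N \<le> x $ ?N" by blast
      then have y: "y \<in> T" "\<And>x. x \<in> T \<Longrightarrow> y $ ?N \<le> x $ ?N" by blast+
      have yB: "y \<in> ?B" and Py: "d \<le> P y" using y(1) by (simp_all only: T_def mem_Collect_eq)
      have "y $ ?N \<noteq> 0"
      proof
        assume "y $ ?N = 0"
        then have "P y \<le> 0" using flat[OF yB] by (simp only: P_def)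
        then show False using Py d by linarith
      qed
      moreover have "lo $ ?N \<le> y $ ?N" using yB unfolding mem_box_cart by blast
      ultimately have pos: "y $ ?N / 2 > 0" using lohi(1) by simp
      have lt: "y $ ?N / 2 < x $ ?N" if "x \<in> T" for x
        using y(2)[OF that] pos by simp
      show ?thesis by (rule that[OF pos lt])
    qed
    \<comment> \<open>The strip has to lie below e0 and inside the box; the last bound makes 2 M R e
      at most \<delta> / 2, with M + 1 covering M = 0.\<close>
    define e where "e = min (min (e0 / 2) (hi $ ?N / 2)) (\<delta> / (4 * (M + 1) * R))"
    have hiN: "hi $ ?N > 0" using lohi(1) lohi(2)[of ?N] by simp
    have e: "e > 0" "2 * e \<le> hi $ ?N" "2 * e \<le> e0" "e \<le> \<delta> / (4 * (M + 1) * R)"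
      using e0 hiN \<delta> M0 R by (auto simp: e_def)
    have "- ?I \<le> (M + 2 * d / e) * (2 * e * R)"
    proof (rule key[OF d e(1,2)])
      show "P x \<le> d" if "x \<in> ?B" "x $ ?N \<le> 2 * e" for x
        using e0(2)[of x] that e(3) by (cases "d \<le> P x") (auto simp: T_def)
    qed
    also have "\<dots> = 2 * M * R * e + 4 * d * R" using e by (simp add: field_simps)
    also have "4 * d * R = \<delta> / 2" using R by (simp add: d_def)
    also have "2 * M * R * e \<le> 2 * (M + 1) * R * (\<delta> / (4 * (M + 1) * R))"
      using e M0 R by (intro mult_mono) auto
    also have "2 * (M + 1) * R * (\<delta> / (4 * (M + 1) * R)) = \<delta> / 2"
    proof -
      define q where "q = (M + 1) * R"
      have q: "q \<noteq> 0" using M0 R by (simp add: q_def)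
      have "2 * (M + 1) * R = 2 * q" "4 * (M + 1) * R = 4 * q" by (simp_all only: q_def mult.assoc)
      then show ?thesis using q by (simp only:) (simp add: field_simps)
    qed
    finally show ?thesis by simp
  qed
  show ?thesis
  proof (rule ccontr)
    assume "\<not> 0 \<le> ?I"
    then show False using small[of "- ?I / 2"] by linarith
  qed
qed

section \<open>Approximate log-convexity\<close>

lemma exp_minus_le_quadratic:
  assumes "(0::real) \<le> x"
  shows "exp (- x) \<le> 1 - x + x\<^sup>2 / 2"
proof -
  have "(\<lambda>x. 1 - x + x\<^sup>2 / 2 - exp (- x)) 0 \<le> (\<lambda>x. 1 - x + x\<^sup>2 / 2 - exp (- x)) x"
  proof (rule DERIV_nonneg_imp_nondecreasing[OF assms])
    fix y :: real
    have "((\<lambda>x. 1 - x + x\<^sup>2 / 2 - exp (- x)) has_real_derivative (- 1 + y + exp (- y))) (at y)"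
      by (auto intro!: derivative_eq_intros)
    moreover have "0 \<le> - 1 + y + exp (- y)" using exp_ge_add_one_self[of "- y"] by simp
    ultimately show "\<exists>D. ((\<lambda>x. 1 - x + x\<^sup>2 / 2 - exp (- x)) has_real_derivative D) (at y) \<and> 0 \<le> D" by blast
  qed
  then show ?thesis by simp
qed

text \<open>At a maximum beyond the first delay interval the derivative vanishes while the backward
  difference quotient is nonnegative, against the strict inequality. Since the quotient reaches back
  by h, the boundary value at a is replaced by a bound on all of [a, a + h].\<close>

lemma delay_maximum_principle:
  fixes Y Y' :: "real \<Rightarrow> real"
  assumes h: "0 < h" "h \<le> b - a"
    and dY: "\<And>t. a \<le> t \<Longrightarrow> t \<le> b \<Longrightarrow> (Y has_real_derivative Y' t) (at t)"
    and ineq: "\<And>t. a + h < t \<Longrightarrow> t < b \<Longrightarrow> (Y t - Y (t - h)) / h < Y' t"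
    and left: "\<And>t. a \<le> t \<Longrightarrow> t \<le> a + h \<Longrightarrow> Y t \<le> M" and right: "Y b \<le> M"
    and t: "a \<le> t" "t \<le> b"
  shows "Y t \<le> M"
proof -
  have cont: "continuous_on {a..b} Y"
    using dY by (intro continuous_at_imp_continuous_on ballI DERIV_isCont) auto
  have ne: "{a..b} \<noteq> {}" using t by auto
  obtain s where s: "s \<in> {a..b}" and mx: "\<forall>y\<in>{a..b}. Y y \<le> Y s"
    using continuous_attains_sup[OF compact_Icc ne cont] by blast
  have "Y s \<le> M"
  proof (rule ccontr)
    assume "\<not> Y s \<le> M"
    then have sI: "a + h < s" "s < b" using left[of s] right s 
      by (cases "s = b"; force)+
    define d where "d = min (s - a) (b - s)"
    have "d > 0" using sI h by (simp add: d_def)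
    moreover have "Y y \<le> Y s" if "\<bar>s - y\<bar> < d" for y
    proof -
      have "y \<in> {a..b}" using that unfolding d_def atLeastAtMost_iff by linarith
      then show ?thesis using mx by blast
    qed
    ultimately have "Y' s = 0" using DERIV_local_max[OF dY[of s]] s by auto
    moreover have "Y (s - h) \<le> Y s" using mx sI h by auto
    ultimately show False using ineq[OF sI] h by (simp add: divide_less_0_iff)
  qed
  then show ?thesis using mx t by force
qed

text \<open>
  Log-convexity of \<open>G\<close> means that \<open>Y t = exp (- 2 * N * (t - m)) * G t\<close> is convex for every \<open>N\<close>. Integrating
  \<open>flow\<close> over \<open>[t - h, t]\<close> bounds \<open>Y' t\<close> from below by the difference quotient over that interval, up to
  errors \<open>O(h^2 + \<omega>)\<close>; the maximum principle turns this into midpoint convexity with error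
  \<open>O(h + \<omega> / h)\<close>, and \<open>h = sqrt \<omega>\<close> is optimal.
\<close>

lemma approximate_log_convexity:
  fixes G G' :: "real \<Rightarrow> real" and F D :: "real \<Rightarrow> real \<Rightarrow> real"
  assumes \<tau>: "\<tau> > 0" and N: "0 \<le> N" "N \<le> N1" and \<Lambda>: "\<Lambda> = exp (2 * N * \<tau>)" "\<Lambda> \<le> \<Lambda>1"
    and dF: "\<And>s t. s \<in> {m - \<tau>..m + \<tau>} \<Longrightarrow> t \<in> {m - \<tau>..m + \<tau>} \<Longrightarrow> (F s has_real_derivative D s t) (at t)"
    and dG: "\<And>t. t \<in> {m - \<tau>..m + \<tau>} \<Longrightarrow> (G has_real_derivative G' t) (at t)"
    and FG: "\<And>t. F t t = G t"
    and par: "\<And>s t \<rho>. s \<in> {m - \<tau>..m + \<tau>} \<Longrightarrow> t \<in> {m - \<tau>..m + \<tau>} \<Longrightarrow> \<rho> > 0 \<Longrightarrow> 2 * F s t \<le> \<rho> * G s + G t / \<rho>"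
    and flow: "\<And>s t. s \<in> {m - \<tau>..m + \<tau>} \<Longrightarrow> t \<in> {m - \<tau>..m + \<tau>} \<Longrightarrow> D s t \<le> (G' s + G' t) / 4 + 2 * (\<omega> * Z)"
    and bG: "\<And>t. t \<in> {m - \<tau>..m + \<tau>} \<Longrightarrow> 0 \<le> G t \<and> G t \<le> Z"
    and bG': "\<And>t. t \<in> {m - \<tau>..m + \<tau>} \<Longrightarrow> \<bar>G' t\<bar> \<le> C0 * Z"
    and \<omega>: "0 < \<omega>" "sqrt \<omega> \<le> \<tau>" "sqrt \<omega> * N1 \<le> 1" and Z: "Z > 0" and C0: "C0 \<ge> 0"
  shows "G m \<le> (\<Lambda> * G (m - \<tau>) + G (m + \<tau>) / \<Lambda>) / 2
    + (4 * (N1\<^sup>2 * (\<Lambda>1 * (C0 + 2 * N1)) + N1^3 * \<Lambda>1 + 8 * \<Lambda>1) * \<tau>\<^sup>2 + 2 * (\<Lambda>1 * (C0 + 2 * N1))) * sqrt \<omega> * Z"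
proof -
  let ?W = "{m - \<tau>..m + \<tau>}"
  define h where "h = sqrt \<omega>"
  have h: "h > 0" "h \<le> \<tau>" "h\<^sup>2 = \<omega>" "N1 * h \<le> 1"
    using \<omega> by (auto simp: h_def mult.commute)
  then have "N * h \<le> 1" using N by (meson mult_right_mono less_imp_le order_trans)
  define x where "x = N * h"
  have x: "0 \<le> x" "x \<le> 1" using h N \<open>N * h \<le> 1\<close> by (auto simp: x_def)
  \<comment> \<open>The optimal weight in \<open>par\<close> if G grows exactly like exp (2 N t): it
    is then the square root of G (t - h) / G t.\<close>
  define \<rho> where "\<rho> = exp (- x)"
  have \<rho>: "\<rho> > 0" "\<rho> \<le> 1 - x + x\<^sup>2 / 2" using exp_minus_le_quadratic[OF x(1)] by (auto simp: \<rho>_def)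
  have "1 \<le> \<Lambda>" using N \<tau> by (simp add: \<Lambda>(1))
  then have \<Lambda>p: "1 \<le> \<Lambda>" "1 \<le> \<Lambda>1" using \<Lambda>(2) by linarith+
  define C2 where "C2 = \<Lambda>1 * (C0 + 2 * N1)"
  define C1 where "C1 = N1\<^sup>2 * C2 + N1^3 * \<Lambda>1 + 8 * \<Lambda>1"
  have C: "C2 \<ge> 0" "C1 > 0"
  proof -
    show "C2 \<ge> 0" using \<Lambda>p C0 N by (simp add: C2_def)
    then have "0 \<le> N1\<^sup>2 * C2" "0 \<le> N1^3 * \<Lambda>1" using N \<Lambda>p by auto
    then show "C1 > 0" using \<Lambda>p by (simp add: C1_def)
  qed
  \<comment> \<open>This tilt equals \<Lambda> at m - \<tau>, 1 at m and 1 / \<Lambda> at m +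
    \<tau>, which produces the weights of the conclusion.\<close>
  define E where "E t = exp (- 2 * N * (t - m))" for t
  define Y where "Y t = E t * G t" for t
  define Y' where "Y' t = E t * (G' t - 2 * N * G t)" for t
  have E: "0 < E t" "E t \<le> \<Lambda>1" if "t \<in> ?W" for t
  proof -
    have "- 2 * N * (t - m) = 2 * N * (m - t)" by (simp add: algebra_simps)
    also have "\<dots> \<le> 2 * N * \<tau>" using that N by (intro mult_left_mono) auto
    finally have "E t \<le> \<Lambda>" by (simp add: E_def \<Lambda>(1))
    then show "E t \<le> \<Lambda>1" using \<Lambda>(2) by linarith
    show "0 < E t" by (simp add: E_def)
  qed
  have dY: "(Y has_real_derivative Y' t) (at t)" if "t \<in> ?W" for t
  proof -
    have dE: "(E has_real_derivative - 2 * N * E t) (at t)"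
      unfolding E_def[abs_def] by (auto intro!: derivative_eq_intros)
    show ?thesis unfolding Y_def[abs_def]
      by (rule DERIV_cong[OF DERIV_mult[OF dE dG[OF that]]]) (simp add: Y'_def algebra_simps)
  qed
  have bY: "0 \<le> Y t" "Y t \<le> \<Lambda>1 * Z" if "t \<in> ?W" for t
    using E[OF that] bG[OF that] by (auto simp: Y_def intro!: mult_mono)
  have bY': "\<bar>Y' t\<bar> \<le> C2 * Z" if "t \<in> ?W" for t
  proof -
    have "\<bar>G' t - 2 * N * G t\<bar> \<le> \<bar>G' t\<bar> + 2 * N * G t"
      using abs_triangle_ineq4[of "G' t" "2 * N * G t"] N bG[OF that] by (simp add: abs_mult)
    also have "\<dots> \<le> C0 * Z + 2 * N1 * Z"
      using bG'[OF that] bG[OF that] N by (intro add_mono mult_mono) auto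
    finally have *: "\<bar>G' t - 2 * N * G t\<bar> \<le> (C0 + 2 * N1) * Z" by (simp add: algebra_simps)
    have "\<bar>Y' t\<bar> = E t * \<bar>G' t - 2 * N * G t\<bar>" using E[OF that] by (simp add: Y'_def abs_mult)
    also have "\<dots> \<le> \<Lambda>1 * ((C0 + 2 * N1) * Z)"
      using E[OF that] * \<Lambda>p by (intro mult_mono) auto
    finally show ?thesis by (simp add: C2_def mult_ac)
  qed
  have lip: "\<bar>Y t - Y s\<bar> \<le> C2 * Z * (t - s)" if "s \<le> t" "s \<in> ?W" "t \<in> ?W" for s t
  proof -
    have "norm (Y t - Y s) \<le> C2 * Z * norm (t - s)"
    proof (rule field_differentiable_bound[where S="{s..t}" and f'=Y'])
      fix z assume "z \<in> {s..t}"
      then have z: "z \<in> ?W" using that by auto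
      show "(Y has_field_derivative Y' z) (at z within {s..t})"
        by (rule has_field_derivative_at_within[OF dY[OF z]])
      show "norm (Y' z) \<le> C2 * Z" using bY'[OF z] by simp
    qed (use that in auto)
    then show ?thesis using that by simp
  qed
  have step: "h * G' t \<ge> (3 - 2 * \<rho>) * G t - (2 / \<rho> - 1) * G (t - h) - 8 * (\<omega> * Z) * h"
    if t: "t \<in> ?W" "t - h \<in> ?W" for t
  proof -
    \<comment> \<open>By \<open>flow\<close> this function is nonincreasing. Comparing t - h with t
      bounds G t in terms of F t (t - h), which \<open>par\<close> then removes.\<close>
    define f where "f \<sigma> = F t \<sigma> - G \<sigma> / 4 - \<sigma> * (G' t / 4 + 2 * (\<omega> * Z))" for \<sigma>
    have "f t \<le> f (t - h)"
    proof (rule DERIV_nonpos_imp_nonincreasing[of "t - h" t f])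
      fix \<sigma> assume "t - h \<le> \<sigma>" "\<sigma> \<le> t"
      then have \<sigma>: "\<sigma> \<in> ?W" using t by auto
      have "(f has_real_derivative D t \<sigma> - G' \<sigma> / 4 - (G' t / 4 + 2 * (\<omega> * Z))) (at \<sigma>)"
        unfolding f_def[abs_def]
        by (rule DERIV_cong, (rule DERIV_diff dF[OF t(1) \<sigma>] dG[OF \<sigma>] DERIV_cdivide DERIV_cmult_right DERIV_ident)+) simp
      moreover have "D t \<sigma> - G' \<sigma> / 4 - (G' t / 4 + 2 * (\<omega> * Z)) \<le> 0"
        using flow[OF t(1) \<sigma>] unfolding add_divide_distrib by linarith
      ultimately show "\<exists>y. (f has_real_derivative y) (at \<sigma>) \<and> y \<le> 0"
        by blast
    qed (use h in simp)
    then have "3 * G t \<le> 4 * F t (t - h) - G (t - h) + h * G' t + 8 * (\<omega> * Z) * h"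
      by (simp add: f_def FG field_simps)
    moreover have "(2 / \<rho> - 1) * G (t - h) = 2 * (G (t - h) / \<rho>) - G (t - h)"
      "(3 - 2 * \<rho>) * G t = 3 * G t - 2 * (\<rho> * G t)" by (simp_all add: left_diff_distrib)
    ultimately show ?thesis using par[OF t \<rho>(1)] by linarith
  qed
  have stepY: "Y' t \<ge> (Y t - Y (t - h)) / h - C1 * \<omega> * Z" if t: "t \<in> ?W" "t - h \<in> ?W" for t
  proof -
    have EE: "E t = \<rho>\<^sup>2 * E (t - h)"
      by (simp add: E_def \<rho>_def x_def exp_double[symmetric] exp_add[symmetric] algebra_simps)
    have "h * Y' t = E t * (h * G' t) - 2 * x * Y t" by (simp add: Y'_def Y_def x_def algebra_simps)
    also have "\<dots> \<ge> E t * ((3 - 2 * \<rho>) * G t - (2 / \<rho> - 1) * G (t - h) - 8 * (\<omega> * Z) * h) - 2 * x * Y t"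
      using step[OF t] E[OF t(1)] by (intro diff_right_mono mult_left_mono) auto
    also have "E t * ((3 - 2 * \<rho>) * G t - (2 / \<rho> - 1) * G (t - h) - 8 * (\<omega> * Z) * h) - 2 * x * Y t
        = (3 - 2 * \<rho> - 2 * x) * Y t - (2 * \<rho> - \<rho>\<^sup>2) * Y (t - h) - 8 * E t * (\<omega> * Z) * h"
    proof -
      have "E t * ((2 / \<rho> - 1) * G (t - h)) = (2 * \<rho> - \<rho>\<^sup>2) * Y (t - h)"
        unfolding EE Y_def using \<rho> by (simp add: power2_eq_square field_simps)
      then show ?thesis by (simp add: Y_def right_diff_distrib left_diff_distrib mult_ac)
    qed
    finally have 1: "h * Y' t \<ge> (3 - 2 * \<rho> - 2 * x) * Y t - (2 * \<rho> - \<rho>\<^sup>2) * Y (t - h) - 8 * E t * (\<omega> * Z) * h" .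
    \<comment> \<open>Both coefficients agree with 1 - x^2 up to third order in x = N h. The factor
      x^2 then multiplies Y t - Y (t - h), which is O(h) by \<open>lip\<close>, so all errors are
      O(h^3) = O(h \<omega>).\<close>
    have "(1 - x\<^sup>2) * Y t \<le> (3 - 2 * \<rho> - 2 * x) * Y t"
      using \<rho> bY[OF t(1)] by (intro mult_right_mono) auto
    moreover have "(2 * \<rho> - \<rho>\<^sup>2) * Y (t - h) \<le> (1 - x\<^sup>2 + x^3) * Y (t - h)"
    proof (intro mult_right_mono bY(1)[OF t(2)])
      have "0 \<le> x * (1 - x / 2)" using x by (intro mult_nonneg_nonneg) auto
      then have "(x - x\<^sup>2 / 2)\<^sup>2 \<le> (1 - \<rho>)\<^sup>2"
        using \<rho> by (intro power_mono) (auto simp: power2_eq_square algebra_simps)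
      moreover have "(x - x\<^sup>2 / 2)\<^sup>2 = x\<^sup>2 - x^3 + (x\<^sup>2)\<^sup>2 / 4"
        by (simp add: power2_eq_square power3_eq_cube algebra_simps)
      moreover have "0 \<le> (x\<^sup>2)\<^sup>2 / 4" by simp
      moreover have "(1 - \<rho>)\<^sup>2 = 1 - (2 * \<rho> - \<rho>\<^sup>2)" by (simp add: power2_eq_square algebra_simps)
      ultimately show "2 * \<rho> - \<rho>\<^sup>2 \<le> 1 - x\<^sup>2 + x^3" by linarith
    qed
    moreover have "8 * E t * (\<omega> * Z) * h \<le> 8 * \<Lambda>1 * (\<omega> * Z) * h"
      using E[OF t(1)] \<omega> Z h by (intro mult_right_mono) auto
    moreover have "x\<^sup>2 * (Y t - Y (t - h)) \<le> (N1\<^sup>2 * \<omega>) * (C2 * Z * h)"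
    proof -
      have "x\<^sup>2 * (Y t - Y (t - h)) \<le> x\<^sup>2 * (C2 * Z * h)"
        using lip[of "t - h" t] t h by (intro mult_left_mono) auto
      also have "\<dots> \<le> (N1\<^sup>2 * \<omega>) * (C2 * Z * h)"
        using C Z h N by (intro mult_right_mono) (auto simp: x_def power_mult_distrib intro!: mult_right_mono power_mono)
      finally show ?thesis .
    qed
    moreover have "x^3 * Y (t - h) \<le> (N1^3 * \<omega> * h) * (\<Lambda>1 * Z)"
    proof (intro mult_mono bY[OF t(2)])
      have "x^3 = N^3 * (h\<^sup>2 * h)" by (simp add: x_def power_mult_distrib power2_eq_square power3_eq_cube)
      also have "\<dots> \<le> N1^3 * (h\<^sup>2 * h)" using N h by (intro mult_right_mono power_mono) auto
      finally show "x^3 \<le> N1^3 * \<omega> * h" by (simp add: h(3))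
      show "0 \<le> N1^3 * \<omega> * h" using N \<omega> h by simp
    qed
    ultimately have "h * Y' t \<ge> (Y t - Y (t - h)) - (N1\<^sup>2 * \<omega>) * (C2 * Z * h) - (N1^3 * \<omega> * h) * (\<Lambda>1 * Z) - 8 * \<Lambda>1 * (\<omega> * Z) * h"
      using 1 by (simp add: algebra_simps)
    then have "h * Y' t \<ge> (Y t - Y (t - h)) - h * (C1 * \<omega> * Z)"
      by (simp add: C1_def algebra_simps)
    then have "Y' t \<ge> ((Y t - Y (t - h)) - h * (C1 * \<omega> * Z)) / h"
      using h by (simp add: pos_divide_le_eq mult.commute)
    then show ?thesis using h by (simp add: diff_divide_distrib)
  qed
  \<comment> \<open>Twice the error in \<open>stepY\<close>, so that the inequality for V becomes
    strict.\<close>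
  define \<kappa> where "\<kappa> = C1 * (2 * \<omega>) * Z"
  have \<kappa>: "\<kappa> > 0" using C \<omega> Z by (simp add: \<kappa>_def)
  define b where "b = 2 * \<kappa> / h"
  define sl where "sl = (Y (m + \<tau>) - Y (m - \<tau>)) / (2 * \<tau>)"
  define avg where "avg = (Y (m + \<tau>) + Y (m - \<tau>)) / 2"
  \<comment> \<open>The chord of Y is subtracted and a parabola is added, whose backward difference
    quotient lags behind its derivative by b h / 2 = \<kappa>; this beats the error in
    \<open>stepY\<close>. At t = m only \<open>avg\<close> is left of these corrections.\<close>
  define V where "V t = Y t - avg - sl * (t - m) + b / 2 * (t - m)\<^sup>2" for t
  define M where "M = b / 2 * \<tau>\<^sup>2 + 2 * (C2 * Z) * h"
  have bpos: "b > 0" using \<kappa> h by (simp add: b_def)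
  have CZ: "C2 * Z \<ge> 0" using C Z by simp
  have end1: "Y (m + \<tau>) - avg - sl * \<tau> = 0" and end2: "Y (m - \<tau>) - avg + sl * \<tau> = 0"
    using \<tau> by (auto simp: avg_def sl_def field_simps)
  have sl_b: "\<bar>sl\<bar> \<le> C2 * Z"
    using lip[of "m - \<tau>" "m + \<tau>"] \<tau> by (simp add: sl_def abs_divide pos_divide_le_eq)
  have "V m \<le> M"
  proof (rule delay_maximum_principle[where a="m - \<tau>" and b="m + \<tau>" and h=h and Y=V and t=m and M=M and Y'="\<lambda>t. Y' t - sl + b * (t - m)"])
    show "(V has_real_derivative Y' t - sl + b * (t - m)) (at t)" if "m - \<tau> \<le> t" "t \<le> m + \<tau>" for t
    proof -
      have t: "t \<in> ?W" using that by simp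
      show ?thesis unfolding V_def[abs_def]
        by (rule DERIV_cong, (rule DERIV_add DERIV_diff dY[OF t] derivative_intros)+) simp
    qed
    show "(V t - V (t - h)) / h < Y' t - sl + b * (t - m)" if "m - \<tau> + h < t" "t < m + \<tau>" for t
    proof -
      have "(V t - V (t - h)) / h = (Y t - Y (t - h)) / h - sl + b * (t - m) - b * h / 2"
        using h by (simp add: V_def power2_eq_square field_simps)
      moreover have "(Y t - Y (t - h)) / h - \<kappa> / 2 \<le> Y' t"
        using stepY[of t] that h unfolding \<kappa>_def by auto
      moreover have "b * h / 2 = \<kappa>" using h by (simp add: b_def)
      ultimately show ?thesis using \<kappa> by linarith
    qed
    show "V t \<le> M" if "m - \<tau> \<le> t" "t \<le> m - \<tau> + h" for t
    proof -
      have "Y t \<le> Y (m - \<tau>) + C2 * Z * (t - (m - \<tau>))" using lip[of "m - \<tau>" t] that h by auto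
      moreover have "- sl * (t - (m - \<tau>)) \<le> C2 * Z * (t - (m - \<tau>))"
        using sl_b that by (intro mult_right_mono) auto
      moreover have "C2 * Z * (t - (m - \<tau>)) \<le> C2 * Z * h" using that CZ by (intro mult_left_mono) auto
      moreover have "b / 2 * (t - m)\<^sup>2 \<le> b / 2 * \<tau>\<^sup>2"
        using bpos that h abs_le_square_iff[of "t - m" \<tau>] by (intro mult_left_mono) auto
      ultimately show ?thesis using end2 by (simp add: V_def M_def algebra_simps)
    qed
    show "V (m + \<tau>) \<le> M" using end1 CZ h by (simp add: V_def M_def)
  qed (use h \<tau> in auto)
  then have "Y m \<le> avg + M" by (simp add: V_def)
  moreover have "Y m = G m" by (simp add: Y_def E_def)
  moreover have "avg = (\<Lambda> * G (m - \<tau>) + G (m + \<tau>) / \<Lambda>) / 2"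
  proof -
    have "E (m - \<tau>) = \<Lambda>" "E (m + \<tau>) = 1 / \<Lambda>" by (simp_all add: E_def \<Lambda>(1) exp_minus inverse_eq_divide)
    then show ?thesis by (simp add: avg_def Y_def)
  qed
  moreover have "M = (2 * C1 * \<tau>\<^sup>2 + 2 * C2) * sqrt \<omega> * Z"
  proof -
    have "\<omega> = h * h" using h(3) by (simp add: power2_eq_square)
    then have "b = 4 * C1 * h * Z" using h(1) by (simp add: b_def \<kappa>_def)
    then show ?thesis unfolding M_def h_def[symmetric] by (simp add: algebra_simps)
  qed
  moreover have "(2 * C1 * \<tau>\<^sup>2 + 2 * C2) * sqrt \<omega> * Z \<le> (4 * C1 * \<tau>\<^sup>2 + 2 * C2) * sqrt \<omega> * Z"
    using C \<omega> Z by (intro mult_right_mono add_mono) auto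
  ultimately show ?thesis by (simp add: C1_def C2_def)
qed

text \<open>
  If two consecutive ratios are at most \<open>L\<close>, the next one is at most \<open>L * (1 + O(q ^ k))\<close>, so all later ratios
  stay bounded by \<open>L0 * (2 - q ^ j)\<close> once \<open>k\<close> is large. The lower bound makes two consecutive ratios
  bounded infinitely often.
\<close>

lemma doubling_of_approximately_log_convex_sequence:
  fixes b :: "nat \<Rightarrow> real"
  assumes q: "0 < q" "q < 1" and M: "1 \<le> M" and c: "0 < c" and \<mu>: "0 < \<mu>" "\<mu> \<le> 1"
    and lower: "\<And>k. c * \<mu> ^ k \<le> b k"
    and mono: "\<And>k. b (k + 1) \<le> M * b k"
    and conv: "\<And>L1. 1 \<le> L1 \<Longrightarrow> \<exists>C\<ge>0. \<exists>k0. \<forall>k\<ge>k0. \<forall>L. 1 \<le> L \<and> L \<le> L1 \<longrightarrow>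
      b (k + 2) \<le> (L * b (k + 3) + b (k + 1) / L) / 2 + C * q ^ k * b k"
  shows "\<exists>L\<ge>1. \<exists>k. \<forall>j\<ge>k. b j \<le> L * b (j + 1)"
proof -
  have pos: "b k > 0" for k using lower[of k] c \<mu> by (smt (verit) mult_pos_pos zero_less_power)
  \<comment> \<open>If one of two consecutive ratios exceeds L0, then \<open>mono\<close> for the
    other one gives b (k + 2) \<le> (M / L0) * b k, and M / L0 = \<mu>^2 / 2 is a decay that
    \<open>lower\<close> does not allow forever.\<close>
  define L0 where "L0 = 2 * M / \<mu>\<^sup>2"
  have \<mu>2: "\<mu>\<^sup>2 \<le> 1" "\<mu>\<^sup>2 > 0" using \<mu> by (auto simp: power_le_one)
  have "2 * M \<le> L0" unfolding L0_def using M \<mu>2 by (simp add: pos_le_divide_eq mult_left_le)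
  then have L0: "L0 \<ge> 2" "L0 > 0" using M by auto
  obtain C k0 where C: "C \<ge> 0" and cv: "\<And>k L. k \<ge> k0 \<Longrightarrow> 1 \<le> L \<Longrightarrow> L \<le> 2 * L0 \<Longrightarrow>
      b (k + 2) \<le> (L * b (k + 3) + b (k + 1) / L) / 2 + C * q ^ k * b k"
    using conv[of "2 * L0"] L0 by auto
  define D where "D = 4 * C * (2 * L0)\<^sup>2"
  have D: "D \<ge> 0" using C by (simp add: D_def)
  have "(\<lambda>k. 2 * (D + 1) * q ^ k) \<longlonglongrightarrow> 2 * (D + 1) * 0"
    using q by (intro tendsto_intros LIMSEQ_power_zero) auto
  then have "\<forall>\<^sub>F k in sequentially. 2 * (D + 1) * q ^ k < 1 - q"
    using q by (intro order_tendstoD(2)[where y=0]) auto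
  then obtain k1 where k1: "k1 \<ge> k0" "\<And>k. k \<ge> k1 \<Longrightarrow> 2 * (D + 1) * q ^ k < 1 - q"
    unfolding eventually_sequentially by (metis max.cobounded1 max.cobounded2 order_trans)
  have Dq: "2 * D * q ^ k \<le> 1 - q" if "k \<ge> k1" for k
    using k1(2)[OF that] q by (smt (verit) mult_right_mono zero_le_power)
  \<comment> \<open>The two ratio bounds turn the error C q^k b k into a small multiple \<sigma> / 2
    of b (k + 2), which is absorbed on the left; D is chosen so that 2 \<sigma> \<le> D q^k for all
    L up to 2 L0.\<close>
  have step: "b (k + 2) \<le> L * (1 + D * q ^ k) * b (k + 3)"
    if "k \<ge> k1" "1 \<le> L" "L \<le> 2 * L0" "b k \<le> L * b (k + 1)" "b (k + 1) \<le> L * b (k + 2)" for k L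
  proof -
    define \<sigma> where "\<sigma> = 2 * C * L\<^sup>2 * q ^ k"
    have qk: "0 \<le> q ^ k" using q by simp
    have L2: "L\<^sup>2 \<le> (2 * L0)\<^sup>2" using that by (intro power_mono) auto
    have \<sigma>0: "0 \<le> \<sigma>" using C qk by (simp add: \<sigma>_def)
    have "4 * C * L\<^sup>2 * q ^ k \<le> D * q ^ k"
      unfolding D_def using C qk L2 by (intro mult_right_mono mult_left_mono) auto
    then have \<sigma>D: "2 * \<sigma> \<le> D * q ^ k" by (simp add: \<sigma>_def)
    have \<sigma>1: "\<sigma> \<le> 1/2" using \<sigma>D Dq[OF that(1)] q \<sigma>0 by linarith
    have "b k \<le> L * (L * b (k + 2))"
      using that by (intro order_trans[OF that(4)] mult_left_mono) auto
    then have "C * q ^ k * b k \<le> C * q ^ k * (L * (L * b (k + 2)))"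
      using C qk by (intro mult_left_mono) auto
    also have "\<dots> = \<sigma> / 2 * b (k + 2)" by (simp add: \<sigma>_def power2_eq_square)
    finally have 1: "C * q ^ k * b k \<le> \<sigma> / 2 * b (k + 2)" .
    have 2: "b (k + 1) / L \<le> b (k + 2)" using that by (simp add: pos_divide_le_eq mult.commute)
    have "b (k + 2) \<le> (L * b (k + 3) + b (k + 1) / L) / 2 + C * q ^ k * b k"
      using cv that k1 by auto
    moreover have "(1 - \<sigma>) * b (k + 2) = b (k + 2) - 2 * (\<sigma> / 2 * b (k + 2))"
      by (simp add: algebra_simps)
    moreover have "W \<le> B" if "X \<le> (B + y) / 2 + z" "W = X - 2 * s" "z \<le> s" "y \<le> X"
      for X B y z s W :: real using that by (simp add: field_simps)
    ultimately have 3: "(1 - \<sigma>) * b (k + 2) \<le> L * b (k + 3)"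
      using 1 2 by blast
    have "1 \<le> (1 + 2 * \<sigma>) * (1 - \<sigma>)"
    proof -
      have "0 \<le> \<sigma> * (1 - 2 * \<sigma>)" using \<sigma>0 \<sigma>1 by (intro mult_nonneg_nonneg) auto
      then show ?thesis by (simp add: algebra_simps)
    qed
    then have "1 * b (k + 2) \<le> (1 + 2 * \<sigma>) * (1 - \<sigma>) * b (k + 2)"
      using pos[of "k + 2"] by (intro mult_right_mono) auto
    also have "\<dots> = (1 + 2 * \<sigma>) * ((1 - \<sigma>) * b (k + 2))" by (simp add: mult.assoc)
    also have "\<dots> \<le> (1 + 2 * \<sigma>) * (L * b (k + 3))" using 3 \<sigma>0 by (intro mult_left_mono) auto
    also have "\<dots> \<le> (1 + D * q ^ k) * (L * b (k + 3))"
      using \<sigma>D that(2) pos[of "k + 3"] by (intro mult_right_mono) auto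
    finally show ?thesis by (simp add: mult_ac)
  qed
  have "\<exists>k\<ge>k1. b k \<le> L0 * b (k + 1) \<and> b (k + 1) \<le> L0 * b (k + 2)"
  proof (rule ccontr)
    assume no: "\<not> ?thesis"
    have dec: "b (k + 2) \<le> \<mu>\<^sup>2 / 2 * b k" if "k \<ge> k1" for k
    proof -
      have "(L0 / M) * b (k + 2) \<le> b k"
      proof (cases "b k \<le> L0 * b (k + 1)")
        case True
        then have "L0 * b (k + 2) \<le> b (k + 1)" using no that by force
        also have "\<dots> \<le> M * b k" by (rule mono)
        finally show ?thesis using M by (simp add: pos_divide_le_eq mult.commute)
      next
        case False
        have "L0 * b (k + 2) \<le> L0 * (M * b (k + 1))"
          using mono[of "k + 1"] L0 by (intro mult_left_mono) auto
        then have "(L0 / M) * b (k + 2) \<le> L0 * b (k + 1)"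
          using M by (simp add: pos_divide_le_eq mult_ac)
        with False show ?thesis by simp
      qed
      then have "2 * b (k + 2) / \<mu>\<^sup>2 \<le> b k" using M by (simp add: L0_def)
      then show ?thesis using \<mu>2 by (simp add: pos_divide_le_eq pos_le_divide_eq mult_ac)
    qed
    have "b (k1 + 2 * j) \<le> (\<mu>\<^sup>2 / 2) ^ j * b k1" for j
    proof (induction j)
      case (Suc j)
      have "b (k1 + 2 * Suc j) \<le> \<mu>\<^sup>2 / 2 * b (k1 + 2 * j)" using dec[of "k1 + 2 * j"] by (simp add: add.assoc)
      also have "\<dots> \<le> \<mu>\<^sup>2 / 2 * ((\<mu>\<^sup>2 / 2) ^ j * b k1)" using Suc \<mu>2 by (intro mult_left_mono) auto
      finally show ?case by (simp add: mult.assoc)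
    qed simp
    then have "c * \<mu> ^ (k1 + 2 * j) \<le> (\<mu>\<^sup>2 / 2) ^ j * b k1" for j
      using lower order_trans by blast
    moreover have "c * \<mu> ^ (k1 + 2 * j) = (c * \<mu> ^ k1) * (\<mu>\<^sup>2) ^ j" for j
      by (simp only: power_add power_mult mult.assoc)
    moreover have "(\<mu>\<^sup>2 / 2) ^ j * b k1 = (b k1 / 2 ^ j) * (\<mu>\<^sup>2) ^ j" for j
      by (simp add: power_divide)
    ultimately have "(c * \<mu> ^ k1) * (\<mu>\<^sup>2) ^ j \<le> (b k1 / 2 ^ j) * (\<mu>\<^sup>2) ^ j" for j
      by metis
    then have up: "c * \<mu> ^ k1 \<le> b k1 / 2 ^ j" for j
      using \<mu>2 by (meson mult_le_cancel_right_pos zero_less_power)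
    have "(\<lambda>j. b k1 * (1/2) ^ j) \<longlonglongrightarrow> b k1 * 0"
      by (intro tendsto_intros LIMSEQ_power_zero) auto
    moreover have "c * \<mu> ^ k1 \<le> b k1 * (1/2) ^ j" for j
      using up[of j] by (simp only: power_divide power_one times_divide_eq_right mult_1_right)
    ultimately have "c * \<mu> ^ k1 \<le> b k1 * 0" by (intro LIMSEQ_le_const) blast+
    moreover have "0 < c * \<mu> ^ k1" using c \<mu> by simp
    ultimately show False by simp
  qed
  then obtain k where k: "k \<ge> k1" "b k \<le> L0 * b (k + 1)" "b (k + 1) \<le> L0 * b (k + 2)" by auto
  \<comment> \<open>The increment L0 q^j (1 - q) pays for the factor 1 + D q^(k + j) of
    \<open>step\<close>, because 2 D q^k \<le> 1 - q, and the values never leave the range [1, 2 L0]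
    in which \<open>cv\<close> applies.\<close>
  define L where "L j = L0 * (2 - q ^ j)" for j
  have qj: "0 \<le> q ^ j" "q ^ j \<le> 1" for j using q by (auto simp: power_le_one)
  have Lb: "1 \<le> L j" "L j \<le> 2 * L0" for j
  proof -
    have "L0 * 1 \<le> L0 * (2 - q ^ j)" using L0 qj[of j] by (intro mult_left_mono) auto
    then show "1 \<le> L j" using L0 unfolding L_def by linarith
    have "L0 * (2 - q ^ j) \<le> L0 * 2" using L0 qj[of j] by (intro mult_left_mono) auto
    then show "L j \<le> 2 * L0" unfolding L_def by linarith
  qed
  have Lstep: "L j * (1 + D * q ^ (k + j)) \<le> L (Suc j)" for j
  proof -
    have "L j * (D * q ^ (k + j)) \<le> (2 * L0) * (D * q ^ (k + j))"
      using Lb D q by (intro mult_right_mono) auto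
    also have "\<dots> = L0 * q ^ j * (2 * D * q ^ k)" by (simp add: power_add mult_ac)
    also have "\<dots> \<le> L0 * q ^ j * (1 - q)" using Dq[OF k(1)] L0 qj by (intro mult_left_mono) auto
    also have "\<dots> = L (Suc j) - L j" by (simp add: L_def algebra_simps)
    finally show ?thesis by (simp add: algebra_simps)
  qed
  have all: "b (k + j) \<le> L j * b (k + j + 1) \<and> b (k + j + 1) \<le> L j * b (k + j + 2)" for j
  proof (induction j)
    case 0
    then show ?case using k by (simp add: L_def)
  next
    case (Suc j)
    have "b (k + j + 2) \<le> L j * (1 + D * q ^ (k + j)) * b (k + j + 3)"
      using step[of "k + j" "L j"] Suc k Lb[of j] by auto
    also have "\<dots> \<le> L (Suc j) * b (k + j + 3)" using Lstep pos[of "k + j + 3"] by (intro mult_right_mono) auto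
    finally have 1: "b (k + j + 2) \<le> L (Suc j) * b (k + j + 3)" .
    have "L j * 1 \<le> L j * (1 + D * q ^ (k + j))" using Lb[of j] D q by (intro mult_left_mono) auto
    then have "L j \<le> L (Suc j)" using Lstep[of j] by linarith
    then have "L j * b (k + j + 2) \<le> L (Suc j) * b (k + j + 2)" using pos[of "k + j + 2"] by (intro mult_right_mono) auto
    then have 2: "b (k + j + 1) \<le> L (Suc j) * b (k + j + 2)" using Suc by linarith
    have e: "k + j + 1 = k + Suc j" "k + j + 2 = k + Suc j + 1" "k + j + 3 = k + Suc j + 2" by auto
    have "b (k + Suc j) \<le> L (Suc j) * b (k + Suc j + 1) \<and> b (k + Suc j + 1) \<le> L (Suc j) * b (k + Suc j + 2)"
      using 2[unfolded e] 1[unfolded e] by (rule conjI)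
    then show ?case .
  qed
  have "b j \<le> (2 * L0) * b (j + 1)" if jk: "j \<ge> k" for j
  proof -
    define i where "i = j - k"
    have i: "j = k + i" using jk by (simp add: i_def)
    have "b j \<le> L i * b (j + 1)" using all[of i] unfolding i by (rule conjunct1)
    also have "\<dots> \<le> (2 * L0) * b (j + 1)" using Lb(2) pos[of "j + 1"] by (intro mult_right_mono) auto
    finally show ?thesis .
  qed
  moreover have "1 \<le> 2 * L0" using L0 by simp
  ultimately show ?thesis by metis
qed

section \<open>Blow-ups at a flat point\<close>

lemma continuous_on_matrix_vector_mult [continuous_intros]:
  fixes A :: "'a::topological_space \<Rightarrow> real^'m^'k"
  assumes "continuous_on S A" "continuous_on S x"
  shows "continuous_on S (\<lambda>y. A y *v x y)"
  unfolding matrix_vector_mult_def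
  by (intro continuous_on_vec_lambda continuous_on_sum continuous_on_mult continuous_on_component assms)

text \<open>Half cubes take the place of half balls because they are boxes and are still permuted by
  the dilations about x; the point x is the centre of the lower face.\<close>

definition half_cube :: "('n::finite) space \<Rightarrow> real \<Rightarrow> 'n space set" where
  "half_cube x r = cbox (x - r *\<^sub>R (\<chi> i. if i = None then 0 else 1)) (x + r *\<^sub>R (\<chi> i. 1))"

lemma mem_half_cube:
  "y \<in> half_cube x r \<longleftrightarrow> (\<forall>i. \<bar>y $ i - x $ i\<bar> \<le> r) \<and> x $ None \<le> y $ None"
proof -
  have "y \<in> half_cube x r \<longleftrightarrow> (\<forall>i. x $ i - r * (if i = None then 0 else 1) \<le> y $ i \<and> y $ i \<le> x $ i + r)"
    unfolding half_cube_def mem_box_cart by simp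
  also have "\<dots> \<longleftrightarrow> (\<forall>i. \<bar>y $ i - x $ i\<bar> \<le> r) \<and> x $ None \<le> y $ None"
  proof (intro iffI conjI allI)
    fix i assume *: "\<forall>i. x $ i - r * (if i = None then 0 else 1) \<le> y $ i \<and> y $ i \<le> x $ i + r"
    show "\<bar>y $ i - x $ i\<bar> \<le> r" using *[rule_format, of i] by (cases "i = None") auto
    show "x $ None \<le> y $ None" using *[rule_format, of None] by simp
  next
    fix i assume *: "(\<forall>i. \<bar>y $ i - x $ i\<bar> \<le> r) \<and> x $ None \<le> y $ None"
    then have "\<bar>y $ i - x $ i\<bar> \<le> r" "x $ None \<le> y $ None" by blast+
    then show "x $ i - r * (if i = None then 0 else 1) \<le> y $ i" "y $ i \<le> x $ i + r"
      by (cases "i = None"; force)+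
  qed
  finally show ?thesis .
qed

lemma half_cube_mono: "r \<le> s \<Longrightarrow> half_cube x r \<subseteq> half_cube x s"
proof
  fix y assume "r \<le> s" "y \<in> half_cube x r"
  then show "y \<in> half_cube x s" unfolding mem_half_cube by (metis order_trans)
qed

lemma half_cube_scale:
  "y \<in> half_cube 0 r \<Longrightarrow> 0 < c \<Longrightarrow> x + c *\<^sub>R y \<in> half_cube x (c * r)"
  by (simp add: mem_half_cube abs_mult)

lemma compact_half_cube: "compact (half_cube x r)"
  unfolding half_cube_def by (rule compact_cbox)

lemma integrable_half_cube: "continuous_on (half_cube x r) f \<Longrightarrow> f integrable_on half_cube x r"
  for f :: "_ \<Rightarrow> real"
  unfolding half_cube_def by (rule integrable_continuous)

lemma integral_half_cube_affine:
  fixes f :: "'n::finite space \<Rightarrow> real"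
  assumes "continuous_on (half_cube x (m * r)) f" "m > 0"
  shows "integral (half_cube 0 r) (\<lambda>y. f (x + m *\<^sub>R y)) = integral (half_cube x (m * r)) f / m ^ CARD('n option)"
proof -
  let ?l = "(\<chi> i. if i = None then 0 else 1) :: 'n space" and ?h = "(\<chi> i. 1) :: 'n space"
  have "(f has_integral integral (half_cube x (m * r)) f) (cbox (x - (m * r) *\<^sub>R ?l) (x + (m * r) *\<^sub>R ?h))"
    using integrable_integral[OF integrable_half_cube[OF assms(1)]] by (simp add: half_cube_def)
  from has_integral_affinity'[OF this assms(2), of x]
  have "((\<lambda>y. f (m *\<^sub>R y + x)) has_integral integral (half_cube x (m * r)) f /\<^sub>R m ^ DIM('n space)) (half_cube 0 r)"
  proof -
    have e: "inverse m * (m * r) = r" using assms(2) by simp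
    show ?thesis if "((\<lambda>y. f (m *\<^sub>R y + x)) has_integral integral (half_cube x (m * r)) f /\<^sub>R m ^ DIM('n space))
        (cbox ((x - (m * r) *\<^sub>R ?l - x) /\<^sub>R m) ((x + (m * r) *\<^sub>R ?h - x) /\<^sub>R m))"
      using that by (simp add: half_cube_def e)
  qed
  then show ?thesis
    by (simp add: integral_unique add.commute divide_inverse)
qed

locale signorini =
  fixes w :: "('n::finite) space \<Rightarrow> real" and gw :: "'n space \<Rightarrow> 'n space" and a :: "'n coeff"
    and x0 :: "'n space" and R H \<gamma> :: real
  assumes R: "0 < R" and H: "0 < H" and \<gamma>: "0 < \<gamma>" and x0: "x0 $ None = 0"
    and w_deriv: "\<And>x. x \<in> half_cube x0 R \<Longrightarrow> (w has_derivative (\<lambda>h. gw x \<bullet> h)) (at x within half_cube x0 R)"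
    and cont_gw: "continuous_on (half_cube x0 R) gw"
    and cont_a: "continuous_on (half_cube x0 R) a"
    and a_sym: "\<And>x. x \<in> half_cube x0 R \<Longrightarrow> transpose (a x) = a x"
    and a_lower: "\<And>x v. x \<in> half_cube x0 R \<Longrightarrow> (v \<bullet> v) / 2 \<le> v \<bullet> (a x *v v)"
    and a_upper: "\<And>x v. x \<in> half_cube x0 R \<Longrightarrow> v \<bullet> (a x *v v) \<le> 2 * (v \<bullet> v)"
    and a_holder: "\<And>x v. x \<in> half_cube x0 R \<Longrightarrow> norm (a x *v v - a x0 *v v) \<le> H * norm (x - x0) powr \<gamma> * norm v"
    and a_flat: "\<And>x i. x \<in> half_cube x0 R \<Longrightarrow> x $ None = 0 \<Longrightarrow> a x $ None $ Some i = 0"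
    and weak: "\<And>r \<psi>. 0 < r \<Longrightarrow> r \<le> R \<Longrightarrow>
      test_function (box (x0 - r *\<^sub>R (\<chi> i. if i = None then 0 else 1)) (x0 + r *\<^sub>R (\<chi> i. 1))) \<psi> \<Longrightarrow>
      integral (half_cube x0 r) (\<lambda>x. \<Sum>i\<in>UNIV. (a x *v gw x) $ i * partial i UNIV \<psi> x) = 0"
    and sign: "\<And>x. x \<in> half_cube x0 R \<Longrightarrow> x $ None = 0 \<Longrightarrow> 0 \<le> w x \<and> gw x $ None \<le> 0 \<and> w x * gw x $ None = 0"
begin

text \<open>The logarithm of the radius serves as time. Blow-ups are studied on half cubes of size
  3, which contain the support of the widest cutoff, and up to time \<open>T0\<close> the
  corresponding dilates stay in the domain.\<close>

definition T0 :: real where "T0 = ln (R / 3)"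
definition u :: "real \<Rightarrow> 'n space \<Rightarrow> real" where "u t y = w (x0 + exp t *\<^sub>R y)"
definition gr :: "real \<Rightarrow> 'n space \<Rightarrow> 'n space" where "gr t y = exp t *\<^sub>R gw (x0 + exp t *\<^sub>R y)"
definition coef :: "real \<Rightarrow> 'n coeff" where "coef t y = a (x0 + exp t *\<^sub>R y)"

abbreviation Q :: "'n space set" where "Q \<equiv> half_cube 0 3"

lemma exp_T0: "t \<le> T0 \<Longrightarrow> exp t * 3 \<le> R"
proof -
  assume "t \<le> T0"
  then have "exp t \<le> exp (ln (R / 3))" by (simp add: T0_def)
  then show ?thesis using R by simp
qed

lemma scaled_mem: "t \<le> T0 \<Longrightarrow> y \<in> Q \<Longrightarrow> x0 + exp t *\<^sub>R y \<in> half_cube x0 R"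
  using half_cube_scale[of y 3 "exp t" x0] half_cube_mono[OF exp_T0, of t x0] by auto

lemma cont_w: "continuous_on (half_cube x0 R) w"
  using w_deriv by (meson continuous_on_eq_continuous_within has_derivative_continuous)

lemma cont_u: "continuous_on S f \<Longrightarrow> continuous_on S g \<Longrightarrow> (\<And>x. x \<in> S \<Longrightarrow> f x \<le> T0 \<and> g x \<in> Q) \<Longrightarrow>
    continuous_on S (\<lambda>x. u (f x) (g x))"
  unfolding u_def by (rule continuous_on_compose2[OF cont_w]) (auto intro!: continuous_intros scaled_mem)

lemma cont_gr: "continuous_on S f \<Longrightarrow> continuous_on S g \<Longrightarrow> (\<And>x. x \<in> S \<Longrightarrow> f x \<le> T0 \<and> g x \<in> Q) \<Longrightarrow>
    continuous_on S (\<lambda>x. gr (f x) (g x))"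
  unfolding gr_def
  by (intro continuous_on_scaleR continuous_on_exp continuous_on_compose2[OF cont_gw])
    (auto intro!: continuous_intros scaled_mem)

lemma cont_coef: "t \<le> T0 \<Longrightarrow> continuous_on Q (coef t)"
  unfolding coef_def[abs_def]
  by (rule continuous_on_compose2[OF cont_a]) (auto intro!: continuous_intros scaled_mem)

lemma cont_u1: "t \<le> T0 \<Longrightarrow> continuous_on Q (u t)"
  using cont_u[of Q "\<lambda>_. t" "\<lambda>y. y"] by (auto intro: continuous_on_const continuous_on_id)

lemma cont_gr1: "t \<le> T0 \<Longrightarrow> continuous_on Q (gr t)"
  using cont_gr[of Q "\<lambda>_. t" "\<lambda>y. y"] by (auto intro: continuous_on_const continuous_on_id)

text \<open>The time derivative of a blow-up is its radial derivative and thus of first order in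
  w.\<close>

lemma u_deriv:
  assumes "t \<le> T0" "y \<in> Q"
  shows "((\<lambda>t. u t y) has_real_derivative y \<bullet> gr t y) (at t within {..T0})"
proof -
  have "((\<lambda>t. w (x0 + exp t *\<^sub>R y)) has_derivative (\<lambda>h. gw (x0 + exp t *\<^sub>R y) \<bullet> (h * exp t) *\<^sub>R y)) (at t within {..T0})"
  proof (rule has_derivative_in_compose2[OF w_deriv])
    show "(\<lambda>t. x0 + exp t *\<^sub>R y) ` {..T0} \<subseteq> half_cube x0 R" using assms scaled_mem by auto
    show "((\<lambda>t. x0 + exp t *\<^sub>R y) has_derivative (\<lambda>h. (h * exp t) *\<^sub>R y)) (at t within {..T0})"
      by (auto intro!: derivative_eq_intros)
  qed (use assms in auto)
  moreover have "(\<lambda>h. gw (x0 + exp t *\<^sub>R y) \<bullet> (h * exp t) *\<^sub>R y) = (*) (y \<bullet> gr t y)"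
    by (simp add: fun_eq_iff gr_def inner_commute)
  ultimately show ?thesis unfolding has_field_derivative_def u_def by simp
qed

text \<open>As the mixed entries vanish on the flat face, the flux is the normal derivative times a
  diagonal entry, nonnegative by ellipticity. So it inherits the sign and complementarity
  conditions.\<close>

lemma conormal_flat:
  assumes "x \<in> half_cube x0 R" "x $ None = 0"
  shows "\<exists>\<theta>\<ge>0. (a x *v gw x) $ None = \<theta> * gw x $ None"
proof (intro exI conjI)
  have "(a x *v gw x) $ None = (\<Sum>j\<in>UNIV. a x $ None $ j * gw x $ j)"
    by (simp add: matrix_vector_mult_def)
  also have "\<dots> = (\<Sum>j\<in>{None}. a x $ None $ j * gw x $ j)"
  proof (rule sum.mono_neutral_right)
    show "\<forall>i\<in>UNIV - {None}. a x $ None $ i * gw x $ i = 0" using a_flat[OF assms] by auto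
  qed auto
  finally show "(a x *v gw x) $ None = a x $ None $ None * gw x $ None" by simp
  have "axis None 1 \<bullet> (a x *v axis None 1) = a x $ None $ None"
    by (simp add: inner_axis' matrix_vector_mult_basis column_def)
  then show "0 \<le> a x $ None $ None" using a_lower[OF assms(1), of "axis None 1"] by (simp add: inner_axis_axis)
qed

text \<open>
  The dilate \<open>u s\<close> is nonnegative on the flat boundary for every \<open>s\<close>, hence a competitor for \<open>u t\<close>. Comparing
  dilations with each other replaces the second derivatives of the classical monotonicity formulas.
\<close>

lemma scaled_variational_inequality:
  assumes st: "s \<le> T0" "t \<le> T0"
    and \<eta>: "\<And>y. (\<eta> has_derivative (\<lambda>h. g\<eta> y \<bullet> h)) (at y)" and cont_g\<eta>: "continuous_on UNIV g\<eta>"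
    and supp: "\<And>y. norm y \<ge> 29/10 \<Longrightarrow> \<eta> y = 0 \<and> g\<eta> y = 0" and \<eta>0: "\<And>y. 0 \<le> \<eta> y"
    and c: "0 \<le> c \<or> s = t"
  shows "0 \<le> c * integral Q (\<lambda>y. (coef t y *v gr t y) \<bullet> (\<eta> y *\<^sub>R gr s y + u s y *\<^sub>R g\<eta> y))"
proof -
  let ?l = "(\<chi> i. if i = None then 0 else 1) :: 'n space" and ?h = "(\<chi> i. 1) :: 'n space"
  let ?r = "exp t * 3"
  \<comment> \<open>The test is carried out in the original variables at scale exp t: p undoes the
    dilation, and z is chosen so that w (z x) = u s (p x).\<close>
  define p where "p x = (1 / exp t) *\<^sub>R (x - x0)" for x
  define z where "z x = x0 + exp (s - t) *\<^sub>R (x - x0)" for x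
  define \<phi> where "\<phi> x = c * (\<eta> (p x) * w (z x))" for x
  define g where "g x = c *\<^sub>R ((w (z x) / exp t) *\<^sub>R g\<eta> (p x) + (\<eta> (p x) * exp (s - t)) *\<^sub>R gw (z x))" for x
  define V where "V x = a x *v gw x" for x
  let ?B = "half_cube x0 ?r"
  define lo where "lo = x0 - ?r *\<^sub>R ?l"
  define hi where "hi = x0 + ?r *\<^sub>R ?h"
  have Bdef: "cbox lo hi = ?B" by (simp only: half_cube_def lo_def hi_def)
  have lo_None: "lo $ None = 0" by (simp add: lo_def x0)
  have lo_Some: "lo $ Some i = x0 $ Some i - ?r" for i by (simp add: lo_def)
  have hi_nth: "hi $ i = x0 $ i + ?r" for i by (simp add: hi_def)
  have BR: "x \<in> half_cube x0 R" if "x \<in> ?B" for x using that half_cube_mono[OF exp_T0[OF st(2)]] by blast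
  have zR: "z x \<in> half_cube x0 R" if "x \<in> ?B" for x
  proof -
    have "\<bar>z x $ i - x0 $ i\<bar> \<le> exp s * 3" for i
    proof -
      have "exp (s - t) * \<bar>x $ i - x0 $ i\<bar> \<le> exp (s - t) * ?r"
        using that unfolding mem_half_cube by (intro mult_left_mono) auto
      also have "\<dots> = exp s * 3" by (simp add: exp_diff)
      finally show ?thesis by (simp add: z_def abs_mult)
    qed
    moreover have "x0 $ None \<le> z x $ None" using that x0 unfolding mem_half_cube by (simp add: z_def)
    ultimately have "z x \<in> half_cube x0 (exp s * 3)" unfolding mem_half_cube by blast
    then show ?thesis using half_cube_mono[OF exp_T0[OF st(1)]] by blast
  qed
  have cz: "continuous_on ?B z" and cp: "continuous_on ?B p"
    unfolding z_def[abs_def] p_def[abs_def] by (intro continuous_intros)+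
  have c\<eta>: "continuous_on UNIV \<eta>"
    using \<eta> by (meson continuous_at_imp_continuous_on has_derivative_continuous)
  have c1: "continuous_on ?B (\<lambda>x. w (z x))" "continuous_on ?B (\<lambda>x. gw (z x))"
    using cz zR by (auto intro!: continuous_on_compose2[OF cont_w] continuous_on_compose2[OF cont_gw])
  have c2: "continuous_on ?B (\<lambda>x. \<eta> (p x))" "continuous_on ?B (\<lambda>x. g\<eta> (p x))"
    using cp by (auto intro!: continuous_on_compose2[OF c\<eta>] continuous_on_compose2[OF cont_g\<eta>])
  have cV: "continuous_on ?B V"
    unfolding V_def[abs_def] using BR
    by (intro continuous_intros continuous_on_subset[OF cont_a] continuous_on_subset[OF cont_gw]) auto
  have cg: "continuous_on ?B g"
    unfolding g_def[abs_def] by (intro continuous_intros c1 c2) auto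
  have "0 \<le> integral (cbox lo hi) (\<lambda>x. V x \<bullet> g x)"
  proof (rule weak_inequality_up_to_boundary[where \<phi>=\<phi> and K="cball x0 (exp t * (29/10))"])
    show "lo $ None = 0" by (rule lo_None)
    show "lo $ i < hi $ i" for i
      by (cases i) (simp_all add: x0 lo_None lo_Some hi_nth)
    show "continuous_on (cbox lo hi) V" "continuous_on (cbox lo hi) g"
      unfolding Bdef by (rule cV, rule cg)
    show "integral (cbox lo hi) (\<lambda>x. \<Sum>i\<in>UNIV. V x $ i * partial i UNIV \<psi> x) = 0"
      if "test_function (box lo hi) \<psi>" for \<psi>
      unfolding Bdef V_def by (rule weak[OF _ exp_T0[OF st(2)] that[unfolded lo_def hi_def]]) simp
    show "(\<phi> has_derivative (\<lambda>h. g x \<bullet> h)) (at x within cbox lo hi)"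
      if "x \<in> cbox lo hi" for x
    proof -
      have xB: "x \<in> ?B" using that by (simp only: Bdef)
      have dz: "(z has_derivative (\<lambda>h. exp (s - t) *\<^sub>R h)) (at x within ?B)"
        unfolding z_def[abs_def] by (auto intro!: derivative_eq_intros)
      have dp: "(p has_derivative (\<lambda>h. (1 / exp t) *\<^sub>R h)) (at x within ?B)"
        unfolding p_def[abs_def] by (auto intro!: derivative_eq_intros)
      have d1: "((\<lambda>x. w (z x)) has_derivative (\<lambda>h. gw (z x) \<bullet> (exp (s - t) *\<^sub>R h))) (at x within ?B)"
        using zR by (intro has_derivative_in_compose2[OF w_deriv _ xB dz]) auto
      have d2: "((\<lambda>x. \<eta> (p x)) has_derivative (\<lambda>h. g\<eta> (p x) \<bullet> ((1 / exp t) *\<^sub>R h))) (at x within ?B)"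
        by (rule has_derivative_compose[OF dp \<eta>])
      have d3: "(\<phi> has_derivative (\<lambda>h. c * (\<eta> (p x) * (gw (z x) \<bullet> (exp (s - t) *\<^sub>R h)) + g\<eta> (p x) \<bullet> ((1 / exp t) *\<^sub>R h) * w (z x)))) (at x within ?B)"
        unfolding \<phi>_def[abs_def] by (intro has_derivative_mult_right has_derivative_mult d1 d2)
      have "c * (\<eta> (p x) * (gw (z x) \<bullet> (exp (s - t) *\<^sub>R h)) + g\<eta> (p x) \<bullet> ((1 / exp t) *\<^sub>R h) * w (z x)) = g x \<bullet> h" for h
        by (simp add: g_def inner_add_left inner_add_right algebra_simps)
      with d3 show ?thesis unfolding Bdef by simp
    qed
    show "compact (cball x0 (exp t * (29/10)))" by (rule compact_cball)
    show "x \<in> box lo hi" if "x \<in> cball x0 (exp t * (29/10))" "x $ None > 0" for x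
    proof -
      have "\<bar>x $ i - x0 $ i\<bar> < ?r" for i
      proof -
        have "\<bar>x $ i - x0 $ i\<bar> \<le> exp t * (29/10)"
          using that(1) component_le_norm_cart[of "x - x0" i] by (simp add: dist_norm norm_minus_commute)
        also have "\<dots> < ?r" by simp
        finally show ?thesis .
      qed
      then have *: "x $ i - x0 $ i < ?r \<and> x0 $ i - x $ i < ?r" for i by (simp add: abs_less_iff)
      have "lo $ i < x $ i \<and> x $ i < hi $ i" for i
        using *[of i] that(2) by (cases i) (simp_all add: x0 lo_None lo_Some hi_nth)
      then show ?thesis unfolding mem_box_cart by blast
    qed
    have out: "\<eta> (p x) = 0 \<and> g\<eta> (p x) = 0" if "x \<notin> cball x0 (exp t * (29/10))" for x
    proof (rule supp)
      have "exp t * (29/10) < norm (x - x0)" using that by (simp add: dist_norm norm_minus_commute)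
      then have "29/10 < norm (x - x0) / exp t" by (simp add: pos_less_divide_eq mult.commute)
      then show "norm (p x) \<ge> 29/10" by (simp add: p_def)
    qed
    show "\<phi> x = 0" "g x = 0" if "x \<notin> cball x0 (exp t * (29/10))" for x
      using out[OF that] by (simp_all add: \<phi>_def g_def)
    show "\<phi> x * V x $ None \<le> 0" if x: "x \<in> cbox lo hi" "x $ None = 0" for x
    proof -
      have xB: "x \<in> ?B" using x(1) by (simp only: Bdef)
      obtain \<theta> where \<theta>: "\<theta> \<ge> 0" "V x $ None = \<theta> * gw x $ None"
        using conormal_flat[OF BR[OF xB] x(2)] unfolding V_def by blast
      have sx: "0 \<le> w x \<and> gw x $ None \<le> 0 \<and> w x * gw x $ None = 0" by (rule sign[OF BR[OF xB] x(2)])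
      show ?thesis
      proof (cases "s = t")
        \<comment> \<open>For s = t complementarity annihilates the flux, so c may have either sign
          and the inequality becomes an equation.\<close>
        case True
        then have "z x = x" by (simp add: z_def)
        then have "\<phi> x * V x $ None = c * \<eta> (p x) * \<theta> * (w x * gw x $ None)" by (simp add: \<phi>_def \<theta>(2))
        moreover have "w x * gw x $ None = 0" using sx by blast
        ultimately show ?thesis by (simp only: mult_zero_right order_refl)
      next
        case False
        then have "c \<ge> 0" using c by blast
        moreover have "z x $ None = 0" using x(2) x0 by (simp add: z_def)
        then have "0 \<le> w (z x)" using sign[OF zR[OF xB]] by blast
        ultimately have "0 \<le> \<phi> x" using \<eta>0 by (simp add: \<phi>_def)
        moreover have "V x $ None \<le> 0" using \<theta> sx by (simp add: mult_nonneg_nonpos)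
        ultimately show ?thesis by (rule mult_nonneg_nonpos)
      qed
    qed
  qed
  then have nonneg: "0 \<le> integral ?B (\<lambda>x. V x \<bullet> g x)" unfolding Bdef .
  have "V (x0 + exp t *\<^sub>R y) \<bullet> g (x0 + exp t *\<^sub>R y)
      = (c / (exp t * exp t)) * ((coef t y *v gr t y) \<bullet> (\<eta> y *\<^sub>R gr s y + u s y *\<^sub>R g\<eta> y))" for y
  proof -
    have 1: "z (x0 + exp t *\<^sub>R y) = x0 + exp s *\<^sub>R y" by (simp add: z_def exp_diff)
    have 2: "p (x0 + exp t *\<^sub>R y) = y" by (simp add: p_def)
    have 3: "V (x0 + exp t *\<^sub>R y) = (1 / exp t) *\<^sub>R (coef t y *v gr t y)"
      by (simp add: V_def coef_def gr_def matrix_vector_mult_scaleR)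
    have 4: "g (x0 + exp t *\<^sub>R y) = (c / exp t) *\<^sub>R (\<eta> y *\<^sub>R gr s y + u s y *\<^sub>R g\<eta> y)"
      unfolding g_def 1 2 by (simp add: gr_def u_def exp_diff scaleR_add_right algebra_simps)
    show ?thesis unfolding 3 4 by simp
  qed
  then have "integral Q (\<lambda>y. V (x0 + exp t *\<^sub>R y) \<bullet> g (x0 + exp t *\<^sub>R y))
     = (c / (exp t * exp t)) * integral Q (\<lambda>y. (coef t y *v gr t y) \<bullet> (\<eta> y *\<^sub>R gr s y + u s y *\<^sub>R g\<eta> y))"
    by simp
  moreover have "integral Q (\<lambda>y. V (x0 + exp t *\<^sub>R y) \<bullet> g (x0 + exp t *\<^sub>R y)) \<ge> 0"
    using integral_half_cube_affine[of x0 "exp t" 3 "\<lambda>x. V x \<bullet> g x"] nonneg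
    by (simp add: continuous_on_inner[OF cV cg])
  ultimately have "0 \<le> (c * integral Q (\<lambda>y. (coef t y *v gr t y) \<bullet> (\<eta> y *\<^sub>R gr s y + u s y *\<^sub>R g\<eta> y))) / (exp t * exp t)"
    by simp
  then show ?thesis by (subst (asm) pos_le_divide_eq) simp_all
qed

lemma x0_mem: "x0 \<in> half_cube x0 R"
  using R by (simp add: mem_half_cube)

definition B :: "((real, 'n option) vec, 'n option) vec" where
  "B = (SOME B. transpose B = B \<and> (\<forall>x. a x0 *v (B *v x) = x) \<and>
     (\<forall>x. (x \<bullet> x) / 2 \<le> x \<bullet> (B *v x)) \<and> (\<forall>x. norm (B *v x) \<le> 2 * norm x))"

lemma B: "transpose B = B" "a x0 *v (B *v x) = x" "(x \<bullet> x) / 2 \<le> x \<bullet> (B *v x)"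
  "norm (B *v x) \<le> 2 * norm x"
proof -
  have "\<exists>B. transpose B = B \<and> (\<forall>x. a x0 *v (B *v x) = x) \<and>
     (\<forall>x. (x \<bullet> x) / 2 \<le> x \<bullet> (B *v x)) \<and> (\<forall>x. norm (B *v x) \<le> 2 * norm x)"
    using elliptic_inverse[OF a_sym[OF x0_mem] a_lower[OF x0_mem] a_upper[OF x0_mem]] by metis
  from someI_ex[OF this, folded B_def]
  show "transpose B = B" "a x0 *v (B *v x) = x" "(x \<bullet> x) / 2 \<le> x \<bullet> (B *v x)"
    "norm (B *v x) \<le> 2 * norm x" by blast+
qed

text \<open>
  The cutoffs are adapted to the frozen matrix: \<open>a x0 *v g\<eta> 1 y = - \<psi> y *\<^sub>R y\<close> with \<open>\<psi> = 4 * \<theta> 1\<close>, so that testing with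
  \<open>\<eta> 1 y *\<^sub>R u s y\<close> produces the derivative of \<open>u t\<close> in \<open>t\<close>.
\<close>

definition q :: "'n space \<Rightarrow> real" where "q y = y \<bullet> (B *v y)"
definition \<theta> :: "real \<Rightarrow> 'n space \<Rightarrow> real" where "\<theta> \<delta> y = max 0 (1 - \<delta> * q y)"
definition \<eta> :: "real \<Rightarrow> 'n space \<Rightarrow> real" where "\<eta> \<delta> y = (\<theta> \<delta> y)\<^sup>2"
definition g\<eta> :: "real \<Rightarrow> 'n space \<Rightarrow> 'n space" where "g\<eta> \<delta> y = (- 4 * \<delta> * \<theta> \<delta> y) *\<^sub>R (B *v y)"

lemma q_lower: "(norm y)\<^sup>2 / 2 \<le> q y"
  using B(3)[of y] by (simp add: q_def dot_square_norm)

lemma q_nonneg: "0 \<le> q y"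
  using q_lower[of y] zero_le_power2[of "norm y"] by linarith

lemma q_upper: "q y \<le> 2 * (norm y)\<^sup>2"
proof -
  have "q y \<le> norm y * norm (B *v y)" unfolding q_def by (rule norm_cauchy_schwarz)
  also have "\<dots> \<le> norm y * (2 * norm y)" by (intro mult_left_mono B(4)) simp
  finally show ?thesis by (simp add: power2_eq_square)
qed

lemma q_scale: "q (c *\<^sub>R y) = c\<^sup>2 * q y"
  by (simp add: q_def matrix_vector_mult_scaleR power2_eq_square)

lemma \<theta>_bounds: "0 \<le> \<delta> \<Longrightarrow> 0 \<le> \<theta> \<delta> y \<and> \<theta> \<delta> y \<le> 1"
  using mult_nonneg_nonneg[OF _ q_nonneg[of y], of \<delta>] by (simp add: \<theta>_def)

lemma \<theta>_support:
  assumes "\<theta> \<delta> y \<noteq> 0" "0 < \<delta>"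
  shows "(norm y)\<^sup>2 < 2 / \<delta>"
proof -
  have "\<delta> * q y < 1" using assms by (auto simp: \<theta>_def max_def split: if_splits)
  moreover have "\<delta> * ((norm y)\<^sup>2 / 2) \<le> \<delta> * q y" using q_lower assms by (intro mult_left_mono) auto
  ultimately have "\<delta> * (norm y)\<^sup>2 < 2" unfolding times_divide_eq_right by linarith
  then show ?thesis using assms by (simp add: pos_less_divide_eq mult.commute)
qed

text \<open>Because q y is at least |y|^2 / 2, the widest cutoff, \<delta> = 1/4, lives where |y|^2
  < 8, and 8 < (29/10)^2. The gap between 29/10 and 3 keeps supports away from the faces of
  \<open>Q\<close> other than the flat one.\<close>

lemma norm_lt_if_\<theta>: "\<theta> \<delta> y \<noteq> 0 \<Longrightarrow> 1/4 \<le> \<delta> \<Longrightarrow> norm y < 29/10"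
proof -
  assume "\<theta> \<delta> y \<noteq> 0" "1/4 \<le> \<delta>"
  then have "(norm y)\<^sup>2 < 2 / \<delta>" by (intro \<theta>_support) auto
  also have "\<dots> \<le> 8" using \<open>1/4 \<le> \<delta>\<close> by (simp add: pos_divide_le_eq)
  also have "(8::real) < (29/10)\<^sup>2" by (simp add: power2_eq_square)
  finally show ?thesis by (rule power_less_imp_less_base) simp
qed

lemma \<eta>_deriv: "(\<eta> \<delta> has_derivative (\<lambda>h. g\<eta> \<delta> y \<bullet> h)) (at y)"
proof -
  have dB: "((\<lambda>y. B *v y) has_derivative (\<lambda>h. B *v h)) (at y)"
    by (intro bounded_linear_imp_has_derivative matrix_vector_mul_bounded_linear)
  have "((\<lambda>y. y \<bullet> (B *v y)) has_derivative (\<lambda>h. y \<bullet> (B *v h) + h \<bullet> (B *v y))) (at y)"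
    by (rule has_derivative_inner[OF has_derivative_ident dB])
  moreover have "y \<bullet> (B *v h) + h \<bullet> (B *v y) = 2 * ((B *v y) \<bullet> h)" for h
    using sym_matrix_inner[OF B(1), of y h] by (simp add: inner_commute)
  ultimately have dq: "(q has_derivative (\<lambda>h. 2 * ((B *v y) \<bullet> h))) (at y)"
    unfolding q_def[abs_def] by simp
  have "((\<lambda>y. 1 - \<delta> * q y) has_derivative (\<lambda>h. - (\<delta> * (2 * ((B *v y) \<bullet> h))))) (at y)"
    by (rule has_derivative_eq_rhs, (rule derivative_intros dq)+) simp
  from has_derivative_compose[OF this DERIV_max_0_square[unfolded has_field_derivative_def]]
  show ?thesis unfolding \<eta>_def[abs_def] \<theta>_def g\<eta>_def by (simp add: mult_ac)
qed

lemma cont_q: "continuous_on S q"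
  unfolding q_def[abs_def] by (intro continuous_intros)

lemma cont_\<theta>: "continuous_on S (\<theta> \<delta>)"
  unfolding \<theta>_def[abs_def] by (intro continuous_on_max continuous_on_const continuous_on_diff continuous_on_mult cont_q)

lemma cont_\<eta>: "continuous_on S (\<eta> \<delta>)"
  unfolding \<eta>_def[abs_def] by (intro continuous_on_power cont_\<theta>)

lemma cont_g\<eta>: "continuous_on S (g\<eta> \<delta>)"
  unfolding g\<eta>_def[abs_def]
  by (intro continuous_on_scaleR continuous_on_mult continuous_on_const cont_\<theta> continuous_on_matrix_vector_mult continuous_on_id)

lemma \<eta>_supp: "1/4 \<le> \<delta> \<Longrightarrow> norm y \<ge> 29/10 \<Longrightarrow> \<eta> \<delta> y = 0 \<and> g\<eta> \<delta> y = 0"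
  using norm_lt_if_\<theta>[of \<delta> y] by (auto simp: \<eta>_def g\<eta>_def)

lemma variational:
  assumes "s \<le> T0" "t \<le> T0" "1/4 \<le> \<delta>" "0 \<le> c \<or> s = t"
  shows "0 \<le> c * integral Q (\<lambda>y. (coef t y *v gr t y) \<bullet> (\<eta> \<delta> y *\<^sub>R gr s y + u s y *\<^sub>R g\<eta> \<delta> y))"
  by (rule scaled_variational_inequality[OF assms(1,2) \<eta>_deriv cont_g\<eta> \<eta>_supp[OF assms(3)] _ assms(4)])
    (simp_all add: \<eta>_def)

section \<open>Weighted masses and energies of the blow-ups\<close>

definition Mass :: "real \<Rightarrow> real" where "Mass t = integral Q (\<lambda>y. (u t y)\<^sup>2)"
definition Dir :: "real \<Rightarrow> real" where "Dir t = integral Q (\<lambda>y. \<eta> (1/4) y * (gr t y \<bullet> gr t y))"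
definition \<psi> :: "'n space \<Rightarrow> real" where "\<psi> y = 4 * \<theta> 1 y"
definition G :: "real \<Rightarrow> real" where "G t = integral Q (\<lambda>y. \<psi> y * (u t y)\<^sup>2)"

lemma cont_\<psi>: "continuous_on S \<psi>"
  unfolding \<psi>_def[abs_def] by (intro continuous_on_mult continuous_on_const cont_\<theta>)

lemma \<psi>_bounds: "0 \<le> \<psi> y" "\<psi> y \<le> 4"
  using \<theta>_bounds[of 1 y] by (simp_all add: \<psi>_def)

lemma coef_norm:
  assumes "t \<le> T0" "y \<in> Q"
  shows "norm (coef t y *v v) \<le> 2 * norm v"
proof -
  have x: "x0 + exp t *\<^sub>R y \<in> half_cube x0 R" using assms by (rule scaled_mem)
  have psd: "0 \<le> v \<bullet> (a (x0 + exp t *\<^sub>R y) *v v)" for v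
    using a_lower[OF x, of v] inner_ge_zero[of v] by linarith
  show ?thesis unfolding coef_def
    by (rule form_bound_imp_norm_bound(2)[OF a_sym[OF x] psd a_upper[OF x]]) simp
qed

text \<open>The variational inequality for s = t and c = - 1 with the wide cutoff. On its support
  norm (B y) \<le> 6 and the coefficients have norm at most 2, so the mixed term is at most 12 Y g
  |u|. Half of the ellipticity term absorbs it up to 144 u^2, and 576 = 4 * 144.\<close>

lemma Caccioppoli:
  assumes t: "t \<le> T0"
  shows "Dir t \<le> 576 * Mass t"
proof -
  let ?I = "\<lambda>y. (coef t y *v gr t y) \<bullet> (\<eta> (1/4) y *\<^sub>R gr t y + u t y *\<^sub>R g\<eta> (1/4) y)"
  note ci = cont_u1[OF t] cont_gr1[OF t] cont_coef[OF t] cont_\<eta> cont_g\<eta>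
  have i1: "?I integrable_on Q"
    by (intro integrable_half_cube continuous_on_inner continuous_on_matrix_vector_mult continuous_on_add continuous_on_scaleR ci)
  have i2: "(\<lambda>y. \<eta> (1/4) y * (gr t y \<bullet> gr t y)) integrable_on Q"
    by (intro integrable_half_cube continuous_on_inner continuous_on_mult ci)
  have i3: "(\<lambda>y. (u t y)\<^sup>2) integrable_on Q"
    by (intro integrable_half_cube continuous_on_power ci)
  have i4: "(\<lambda>y. (1/4) * (\<eta> (1/4) y * (gr t y \<bullet> gr t y)) - 144 * (u t y)\<^sup>2) integrable_on Q"
    by (intro integrable_diff integrable_on_mult_right i2 i3)
  have "(1/4) * Dir t - 144 * Mass t = integral Q (\<lambda>y. (1/4) * (\<eta> (1/4) y * (gr t y \<bullet> gr t y)) - 144 * (u t y)\<^sup>2)"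
    unfolding Dir_def Mass_def
    by (subst integral_diff[OF integrable_on_mult_right[OF i2] integrable_on_mult_right[OF i3]]) simp
  also have "\<dots> \<le> integral Q ?I"
  proof (rule integral_le[OF i4 i1])
    fix y assume y: "y \<in> Q"
    define Y where "Y = \<theta> (1/4) y"
    define g where "g = norm (gr t y)"
    have Y: "0 \<le> Y" unfolding Y_def using \<theta>_bounds[of "1/4" y] by simp
    have e: "\<eta> (1/4) y = Y\<^sup>2" by (simp add: \<eta>_def Y_def)
    have "g\<^sup>2 / 2 \<le> (coef t y *v gr t y) \<bullet> gr t y"
      using a_lower[OF scaled_mem[OF t y], of "gr t y"] by (simp add: coef_def g_def dot_square_norm inner_commute)
    then have 1: "Y\<^sup>2 * (g\<^sup>2 / 2) \<le> Y\<^sup>2 * ((coef t y *v gr t y) \<bullet> gr t y)" by (intro mult_left_mono) auto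
    have 2: "- (12 * (Y * g * \<bar>u t y\<bar>)) \<le> u t y * ((coef t y *v gr t y) \<bullet> g\<eta> (1/4) y)"
    proof -
      have "norm (g\<eta> (1/4) y) \<le> Y * 6"
      proof (cases "Y = 0")
        case False
        then have "norm y < 29/10" unfolding Y_def by (rule norm_lt_if_\<theta>) simp
        then have "norm (B *v y) \<le> 6" using B(4)[of y] by linarith
        then have "Y * norm (B *v y) \<le> Y * 6" using Y by (intro mult_left_mono)
        then show ?thesis using Y by (simp add: g\<eta>_def Y_def)
      qed (simp add: g\<eta>_def Y_def)
      then have "norm (coef t y *v gr t y) * norm (g\<eta> (1/4) y) \<le> (2 * g) * (Y * 6)"
        unfolding g_def by (intro mult_mono coef_norm[OF t y]) auto
      then have "\<bar>(coef t y *v gr t y) \<bullet> g\<eta> (1/4) y\<bar> \<le> 12 * (Y * g)"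
        using Cauchy_Schwarz_ineq2[of "coef t y *v gr t y" "g\<eta> (1/4) y"] by (simp add: mult_ac)
      then have "\<bar>u t y\<bar> * \<bar>(coef t y *v gr t y) \<bullet> g\<eta> (1/4) y\<bar> \<le> \<bar>u t y\<bar> * (12 * (Y * g))"
        by (intro mult_left_mono) auto
      then have "\<bar>u t y * ((coef t y *v gr t y) \<bullet> g\<eta> (1/4) y)\<bar> \<le> 12 * (Y * g * \<bar>u t y\<bar>)"
        by (simp add: abs_mult mult_ac)
      then show ?thesis by linarith
    qed
    have "0 \<le> (Y * g / 2 - 12 * \<bar>u t y\<bar>)\<^sup>2" by simp
    then have 3: "12 * (Y * g * \<bar>u t y\<bar>) \<le> Y\<^sup>2 * g\<^sup>2 / 4 + 144 * (u t y)\<^sup>2"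
      by (simp add: power2_diff power_mult_distrib power_divide mult_ac)
    have "?I y = Y\<^sup>2 * ((coef t y *v gr t y) \<bullet> gr t y) + u t y * ((coef t y *v gr t y) \<bullet> g\<eta> (1/4) y)"
      by (simp add: inner_add_right e)
    moreover have "1 / 4 * (\<eta> (1/4) y * (gr t y \<bullet> gr t y)) = Y\<^sup>2 * g\<^sup>2 / 4"
      by (simp add: e g_def dot_square_norm)
    ultimately show "1 / 4 * (\<eta> (1/4) y * (gr t y \<bullet> gr t y)) - 144 * (u t y)\<^sup>2 \<le> ?I y"
      using 1 2 3 by simp
  qed
  also have "\<dots> \<le> 0" using variational[of t t "1/4" "-1"] t by simp
  finally show ?thesis by simp
qed

lemma integral_dilate_le:
  fixes f :: "'n space \<Rightarrow> real"
  assumes "continuous_on Q f" "\<And>y. y \<in> Q \<Longrightarrow> 0 \<le> f y" "0 < c" "c \<le> 1"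
  shows "c ^ CARD('n option) * integral Q (\<lambda>y. f (c *\<^sub>R y)) \<le> integral Q f"
proof -
  have sub: "half_cube 0 (c * 3) \<subseteq> (Q :: 'n space set)" using assms by (intro half_cube_mono) simp
  have cf: "continuous_on (half_cube 0 (c * 3)) f" by (rule continuous_on_subset[OF assms(1) sub])
  have "integral Q (\<lambda>y. f (c *\<^sub>R y)) = integral (half_cube 0 (c * 3)) f / c ^ CARD('n option)"
    using integral_half_cube_affine[of 0 c 3 f] cf assms(3) by simp
  then have "c ^ CARD('n option) * integral Q (\<lambda>y. f (c *\<^sub>R y)) = integral (half_cube 0 (c * 3)) f"
    using assms(3) by simp
  also have "\<dots> \<le> integral Q f"
    by (rule integral_subset_le[OF sub integrable_half_cube[OF cf] integrable_half_cube[OF assms(1)]])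
      (use assms(2) in blast)
  finally show ?thesis .
qed

lemma u_dilate: "u t (exp (s - t) *\<^sub>R y) = u s y"
  by (simp add: u_def exp_diff)

text \<open>With d the dimension, exp (d t) G t is a weighted mass of w around x0 itself, and its
  weight grows with t because q decreases under contractions.\<close>

lemma G_mono:
  assumes "s \<le> t" "t \<le> T0"
  shows "exp (s - t) ^ CARD('n option) * G s \<le> G t"
proof -
  have s: "s \<le> T0" using assms by simp
  have cf: "continuous_on Q (\<lambda>y. \<psi> y * (u t y)\<^sup>2)"
    by (intro continuous_on_mult continuous_on_power cont_\<psi> cont_u1[OF assms(2)])
  have c2: "exp (s - t) *\<^sub>R y \<in> Q" if "y \<in> Q" for y
    using half_cube_scale[OF that, of "exp (s - t)" 0] half_cube_mono[of "exp (s - t) * 3" 3 0] assms by auto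
  have "G s \<le> integral Q (\<lambda>y. \<psi> (exp (s - t) *\<^sub>R y) * (u t (exp (s - t) *\<^sub>R y))\<^sup>2)"
    unfolding G_def
  proof (rule integral_le)
    show "(\<lambda>y. \<psi> y * (u s y)\<^sup>2) integrable_on Q"
      by (intro integrable_half_cube continuous_on_mult continuous_on_power cont_\<psi> cont_u1[OF s])
    show "(\<lambda>y. \<psi> (exp (s - t) *\<^sub>R y) * (u t (exp (s - t) *\<^sub>R y))\<^sup>2) integrable_on Q"
      by (intro integrable_half_cube continuous_on_compose2[OF cf] continuous_on_scaleR continuous_on_const continuous_on_id)
        (use c2 in blast)
    fix y :: "'n space"
    have "q (exp (s - t) *\<^sub>R y) \<le> 1 * q y"
      unfolding q_scale using assms by (intro mult_right_mono q_nonneg) (simp add: power_le_one)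
    then have "\<psi> y \<le> \<psi> (exp (s - t) *\<^sub>R y)" by (simp add: \<psi>_def \<theta>_def)
    then show "\<psi> y * (u s y)\<^sup>2 \<le> \<psi> (exp (s - t) *\<^sub>R y) * (u t (exp (s - t) *\<^sub>R y))\<^sup>2"
      unfolding u_dilate by (intro mult_right_mono) auto
  qed
  then have "exp (s - t) ^ CARD('n option) * G s \<le> exp (s - t) ^ CARD('n option) *
      integral Q (\<lambda>y. \<psi> (exp (s - t) *\<^sub>R y) * (u t (exp (s - t) *\<^sub>R y))\<^sup>2)"
    by (intro mult_left_mono) auto
  also have "\<dots> \<le> G t" unfolding G_def
    by (rule integral_dilate_le[OF cf]) (use assms \<psi>_bounds in auto)
  finally show ?thesis .
qed

text \<open>The step \<open>\<tau>\<close> is so large that \<open>\<psi> \<ge> 2\<close> on the cube \<open>exp (- \<tau>) *\<^sub>R Q\<close>.\<close>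

definition \<tau> :: real where "\<tau> = ln (6 * real CARD('n option))"

lemma exp_\<tau>: "exp \<tau> = 6 * real CARD('n option)" "0 < \<tau>"
proof -
  have d: "1 \<le> CARD('n option)" by simp
  then show "exp \<tau> = 6 * real CARD('n option)" by (simp add: \<tau>_def)
  have "6 * 1 \<le> 6 * real CARD('n option)" using d by (intro mult_left_mono) auto
  then show "0 < \<tau>" unfolding \<tau>_def by (intro ln_gt_zero) linarith
qed

lemma norm_Q:
  assumes "y \<in> Q"
  shows "norm y \<le> 3 * real CARD('n option)"
proof -
  have "norm y \<le> (\<Sum>i\<in>UNIV. \<bar>y $ i\<bar>)" by (rule norm_le_l1_cart)
  also have "\<dots> \<le> (\<Sum>i\<in>(UNIV::'n option set). 3)" using assms unfolding mem_half_cube by (intro sum_mono) auto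
  finally show ?thesis by (simp add: mult.commute)
qed

text \<open>Energy estimates involve the mass on the whole half cube, whereas G only sees the
  support of \<open>\<psi>\<close>. One step up in scale closes this gap, at the price of measuring
  errors at larger scales.\<close>

lemma Mass_le_G:
  assumes "t + \<tau> \<le> T0"
  shows "2 * Mass t \<le> exp \<tau> ^ CARD('n option) * G (t + \<tau>)"
proof -
  let ?d = "CARD('n option)"
  let ?t = "t + \<tau>" 
  let ?c = "exp (t - ?t)"
  have t: "t \<le> T0" using assms exp_\<tau>(2) by simp
  have cle: "?c \<le> 1" using exp_\<tau>(2) by simp
  have ce: "?c = 1 / (6 * real ?d)"
  proof -
    have "?c = exp (- \<tau>)" by simp
    then show ?thesis unfolding exp_minus exp_\<tau>(1) inverse_eq_divide by simp
  qed
  have cf: "continuous_on Q (\<lambda>y. \<psi> y * (u ?t y)\<^sup>2)"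
    by (intro continuous_on_mult continuous_on_power cont_\<psi> cont_u1[OF assms])
  have c2: "?c *\<^sub>R y \<in> Q" if "y \<in> Q" for y
    using half_cube_scale[OF that, of ?c 0] half_cube_mono[of "?c * 3" 3 0] cle by auto
  have "2 * Mass t = integral Q (\<lambda>y. 2 * (u t y)\<^sup>2)" unfolding Mass_def by simp
  also have "\<dots> \<le> integral Q (\<lambda>y. \<psi> (?c *\<^sub>R y) * (u ?t (?c *\<^sub>R y))\<^sup>2)"
  proof (rule integral_le)
    show "(\<lambda>y. 2 * (u t y)\<^sup>2) integrable_on Q"
      by (intro integrable_half_cube continuous_on_mult continuous_on_power continuous_on_const cont_u1[OF t])
    show "(\<lambda>y. \<psi> (?c *\<^sub>R y) * (u ?t (?c *\<^sub>R y))\<^sup>2) integrable_on Q"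
      by (intro integrable_half_cube continuous_on_compose2[OF cf] continuous_on_scaleR continuous_on_const continuous_on_id)
        (use c2 in blast)
    fix y :: "'n space" assume y: "y \<in> Q"
    \<comment> \<open>In dimension d a point of \<open>Q\<close> has norm at most 3 d, and the
      contraction divides by 6 d; then q \<le> 2 * (1/2)^2.\<close>
    have "norm (?c *\<^sub>R y) \<le> 1 / 2"
    proof -
      have "norm (?c *\<^sub>R y) = ?c * norm y" by simp
      also have "\<dots> \<le> 1 / (6 * real ?d) * (3 * real ?d)"
        unfolding ce by (intro mult_left_mono norm_Q[OF y]) (rule divide_nonneg_nonneg, simp_all)
      also have "\<dots> = 1 / 2" by (simp del: of_nat_Suc card_option)
      finally show ?thesis .
    qed
    then have "(norm (?c *\<^sub>R y))\<^sup>2 \<le> (1/2)\<^sup>2" by (intro power_mono) auto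
    then have "q (?c *\<^sub>R y) \<le> 1 / 2" using q_upper[of "?c *\<^sub>R y"] by (simp add: power2_eq_square)
    then have "2 \<le> \<psi> (?c *\<^sub>R y)" by (simp add: \<psi>_def \<theta>_def)
    then show "2 * (u t y)\<^sup>2 \<le> \<psi> (?c *\<^sub>R y) * (u ?t (?c *\<^sub>R y))\<^sup>2"
      unfolding u_dilate by (intro mult_right_mono) auto
  qed
  finally have 1: "2 * Mass t \<le> integral Q (\<lambda>y. \<psi> (?c *\<^sub>R y) * (u ?t (?c *\<^sub>R y))\<^sup>2)" .
  have 2: "?c ^ ?d * integral Q (\<lambda>y. \<psi> (?c *\<^sub>R y) * (u ?t (?c *\<^sub>R y))\<^sup>2) \<le> G ?t" unfolding G_def
    by (rule integral_dilate_le[OF cf]) (use cle \<psi>_bounds in auto)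
  have "exp \<tau> * ?c = 1" by (simp flip: exp_add)
  then have "(exp \<tau> ^ ?d) * (?c ^ ?d) = 1" by (metis power_mult_distrib power_one)
  then have "2 * Mass t \<le> (exp \<tau> ^ ?d) * (?c ^ ?d) * integral Q (\<lambda>y. \<psi> (?c *\<^sub>R y) * (u ?t (?c *\<^sub>R y))\<^sup>2)"
    using 1 by (simp only: mult_1_left)
  also have "\<dots> = exp \<tau> ^ ?d * (?c ^ ?d * integral Q (\<lambda>y. \<psi> (?c *\<^sub>R y) * (u ?t (?c *\<^sub>R y))\<^sup>2))"
    by (simp only: mult.assoc)
  also have "\<dots> \<le> exp \<tau> ^ ?d * G ?t" by (intro mult_left_mono 2) simp
  finally show ?thesis .
qed

section \<open>The approximate gradient flow of the blow-ups\<close>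

definition F :: "real \<Rightarrow> real \<Rightarrow> real" where "F s t = integral Q (\<lambda>y. \<psi> y * u s y * u t y)"
definition D :: "real \<Rightarrow> real \<Rightarrow> real" where "D s t = integral Q (\<lambda>y. \<psi> y * u s y * (y \<bullet> gr t y))"

text \<open>Blow-ups exist only up to \<open>T0\<close>, so differentiation under the integral takes
  place within {..T0}; before \<open>T0\<close> this is the full derivative.\<close>

lemma leibniz_Q:
  assumes t: "t < T0"
    and d: "\<And>t y. t \<le> T0 \<Longrightarrow> y \<in> Q \<Longrightarrow> ((\<lambda>t. f t y) has_real_derivative f' t y) (at t within {..T0})"
    and i: "\<And>t. t \<le> T0 \<Longrightarrow> continuous_on Q (f t)"
    and c: "continuous_on ({..T0} \<times> Q) (\<lambda>p. f' (fst p) (snd p))"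
  shows "((\<lambda>t. integral Q (f t)) has_real_derivative integral Q (f' t)) (at t)"
proof -
  have "((\<lambda>t. integral Q (f t)) has_real_derivative integral Q (f' t)) (at t within {..T0})"
    unfolding half_cube_def
  proof (rule leibniz_rule_field_derivative, fold half_cube_def)
    show "f t integrable_on Q" if "t \<in> {..T0}" for t using that by (intro integrable_half_cube i) simp
    show "continuous_on ({..T0} \<times> Q) (\<lambda>(t, y). f' t y)" unfolding case_prod_beta by (rule c)
  qed (use t d in auto)
  moreover have "at t within {..T0} = at t" by (rule at_within_interior) (use t in simp)
  ultimately show ?thesis by simp
qed

lemma cont_u_joint: "continuous_on ({..T0} \<times> Q) (\<lambda>p. u (fst p) (snd p))"
  by (rule cont_u) (auto intro: continuous_on_fst continuous_on_snd continuous_on_id)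

lemma cont_gr_joint: "continuous_on ({..T0} \<times> Q) (\<lambda>p. gr (fst p) (snd p))"
  by (rule cont_gr) (auto intro: continuous_on_fst continuous_on_snd continuous_on_id)

lemma cont_snd_comp: "continuous_on Q f \<Longrightarrow> continuous_on ({..T0} \<times> Q) (\<lambda>p. f (snd p))"
  by (rule continuous_on_compose2[where t=Q]) (auto intro: continuous_on_snd continuous_on_id)

lemma F_deriv:
  assumes s: "s \<le> T0" and t: "t < T0"
  shows "(F s has_real_derivative D s t) (at t)"
  unfolding F_def[abs_def] D_def
proof (rule leibniz_Q[OF t])
  show "((\<lambda>t. \<psi> y * u s y * u t y) has_real_derivative \<psi> y * u s y * (y \<bullet> gr t y)) (at t within {..T0})"
    if "t \<le> T0" "y \<in> Q" for t y
    by (intro DERIV_cmult u_deriv that)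
  show "continuous_on Q (\<lambda>y. \<psi> y * u s y * u t y)" if "t \<le> T0" for t
    by (intro continuous_on_mult cont_\<psi> cont_u1 s that)
  show "continuous_on ({..T0} \<times> Q) (\<lambda>p. \<psi> (snd p) * u s (snd p) * (snd p \<bullet> gr (fst p) (snd p)))"
    by (intro continuous_on_mult continuous_on_inner cont_gr_joint cont_snd_comp cont_\<psi> cont_u1 s
        continuous_on_snd continuous_on_id)
qed

lemma G_deriv:
  assumes t: "t < T0"
  shows "(G has_real_derivative 2 * D t t) (at t)"
proof -
  have "(G has_real_derivative integral Q (\<lambda>y. 2 * (\<psi> y * u t y * (y \<bullet> gr t y)))) (at t)"
    unfolding G_def[abs_def]
  proof (rule leibniz_Q[OF t])
    show "((\<lambda>t. \<psi> y * (u t y)\<^sup>2) has_real_derivative 2 * (\<psi> y * u t y * (y \<bullet> gr t y))) (at t within {..T0})"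
      if "t \<le> T0" "y \<in> Q" for t y
      by (rule DERIV_cong[OF DERIV_cmult[OF DERIV_power[OF u_deriv[OF that]]]]) simp
    show "continuous_on Q (\<lambda>y. \<psi> y * (u t y)\<^sup>2)" if "t \<le> T0" for t
      by (intro continuous_on_mult continuous_on_power cont_\<psi> cont_u1 that)
    show "continuous_on ({..T0} \<times> Q) (\<lambda>p. 2 * (\<psi> (snd p) * u (fst p) (snd p) * (snd p \<bullet> gr (fst p) (snd p))))"
      by (intro continuous_on_mult continuous_on_inner cont_gr_joint cont_u_joint cont_snd_comp cont_\<psi>
          continuous_on_snd continuous_on_id continuous_on_const)
  qed
  then show ?thesis by (simp add: D_def)
qed

lemma F_diag: "F t t = G t"
  by (simp add: F_def G_def power2_eq_square mult.assoc)

lemma two_F_le: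
  assumes s: "s \<le> T0" and t: "t \<le> T0" and \<rho>: "\<rho> > 0"
  shows "2 * F s t \<le> \<rho> * G s + G t / \<rho>"
proof -
  have i: "(\<lambda>y. \<psi> y * u s y * u t y) integrable_on Q" "(\<lambda>y. \<psi> y * (u s y)\<^sup>2) integrable_on Q"
    "(\<lambda>y. \<psi> y * (u t y)\<^sup>2) integrable_on Q"
    by (intro integrable_half_cube continuous_on_mult continuous_on_power cont_\<psi> cont_u1 s t)+
  have "2 * F s t = integral Q (\<lambda>y. 2 * (\<psi> y * u s y * u t y))" by (simp add: F_def)
  also have "\<dots> \<le> integral Q (\<lambda>y. \<rho> * (\<psi> y * (u s y)\<^sup>2) + (1 / \<rho>) * (\<psi> y * (u t y)\<^sup>2))"
  proof (rule integral_le)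
    fix y
    have "2 * (u s y * u t y) \<le> \<rho> * (u s y)\<^sup>2 + (1 / \<rho>) * (u t y)\<^sup>2"
    proof -
      have "0 \<le> (\<rho> * u s y - u t y)\<^sup>2 / \<rho>" using \<rho> by simp
      also have "\<dots> = \<rho> * (u s y)\<^sup>2 + (1 / \<rho>) * (u t y)\<^sup>2 - 2 * (u s y * u t y)"
        using \<rho> by (simp add: power2_eq_square field_simps)
      finally show ?thesis by simp
    qed
    then have "\<psi> y * (2 * (u s y * u t y)) \<le> \<psi> y * (\<rho> * (u s y)\<^sup>2 + (1 / \<rho>) * (u t y)\<^sup>2)"
      by (intro mult_left_mono \<psi>_bounds)
    then show "2 * (\<psi> y * u s y * u t y) \<le> \<rho> * (\<psi> y * (u s y)\<^sup>2) + (1 / \<rho>) * (\<psi> y * (u t y)\<^sup>2)"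
      by (simp add: algebra_simps)
  qed (intro integrable_add integrable_on_mult_right i)+
  also have "\<dots> = integral Q (\<lambda>y. \<rho> * (\<psi> y * (u s y)\<^sup>2)) + integral Q (\<lambda>y. (1 / \<rho>) * (\<psi> y * (u t y)\<^sup>2))"
    by (intro integral_add integrable_on_mult_right i)
  also have "\<dots> = \<rho> * G s + (1 / \<rho>) * G t" unfolding G_def by (simp only: integral_mult_right)
  finally show ?thesis by simp
qed

definition err :: "real \<Rightarrow> real \<Rightarrow> real" where
  "err s t = integral Q (\<lambda>y. (coef t y *v gr t y - a x0 *v gr t y) \<bullet> (\<eta> 1 y *\<^sub>R gr s y + u s y *\<^sub>R g\<eta> 1 y))"
definition E :: "real \<Rightarrow> real \<Rightarrow> real" where
  "E s t = integral Q (\<lambda>y. \<eta> 1 y * ((a x0 *v gr t y) \<bullet> gr s y))"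
text \<open>A bound for the oscillation of the coefficients about \<open>a x0\<close> on the half
  cube of time t, whose points have distance at most 3 d exp t from x0 in dimension d.\<close>

definition om :: "real \<Rightarrow> real" where
  "om t = H * (3 * real CARD('n option) * exp t) powr \<gamma>"

lemma energy_split:
  assumes s: "s \<le> T0" and t: "t \<le> T0"
  shows "integral Q (\<lambda>y. (coef t y *v gr t y) \<bullet> (\<eta> 1 y *\<^sub>R gr s y + u s y *\<^sub>R g\<eta> 1 y)) = E s t - D s t + err s t"
proof -
  note ci = cont_u1[OF s] cont_gr1[OF s] cont_gr1[OF t] cont_coef[OF t] cont_\<eta> cont_g\<eta> cont_\<psi>
    continuous_on_const continuous_on_id
  have i1: "(\<lambda>y. \<eta> 1 y * ((a x0 *v gr t y) \<bullet> gr s y)) integrable_on Q"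
    by (intro integrable_half_cube continuous_on_mult continuous_on_inner continuous_on_matrix_vector_mult ci)
  have i2: "(\<lambda>y. \<psi> y * u s y * (y \<bullet> gr t y)) integrable_on Q"
    by (intro integrable_half_cube continuous_on_mult continuous_on_inner ci)
  have i3: "(\<lambda>y. (coef t y *v gr t y - a x0 *v gr t y) \<bullet> (\<eta> 1 y *\<^sub>R gr s y + u s y *\<^sub>R g\<eta> 1 y)) integrable_on Q"
    by (intro integrable_half_cube continuous_on_inner continuous_on_diff continuous_on_matrix_vector_mult
        continuous_on_add continuous_on_scaleR ci)
  have "(coef t y *v gr t y) \<bullet> (\<eta> 1 y *\<^sub>R gr s y + u s y *\<^sub>R g\<eta> 1 y)
     = (\<eta> 1 y * ((a x0 *v gr t y) \<bullet> gr s y) - \<psi> y * u s y * (y \<bullet> gr t y))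
       + (coef t y *v gr t y - a x0 *v gr t y) \<bullet> (\<eta> 1 y *\<^sub>R gr s y + u s y *\<^sub>R g\<eta> 1 y)" for y
  proof -
    have "(a x0 *v gr t y) \<bullet> g\<eta> 1 y = gr t y \<bullet> (a x0 *v g\<eta> 1 y)"
      by (rule sym_matrix_inner[OF a_sym[OF x0_mem]])
    also have "a x0 *v g\<eta> 1 y = (- \<psi> y) *\<^sub>R y"
      unfolding g\<eta>_def matrix_vector_mult_scaleR B(2) \<psi>_def by simp
    finally have "(a x0 *v gr t y) \<bullet> g\<eta> 1 y = - (\<psi> y * (y \<bullet> gr t y))" by (simp add: inner_commute)
    then show ?thesis by (simp add: inner_diff_left inner_add_right algebra_simps)
  qed
  then show ?thesis unfolding E_def D_def err_def
    by (simp add: integral_add[OF integrable_diff[OF i1 i2] i3] integral_diff[OF i1 i2])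
qed

lemma E_le:
  assumes s: "s \<le> T0" and t: "t \<le> T0"
  shows "2 * E s t \<le> E s s + E t t"
proof -
  have i: "(\<lambda>y. \<eta> 1 y * ((a x0 *v gr t y) \<bullet> gr s y)) integrable_on Q" if "s \<le> T0" "t \<le> T0" for s t
    by (intro integrable_half_cube continuous_on_mult continuous_on_inner continuous_on_matrix_vector_mult
        cont_\<eta> cont_gr1 continuous_on_const that)
  have psd: "0 \<le> v \<bullet> (a x0 *v v)" for v
    using a_lower[OF x0_mem, of v] inner_ge_zero[of v] by linarith
  have "2 * E s t = integral Q (\<lambda>y. 2 * (\<eta> 1 y * ((a x0 *v gr t y) \<bullet> gr s y)))" by (simp add: E_def)
  also have "\<dots> \<le> integral Q (\<lambda>y. \<eta> 1 y * ((a x0 *v gr s y) \<bullet> gr s y) + \<eta> 1 y * ((a x0 *v gr t y) \<bullet> gr t y))"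
  proof (rule integral_le)
    fix y
    have "\<eta> 1 y * (2 * ((a x0 *v gr t y) \<bullet> gr s y)) \<le> \<eta> 1 y * ((a x0 *v gr t y) \<bullet> gr t y + (a x0 *v gr s y) \<bullet> gr s y)"
      by (intro mult_left_mono psd_Cauchy_Schwarz a_sym[OF x0_mem] psd) (simp add: \<eta>_def)
    then show "2 * (\<eta> 1 y * ((a x0 *v gr t y) \<bullet> gr s y))
        \<le> \<eta> 1 y * ((a x0 *v gr s y) \<bullet> gr s y) + \<eta> 1 y * ((a x0 *v gr t y) \<bullet> gr t y)"
      by (simp add: algebra_simps)
  qed (intro integrable_add integrable_on_mult_right i s t)+
  also have "\<dots> = E s s + E t t" unfolding E_def by (intro integral_add i s t)
  finally show ?thesis .
qed

text \<open>Up to errors D s t is at most E s t, hence at most the mean of the diagonal energies,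
  and on the diagonal D and E agree. One e is spent on the pair (s, t) and half of one on each
  diagonal term.\<close>

lemma flow_inequality:
  assumes s: "s \<le> T0" and t: "t \<le> T0"
    and e: "\<bar>err s t\<bar> \<le> e" "\<bar>err s s\<bar> \<le> e" "\<bar>err t t\<bar> \<le> e"
  shows "D s t \<le> (2 * D s s + 2 * D t t) / 4 + 2 * e"
proof -
  have st: "0 \<le> E s t - D s t + err s t"
    using variational[OF s t, of 1 1] energy_split[OF s t] by simp
  have diag: "E t t - D t t + err t t = 0" if "t \<le> T0" for t
    using variational[OF that that, of 1 1] variational[OF that that, of 1 "-1"] energy_split[OF that that] by simp
  have "err s t \<le> e" "- err s s \<le> e" "- err t t \<le> e" using e by (simp_all add: abs_le_iff)
  then show ?thesis
    using st E_le[OF s t] diag[OF s] diag[OF t] by (simp add: field_simps)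
qed

text \<open>On the support of the narrow cutoff the wide one is bounded below, so gradients there
  are controlled by \<open>Dir\<close> and hence by the Caccioppoli inequality.\<close>

lemma \<theta>1_facts:
  assumes "\<theta> 1 y \<noteq> 0"
  shows "1/2 \<le> \<eta> (1/4) y" "norm y \<le> 3/2"
proof -
  have "q y < 1" using assms by (auto simp: \<theta>_def max_def split: if_splits)
  then have "3/4 \<le> \<theta> (1/4) y" by (simp add: \<theta>_def)
  then have "(3/4)\<^sup>2 \<le> \<eta> (1/4) y" unfolding \<eta>_def by (intro power_mono) auto
  then show "1/2 \<le> \<eta> (1/4) y" by (simp add: power2_eq_square)
  have "(norm y)\<^sup>2 < 2 / 1" by (rule \<theta>_support[OF assms]) simp
  also have "(2/1 :: real) \<le> (3/2)\<^sup>2" by (simp add: power2_eq_square)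
  finally have "norm y < 3/2" by (rule power_less_imp_less_base) simp
  then show "norm y \<le> 3/2" by simp
qed

lemma \<eta>_bounds: "0 \<le> \<delta> \<Longrightarrow> 0 \<le> \<eta> \<delta> y \<and> \<eta> \<delta> y \<le> 1"
  using \<theta>_bounds[of \<delta> y] by (simp add: \<eta>_def power_le_one)

lemma err_bound:
  assumes s: "s \<le> T0" and t: "t \<le> T0" and Z: "Mass s \<le> Z" "Mass t \<le> Z"
  shows "\<bar>err s t\<bar> \<le> om t * (8076 * Z)"
proof -
  let ?X = "\<lambda>y. \<eta> 1 y *\<^sub>R gr s y + u s y *\<^sub>R g\<eta> 1 y"
  let ?k = "\<eta> (1/4)"
  let ?d = "real CARD('n option)"
  note ci = cont_u1[OF s] cont_gr1[OF s] cont_gr1[OF t] cont_coef[OF t] cont_\<eta> cont_g\<eta> cont_\<psi>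
    continuous_on_const continuous_on_id
  have om0: "0 \<le> om t" using H by (simp add: om_def)
  have i1: "(\<lambda>y. (coef t y *v gr t y - a x0 *v gr t y) \<bullet> ?X y) integrable_on Q"
    by (intro integrable_half_cube continuous_on_inner continuous_on_diff continuous_on_matrix_vector_mult
        continuous_on_add continuous_on_scaleR ci)
  have j1: "(\<lambda>y. ?k y * (gr t y \<bullet> gr t y)) integrable_on Q" and j2: "(\<lambda>y. ?k y * (gr s y \<bullet> gr s y)) integrable_on Q"
    by (intro integrable_half_cube continuous_on_mult continuous_on_inner ci)+
  have j3: "(\<lambda>y. (u s y)\<^sup>2) integrable_on Q"
    by (intro integrable_half_cube continuous_on_power ci)
  have i2: "(\<lambda>y. om t * (13 * (?k y * (gr t y \<bullet> gr t y)) + ?k y * (gr s y \<bullet> gr s y) + 12 * (u s y)\<^sup>2)) integrable_on Q"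
    by (intro integrable_on_mult_right integrable_add j1 j2 j3)
  have "norm (err s t) \<le> integral Q (\<lambda>y. om t * (13 * (?k y * (gr t y \<bullet> gr t y)) + ?k y * (gr s y \<bullet> gr s y) + 12 * (u s y)\<^sup>2))"
    unfolding err_def
  proof (rule integral_norm_bound_integral[OF i1 i2])
    fix y :: "'n space" assume y: "y \<in> Q"
    define g where "g = norm (gr t y)"
    define gs where "gs = norm (gr s y)"
    define v where "v = \<bar>u s y\<bar>"
    define k where "k = ?k y"
    have k: "0 \<le> k" "k \<le> 1" unfolding k_def using \<eta>_bounds[of "1/4" y] by auto
    have nn: "0 \<le> g" "0 \<le> gs" "0 \<le> v" by (auto simp: g_def gs_def v_def)
    have "norm (coef t y *v gr t y - a x0 *v gr t y) \<le> H * norm (x0 + exp t *\<^sub>R y - x0) powr \<gamma> * g"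
      unfolding coef_def g_def by (rule a_holder[OF scaled_mem[OF t y]])
    also have "\<dots> \<le> om t * g"
    proof -
      have "norm (x0 + exp t *\<^sub>R y - x0) \<le> exp t * (3 * ?d)"
        using norm_Q[OF y] by (simp del: card_option)
      then have "norm (x0 + exp t *\<^sub>R y - x0) powr \<gamma> \<le> (3 * ?d * exp t) powr \<gamma>"
        using \<gamma> by (intro powr_mono2) (auto simp: mult_ac)
      then show ?thesis unfolding om_def using H nn by (intro mult_right_mono mult_left_mono) auto
    qed
    finally have 1: "norm (coef t y *v gr t y - a x0 *v gr t y) \<le> om t * g" .
    \<comment> \<open>On the support of the narrow cutoff norm (g\<eta> 1 y) \<le> 12 and k \<ge>
      1/2; using 2 a b \<le> a^2 + b^2 twice leaves the weights 1 + 12 = 13, 1 and 12.\<close>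
    have 2: "g * norm (?X y) \<le> 13 * (k * g\<^sup>2) + k * gs\<^sup>2 + 12 * v\<^sup>2"
    proof (cases "\<theta> 1 y = 0")
      case True
      then have "?X y = 0" by (simp add: \<eta>_def g\<eta>_def)
      then show ?thesis using k by simp
    next
      case False
      note tf = \<theta>1_facts[OF False]
      have "norm (g\<eta> 1 y) \<le> 12"
      proof -
        have "norm (B *v y) \<le> 3" using B(4)[of y] tf(2) by linarith
        then have "4 * \<theta> 1 y * norm (B *v y) \<le> 4 * 1 * 3"
          using \<theta>_bounds[of 1 y] by (intro mult_mono) auto
        then show ?thesis using \<theta>_bounds[of 1 y] by (simp add: g\<eta>_def abs_mult)
      qed
      then have a: "norm (g\<eta> 1 y) \<le> 24 * k" using tf(1) by (simp add: k_def)
      have b: "\<eta> 1 y \<le> 2 * k" using \<eta>_bounds[of 1 y] tf(1) by (simp add: k_def)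
      have "norm (?X y) \<le> norm (\<eta> 1 y *\<^sub>R gr s y) + norm (u s y *\<^sub>R g\<eta> 1 y)" by (rule norm_triangle_ineq)
      also have "\<dots> = \<eta> 1 y * gs + v * norm (g\<eta> 1 y)"
        using \<eta>_bounds[of 1 y] by (simp add: gs_def v_def)
      also have "\<dots> \<le> (2 * k) * gs + v * (24 * k)"
        using a b nn by (intro add_mono mult_right_mono mult_left_mono) auto
      finally have "g * norm (?X y) \<le> g * ((2 * k) * gs + v * (24 * k))" using nn by (intro mult_left_mono)
      also have "\<dots> = k * (2 * (g * gs)) + 12 * (k * (2 * (g * v)))" by (simp add: algebra_simps)
      also have "\<dots> \<le> k * (g\<^sup>2 + gs\<^sup>2) + 12 * (k * (g\<^sup>2 + v\<^sup>2))"
        using k sum_squares_bound[of g gs] sum_squares_bound[of g v]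
        by (intro add_mono mult_left_mono) (auto simp: mult.assoc)
      also have "\<dots> = 13 * (k * g\<^sup>2) + k * gs\<^sup>2 + 12 * (k * v\<^sup>2)" by (simp add: algebra_simps)
      also have "\<dots> \<le> 13 * (k * g\<^sup>2) + k * gs\<^sup>2 + 12 * (1 * v\<^sup>2)"
        using k by (intro add_left_mono mult_left_mono mult_right_mono) auto
      finally show ?thesis by simp
    qed
    have "norm ((coef t y *v gr t y - a x0 *v gr t y) \<bullet> ?X y) \<le> norm (coef t y *v gr t y - a x0 *v gr t y) * norm (?X y)"
      using Cauchy_Schwarz_ineq2 by simp
    also have "\<dots> \<le> (om t * g) * norm (?X y)" by (intro mult_right_mono 1) simp
    also have "\<dots> = om t * (g * norm (?X y))" by simp
    also have "\<dots> \<le> om t * (13 * (k * g\<^sup>2) + k * gs\<^sup>2 + 12 * v\<^sup>2)" by (intro mult_left_mono 2 om0)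
    finally show "norm ((coef t y *v gr t y - a x0 *v gr t y) \<bullet> ?X y)
        \<le> om t * (13 * (?k y * (gr t y \<bullet> gr t y)) + ?k y * (gr s y \<bullet> gr s y) + 12 * (u s y)\<^sup>2)"
      by (simp add: k_def g_def gs_def v_def dot_square_norm)
  qed
  also have "\<dots> = om t * (13 * Dir t + Dir s + 12 * Mass s)"
    unfolding Dir_def Mass_def
    by (simp only: integral_mult_right integral_add[OF integrable_add[OF integrable_on_mult_right[OF j1] j2] integrable_on_mult_right[OF j3]]
        integral_add[OF integrable_on_mult_right[OF j1] j2])
  \<comment> \<open>By the Caccioppoli inequality 13 + 1 energies and 12 masses give 14 * 576 + 12 =
    8076.\<close>
  also have "\<dots> \<le> om t * (8076 * Z)"
    using Caccioppoli[OF s] Caccioppoli[OF t] Z by (intro mult_left_mono om0) linarith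
  finally show ?thesis by simp
qed

lemma D_bound:
  assumes t: "t \<le> T0" and Z: "Mass t \<le> Z"
  shows "\<bar>2 * D t t\<bar> \<le> 6924 * Z"
proof -
  let ?k = "\<eta> (1/4)"
  note ci = cont_u1[OF t] cont_gr1[OF t] cont_\<eta> cont_\<psi> continuous_on_const continuous_on_id
  have i1: "(\<lambda>y. \<psi> y * u t y * (y \<bullet> gr t y)) integrable_on Q"
    by (intro integrable_half_cube continuous_on_mult continuous_on_inner ci)
  have j1: "(\<lambda>y. ?k y * (gr t y \<bullet> gr t y)) integrable_on Q"
    by (intro integrable_half_cube continuous_on_mult continuous_on_inner ci)
  have j3: "(\<lambda>y. (u t y)\<^sup>2) integrable_on Q"
    by (intro integrable_half_cube continuous_on_power ci)
  have i2: "(\<lambda>y. 6 * (?k y * (gr t y \<bullet> gr t y)) + 6 * (u t y)\<^sup>2) integrable_on Q"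
    by (intro integrable_on_mult_right integrable_add j1 j3)
  have "norm (D t t) \<le> integral Q (\<lambda>y. 6 * (?k y * (gr t y \<bullet> gr t y)) + 6 * (u t y)\<^sup>2)"
    unfolding D_def
  proof (rule integral_norm_bound_integral[OF i1 i2])
    fix y :: "'n space" assume y: "y \<in> Q"
    define g where "g = norm (gr t y)"
    define v where "v = \<bar>u t y\<bar>"
    define k where "k = ?k y"
    have k: "0 \<le> k" "k \<le> 1" unfolding k_def using \<eta>_bounds[of "1/4" y] by auto
    have nn: "0 \<le> g" "0 \<le> v" by (auto simp: g_def v_def)
    have "\<bar>\<psi> y * u t y * (y \<bullet> gr t y)\<bar> \<le> 6 * (k * g\<^sup>2) + 6 * v\<^sup>2"
    proof (cases "\<theta> 1 y = 0")
      case True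
      then show ?thesis using k by (simp add: \<psi>_def)
    next
      case False
      note tf = \<theta>1_facts[OF False]
      have "\<bar>\<psi> y * u t y * (y \<bullet> gr t y)\<bar> = \<psi> y * v * \<bar>y \<bullet> gr t y\<bar>"
        using \<psi>_bounds(1)[of y] by (simp add: abs_mult v_def)
      also have "\<dots> \<le> 4 * v * (3/2 * g)"
      proof (intro mult_mono)
        have "\<bar>y \<bullet> gr t y\<bar> \<le> norm y * g" unfolding g_def by (rule Cauchy_Schwarz_ineq2)
        also have "\<dots> \<le> 3/2 * g" using tf(2) nn by (intro mult_right_mono)
        finally show "\<bar>y \<bullet> gr t y\<bar> \<le> 3/2 * g" .
      qed (use nn \<psi>_bounds in auto)
      also have "\<dots> = 6 * (g * v)" by simp
      also have "\<dots> \<le> (12 * k) * (g * v)" using tf(1) nn by (intro mult_right_mono) (auto simp: k_def)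
      also have "\<dots> = 6 * (k * (2 * (g * v)))" by simp
      also have "\<dots> \<le> 6 * (k * (g\<^sup>2 + v\<^sup>2))"
        using k sum_squares_bound[of g v] by (intro mult_left_mono) (auto simp: mult.assoc)
      also have "\<dots> = 6 * (k * g\<^sup>2) + 6 * (k * v\<^sup>2)" by (simp add: algebra_simps)
      also have "\<dots> \<le> 6 * (k * g\<^sup>2) + 6 * (1 * v\<^sup>2)"
        using k by (intro add_left_mono mult_left_mono mult_right_mono) auto
      finally show ?thesis by simp
    qed
    then show "norm (\<psi> y * u t y * (y \<bullet> gr t y)) \<le> 6 * (?k y * (gr t y \<bullet> gr t y)) + 6 * (u t y)\<^sup>2"
      by (simp add: k_def g_def v_def dot_square_norm)
  qed
  also have "\<dots> = 6 * Dir t + 6 * Mass t"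
    unfolding Dir_def Mass_def
    by (simp only: integral_mult_right integral_add[OF integrable_on_mult_right[OF j1] integrable_on_mult_right[OF j3]])
  \<comment> \<open>Here 3462 = 6 * 576 + 6; the claim doubles it because 2 * D t t is the
    derivative of G.\<close>
  also have "\<dots> \<le> 3462 * Z" using Caccioppoli[OF t] Z by linarith
  finally show ?thesis by (simp add: abs_mult)
qed

lemma G_le_Mass:
  assumes t: "t \<le> T0"
  shows "0 \<le> G t" "G t \<le> 4 * Mass t"
proof -
  have i: "(\<lambda>y. \<psi> y * (u t y)\<^sup>2) integrable_on Q" "(\<lambda>y. (u t y)\<^sup>2) integrable_on Q"
    by (intro integrable_half_cube continuous_on_mult continuous_on_power cont_\<psi> cont_u1 t)+
  show "0 \<le> G t" unfolding G_def by (intro integral_nonneg i mult_nonneg_nonneg \<psi>_bounds zero_le_power2)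
  have "G t \<le> integral Q (\<lambda>y. 4 * (u t y)\<^sup>2)" unfolding G_def
    by (intro integral_le i integrable_on_mult_right mult_right_mono \<psi>_bounds zero_le_power2)
  then show "G t \<le> 4 * Mass t" by (simp add: Mass_def)
qed

lemma G_mono':
  assumes "s \<le> t" "t \<le> T0"
  shows "G s \<le> exp (t - s) ^ CARD('n option) * G t"
proof -
  have "exp (t - s) * exp (s - t) = 1" by (simp flip: exp_add)
  then have e: "exp (t - s) ^ CARD('n option) * exp (s - t) ^ CARD('n option) = 1"
    by (metis power_mult_distrib power_one)
  have "exp (t - s) ^ CARD('n option) * (exp (s - t) ^ CARD('n option) * G s) \<le> exp (t - s) ^ CARD('n option) * G t"
    by (intro mult_left_mono G_mono assms) simp
  then show ?thesis unfolding mult.assoc[symmetric] e by simp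
qed

text \<open>One factor for the step \<tau> from \<open>Mass\<close> to G, the other for the distance
  of at most 2 \<tau> to the common scale m + 2 * \<tau>.\<close>

definition K0 :: real where "K0 = exp \<tau> ^ CARD('n option) * exp (2 * \<tau>) ^ CARD('n option)"

lemma K0_pos: "0 < K0"
  by (simp add: K0_def)

lemma Mass_le_top:
  assumes "m - \<tau> \<le> t" "t \<le> m + \<tau>" "m + 2 * \<tau> \<le> T0"
  shows "Mass t \<le> K0 * G (m + 2 * \<tau>)"
proof -
  let ?d = "CARD('n option)"
  have t: "t + \<tau> \<le> T0" "t \<le> T0" using assms exp_\<tau>(2) by linarith+
  have G0: "0 \<le> G (m + 2 * \<tau>)" by (rule G_le_Mass(1)[OF assms(3)])
  have M0: "0 \<le> Mass t" using G_le_Mass[OF t(2)] by linarith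
  have "2 * Mass t \<le> exp \<tau> ^ ?d * G (t + \<tau>)" by (rule Mass_le_G[OF t(1)])
  also have "\<dots> \<le> exp \<tau> ^ ?d * (exp (2 * \<tau>) ^ ?d * G (m + 2 * \<tau>))"
  proof (intro mult_left_mono)
    have "G (t + \<tau>) \<le> exp (m + 2 * \<tau> - (t + \<tau>)) ^ ?d * G (m + 2 * \<tau>)"
      using assms by (intro G_mono') auto
    also have "\<dots> \<le> exp (2 * \<tau>) ^ ?d * G (m + 2 * \<tau>)"
      using assms G0 by (intro mult_right_mono power_mono) auto
    finally show "G (t + \<tau>) \<le> exp (2 * \<tau>) ^ ?d * G (m + 2 * \<tau>)" .
  qed simp
  also have "\<dots> = K0 * G (m + 2 * \<tau>)" by (simp only: K0_def mult.assoc)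
  finally show ?thesis using M0 by linarith
qed

lemma om_mono: "s \<le> t \<Longrightarrow> om s \<le> om t"
  unfolding om_def using H \<gamma> by (intro mult_left_mono powr_mono2) auto

lemma om_pos: "0 < om t"
  unfolding om_def using H by simp

text \<open>A single quantity, 10000 * K0 * G (m + 2 * \<tau>), plays the role of Z throughout
  \<open>approximate_log_convexity\<close>: the factor exceeds the constants 4 for G, 6924 for its
  derivative and 8076 for the coefficient error.\<close>

lemma G_approximately_convex:
  assumes m: "m + 2 * \<tau> \<le> T0" and pos: "0 < G (m + 2 * \<tau>)"
    and N: "0 \<le> N" "N \<le> N1" and L: "L = exp (2 * N * \<tau>)" "L \<le> L1"
    and small: "sqrt (om (m + \<tau>)) \<le> \<tau>" "sqrt (om (m + \<tau>)) * N1 \<le> 1"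
  shows "G m \<le> (L * G (m - \<tau>) + G (m + \<tau>) / L) / 2
    + (4 * (N1\<^sup>2 * (L1 * (1 + 2 * N1)) + N1^3 * L1 + 8 * L1) * \<tau>\<^sup>2 + 2 * (L1 * (1 + 2 * N1)))
      * sqrt (om (m + \<tau>)) * (10000 * (K0 * G (m + 2 * \<tau>)))"
proof (rule approximate_log_convexity[where G'="\<lambda>t. 2 * D t t" and F=F and D=D, OF exp_\<tau>(2) N L])
  let ?W = "{m - \<tau>..m + \<tau>}"
  let ?Z = "K0 * G (m + 2 * \<tau>)"
  have Z: "0 < ?Z" using K0_pos pos by simp
  have W: "t < T0" "t \<le> T0" if "t \<in> ?W" for t using that m exp_\<tau>(2) by auto
  have Ms: "Mass t \<le> ?Z" if "t \<in> ?W" for t using that m by (intro Mass_le_top) auto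
  have e: "\<bar>err s t\<bar> \<le> om (m + \<tau>) * (10000 * ?Z)" if "s \<in> ?W" "t \<in> ?W" for s t
  proof -
    have "\<bar>err s t\<bar> \<le> om t * (8076 * ?Z)" using that by (intro err_bound W Ms)
    also have "\<dots> \<le> om (m + \<tau>) * (10000 * ?Z)"
    proof (rule mult_mono[OF om_mono])
      show "8076 * ?Z \<le> 10000 * ?Z" "0 \<le> 8076 * ?Z" using Z by linarith+
    qed (use that om_pos[of "m + \<tau>"] in auto)
    finally show ?thesis .
  qed
  show "(F s has_real_derivative D s t) (at t)" if "s \<in> ?W" "t \<in> ?W" for s t
    using that by (intro F_deriv W)
  show "(G has_real_derivative 2 * D t t) (at t)" if "t \<in> ?W" for t
    using that by (intro G_deriv W)
  show "F t t = G t" for t by (rule F_diag)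
  show "2 * F s t \<le> \<rho> * G s + G t / \<rho>" if "s \<in> ?W" "t \<in> ?W" "\<rho> > 0" for s t \<rho>
    using that by (intro two_F_le W)
  show "D s t \<le> (2 * D s s + 2 * D t t) / 4 + 2 * (om (m + \<tau>) * (10000 * ?Z))" if "s \<in> ?W" "t \<in> ?W" for s t
    using that by (intro flow_inequality W e)
  show "0 \<le> G t \<and> G t \<le> 10000 * ?Z" if "t \<in> ?W" for t
    using G_le_Mass[OF W(2)[OF that]] Ms[OF that] Z by linarith
  show "\<bar>2 * D t t\<bar> \<le> 1 * (10000 * ?Z)" if "t \<in> ?W" for t
    using D_bound[OF W(2)[OF that] Ms[OF that]] Z by linarith
  show "0 < om (m + \<tau>)" by (rule om_pos)
  show "0 < 10000 * ?Z" using Z by simp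
qed (use small in auto)

text \<open>Along the times T0 - k \<tau> the error in the convexity of G is a multiple of the
  square root of \<open>om\<close>. As \<open>om\<close> is a power of the scale, this decays
  geometrically, as the sequence lemma requires.\<close>

lemma G_doubling:
  assumes c: "0 < c" and \<mu>: "0 < \<mu>" "\<mu> \<le> 1"
    and lower: "\<And>k. c * \<mu> ^ k \<le> G (T0 - real k * \<tau>)"
  shows "\<exists>L\<ge>1. \<exists>k. \<forall>j\<ge>k. G (T0 - real j * \<tau>) \<le> L * G (T0 - real (j + 1) * \<tau>)"
proof -
  define b where "b k = G (T0 - real k * \<tau>)" for k :: nat
  have \<tau>: "0 < \<tau>" by (rule exp_\<tau>(2))
  \<comment> \<open>Per step \<open>om\<close> shrinks by exp (- (\<gamma> * \<tau>)); p is the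
    square root of this factor.\<close>
  define p where "p = exp (- (\<gamma> * \<tau> / 2))"
  have p: "0 < p" "p < 1" using \<gamma> \<tau> by (auto simp: p_def)
  define S where "S = sqrt (om (T0 - \<tau>))"
  have S: "0 < S" unfolding S_def using om_pos by simp
  have som: "sqrt (om (T0 - real (k + 1) * \<tau>)) = S * p ^ k" for k
  proof -
    have 1: "exp (T0 - real (k + 1) * \<tau>) = exp (T0 - \<tau>) * exp (- (real k * \<tau>))"
      by (simp add: exp_add[symmetric] algebra_simps)
    have 2: "exp (- (real k * \<tau>)) powr \<gamma> = p ^ k * p ^ k"
    proof -
      have "exp (- (real k * \<tau>)) powr \<gamma> = exp (real k * (- (\<gamma> * \<tau> / 2)) + real k * (- (\<gamma> * \<tau> / 2)))"
        by (simp add: powr_def field_simps)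
      also have "\<dots> = p ^ k * p ^ k" unfolding exp_add p_def exp_of_nat_mult by simp
      finally show ?thesis .
    qed
    have "om (T0 - real (k + 1) * \<tau>) = om (T0 - \<tau>) * (p ^ k * p ^ k)"
      unfolding om_def 1 mult.assoc[symmetric] by (subst powr_mult) (auto simp: 2)
    then show ?thesis unfolding S_def using p by (simp add: real_sqrt_mult)
  qed
  have pos: "0 < b k" for k
    using lower[of k] c \<mu> unfolding b_def by (smt (verit) mult_pos_pos zero_less_power)
  have "\<exists>L\<ge>1. \<exists>k. \<forall>j\<ge>k. b j \<le> L * b (j + 1)"
  proof (rule doubling_of_approximately_log_convex_sequence[OF p _ c \<mu>])
    show "1 \<le> exp \<tau> ^ CARD('n option)" using \<tau> by (intro one_le_power) auto
    show "c * \<mu> ^ k \<le> b k" for k unfolding b_def by (rule lower)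
    show "b (k + 1) \<le> exp \<tau> ^ CARD('n option) * b k" for k
    proof -
      have "G (T0 - real (k + 1) * \<tau>) \<le> exp ((T0 - real k * \<tau>) - (T0 - real (k + 1) * \<tau>)) ^ CARD('n option) * G (T0 - real k * \<tau>)"
        using \<tau> by (intro G_mono') (auto simp: algebra_simps)
      moreover have "(T0 - real k * \<tau>) - (T0 - real (k + 1) * \<tau>) = \<tau>" by (simp add: algebra_simps)
      ultimately show ?thesis unfolding b_def by (simp only:)
    qed
    fix L1 :: real assume L1: "1 \<le> L1"
    define N1 where "N1 = ln L1 / (2 * \<tau>)"
    have N1: "0 \<le> N1" using L1 \<tau> by (simp add: N1_def)
    define C where "C = (4 * (N1\<^sup>2 * (L1 * (1 + 2 * N1)) + N1^3 * L1 + 8 * L1) * \<tau>\<^sup>2 + 2 * (L1 * (1 + 2 * N1)))"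
    have C: "0 \<le> C" unfolding C_def using N1 L1 by (intro add_nonneg_nonneg mult_nonneg_nonneg) auto
    have lim: "(\<lambda>k. S * p ^ k) \<longlonglongrightarrow> S * 0"
      using p by (intro tendsto_intros LIMSEQ_power_zero) auto
    \<comment> \<open>From k0 on both smallness conditions of the convexity lemma hold; N1 + 1
      covers N1 = 0.\<close>
    have "S * 0 < min \<tau> (1 / (N1 + 1))" using \<tau> N1 by (simp add: add_nonneg_pos)
    then have "\<forall>\<^sub>F k in sequentially. S * p ^ k < min \<tau> (1 / (N1 + 1))"
      by (rule order_tendstoD(2)[OF lim])
    then obtain k0 where k0: "\<And>k. k \<ge> k0 \<Longrightarrow> S * p ^ k < min \<tau> (1 / (N1 + 1))"
      unfolding eventually_sequentially by blast
    have main: "b (k + 2) \<le> (L * b (k + 3) + b (k + 1) / L) / 2 + C * S * 10000 * K0 * p ^ k * b k"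
      if k: "k \<ge> k0" and L: "1 \<le> L" "L \<le> L1" for k L
    proof -
      \<comment> \<open>The midpoint lies two steps below scale k, so that the error is relative to
        b k, and N is the slope that makes L the weight exp (2 N \<tau>).\<close>
      define m where "m = T0 - real (k + 2) * \<tau>"
      define N where "N = ln L / (2 * \<tau>)"
      have m2: "m + 2 * \<tau> = T0 - real k * \<tau>" "m + \<tau> = T0 - real (k + 1) * \<tau>" "m - \<tau> = T0 - real (k + 3) * \<tau>"
        by (simp_all add: m_def algebra_simps)
      have ln: "ln L \<le> ln L1" using L by simp
      have sm: "S * p ^ k \<le> \<tau>" "S * p ^ k * N1 \<le> 1"
      proof -
        show "S * p ^ k \<le> \<tau>" using k0[OF k] by simp
        have "S * p ^ k * N1 \<le> (1 / (N1 + 1)) * N1" using k0[OF k] N1 by (intro mult_right_mono) auto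
        also have "\<dots> \<le> 1" using N1 by simp
        finally show "S * p ^ k * N1 \<le> 1" .
      qed
      have "G m \<le> (L * G (m - \<tau>) + G (m + \<tau>) / L) / 2 + C * sqrt (om (m + \<tau>)) * (10000 * (K0 * G (m + 2 * \<tau>)))"
        unfolding C_def
      proof (rule G_approximately_convex[where N=N])
        show "m + 2 * \<tau> \<le> T0" using \<tau> by (simp add: m2)
        show "0 < G (m + 2 * \<tau>)" using pos[of k] by (simp add: m2 b_def)
        show "0 \<le> N" using L \<tau> by (simp add: N_def)
        show "N \<le> N1" unfolding N_def N1_def using ln \<tau> by (intro divide_right_mono) auto
        show "L = exp (2 * N * \<tau>)" using L \<tau> by (simp add: N_def)
        show "L \<le> L1" by (rule L(2))
        show "sqrt (om (m + \<tau>)) \<le> \<tau>" "sqrt (om (m + \<tau>)) * N1 \<le> 1" unfolding m2 som by (rule sm)+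
      qed
      then have "b (k + 2) \<le> (L * b (k + 3) + b (k + 1) / L) / 2 + C * (S * p ^ k) * (10000 * (K0 * b k))"
        unfolding m2 som unfolding b_def m_def .
      then show ?thesis by (simp only: mult_ac)
    qed
    have "0 \<le> C * S * 10000 * K0" using C S K0_pos by simp
    then show "\<exists>C\<ge>0. \<exists>k0. \<forall>k\<ge>k0. \<forall>L. 1 \<le> L \<and> L \<le> L1 \<longrightarrow>
      b (k + 2) \<le> (L * b (k + 3) + b (k + 1) / L) / 2 + C * p ^ k * b k"
      using main by metis
  qed
  then show ?thesis unfolding b_def .
qed

end

section \<open>Comparison with the masses on half balls\<close>

lemma half_ball_measurable: "half_ball (x :: 'n::finite space) r \<in> sets lebesgue"
proof -
  have "closed {y :: 'n space. 0 \<le> y $ None}"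
    by (intro closed_Collect_le continuous_intros)
  moreover have "half_ball x r = {y :: 'n space. 0 \<le> y $ None} \<inter> ball x r"
    by (auto simp: half_ball_def dist_norm norm_minus_commute)
  ultimately show ?thesis
    by (simp add: borel_closed borel_open sets.Int sets_completionI_sets)
qed

lemma half_ball_subset_half_cube:
  assumes "x $ None = 0" "r \<le> s"
  shows "half_ball x r \<subseteq> half_cube x s"
proof
  fix y assume y: "y \<in> half_ball x r"
  have "\<bar>y $ i - x $ i\<bar> \<le> s" for i
    using component_le_norm_cart[of "y - x" i] y assms(2) by (simp add: half_ball_def)
  then show "y \<in> half_cube x s" using y assms(1) by (simp add: mem_half_cube half_ball_def)
qed

lemma continuous_on_half_cube_half_ball_integral:
  fixes f :: "'n::finite space \<Rightarrow> real"
  assumes "continuous_on (half_cube x s) f" "x $ None = 0" "r \<le> s"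
  shows "f absolutely_integrable_on half_ball x r" "(LINT y:half_ball x r|lebesgue. f y) = integral (half_ball x r) f"
proof -
  have "f absolutely_integrable_on half_cube x s"
    using assms(1) unfolding half_cube_def by (rule absolutely_integrable_continuous)
  then show i: "f absolutely_integrable_on half_ball x r"
    by (rule set_integrable_subset[OF _ half_ball_measurable half_ball_subset_half_cube[OF assms(2,3)]])
  show "(LINT y:half_ball x r|lebesgue. f y) = integral (half_ball x r) f"
    by (rule set_lebesgue_integral_eq_integral(2)[OF i])
qed

context signorini begin

definition J :: "real \<Rightarrow> real" where "J r = (LINT x:half_ball x0 r|lebesgue. (w x)\<^sup>2)"

lemma cont_w2: "continuous_on (half_cube x0 R) (\<lambda>x. (w x)\<^sup>2)"
  by (intro continuous_on_power cont_w)

lemma J_eq: "r \<le> R \<Longrightarrow> J r = integral (half_ball x0 r) (\<lambda>x. (w x)\<^sup>2)"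
  unfolding J_def by (rule continuous_on_half_cube_half_ball_integral(2)[OF cont_w2 x0])

lemma J_integrable: "r \<le> R \<Longrightarrow> (\<lambda>x. (w x)\<^sup>2) integrable_on half_ball x0 r"
  using continuous_on_half_cube_half_ball_integral(1)[OF cont_w2 x0] set_lebesgue_integral_eq_integral(1) by blast

lemma J_le_Mass:
  assumes t: "t \<le> T0" and r: "r \<le> 3 * exp t"
  shows "J r \<le> exp t ^ CARD('n option) * Mass t"
proof -
  have tR: "exp t * 3 \<le> R" by (rule exp_T0[OF t])
  have rR: "r \<le> R" using r tR by simp
  have cw: "continuous_on (half_cube x0 (exp t * 3)) (\<lambda>x. (w x)\<^sup>2)"
    by (rule continuous_on_subset[OF cont_w2 half_cube_mono[OF tR]])
  have "J r = integral (half_ball x0 r) (\<lambda>x. (w x)\<^sup>2)" by (rule J_eq[OF rR])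
  also have "\<dots> \<le> integral (half_cube x0 (exp t * 3)) (\<lambda>x. (w x)\<^sup>2)"
  proof (rule integral_subset_le)
    show "half_ball x0 r \<subseteq> half_cube x0 (exp t * 3)"
      using r by (intro half_ball_subset_half_cube x0) simp
    show "(\<lambda>x. (w x)\<^sup>2) integrable_on half_ball x0 r" by (rule J_integrable[OF rR])
    show "(\<lambda>x. (w x)\<^sup>2) integrable_on half_cube x0 (exp t * 3)" by (rule integrable_half_cube[OF cw])
  qed simp
  also have "\<dots> = exp t ^ CARD('n option) * Mass t"
    using integral_half_cube_affine[OF cw] by (simp add: Mass_def u_def)
  finally show ?thesis .
qed

text \<open>\<open>\<psi>\<close> is at most 4 and vanishes for norm y > 3/2, so the half ball of
  radius 2 exp t contains all that G sees at time t. With \<open>J_le_Mass\<close> and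
  \<open>Mass_le_G\<close> this makes G and J comparable up to fixed factors in the radius.\<close>

lemma G_le_J:
  assumes t: "t \<le> T0"
  shows "exp t ^ CARD('n option) * G t \<le> 4 * J (2 * exp t)"
proof -
  have tR: "exp t * 3 \<le> R" by (rule exp_T0[OF t])
  then have rR: "2 * exp t \<le> R" using exp_gt_zero[of t] by linarith
  define f where "f x = \<psi> ((1 / exp t) *\<^sub>R (x - x0)) * (w x)\<^sup>2" for x
  have cf: "continuous_on (half_cube x0 (exp t * 3)) f"
    unfolding f_def[abs_def]
    by (intro continuous_on_mult continuous_on_subset[OF cont_w2 half_cube_mono[OF tR]] continuous_on_compose2[OF cont_\<psi>[of UNIV]]
        continuous_on_scaleR continuous_on_diff continuous_on_const continuous_on_id subset_UNIV)
  have sub: "half_ball x0 (2 * exp t) \<subseteq> half_cube x0 (exp t * 3)"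
    by (intro half_ball_subset_half_cube x0) simp
  have hi: "((\<lambda>x. 4 * (w x)\<^sup>2) has_integral 4 * J (2 * exp t)) (half_ball x0 (2 * exp t))"
    unfolding J_eq[OF rR] by (intro has_integral_mult_right integrable_integral J_integrable rR)
  have "f (x0 + exp t *\<^sub>R y) = \<psi> y * (u t y)\<^sup>2" for y by (simp add: f_def u_def)
  then have "exp t ^ CARD('n option) * G t = integral (half_cube x0 (exp t * 3)) f"
    using integral_half_cube_affine[OF cf] by (simp add: G_def)
  also have "\<dots> \<le> 4 * J (2 * exp t)"
  proof (rule has_integral_le)
    show "(f has_integral integral (half_cube x0 (exp t * 3)) f) (half_cube x0 (exp t * 3))"
      by (rule integrable_integral[OF integrable_half_cube[OF cf]])
    show "((\<lambda>x. if x \<in> half_ball x0 (2 * exp t) then 4 * (w x)\<^sup>2 else 0) has_integral 4 * J (2 * exp t)) (half_cube x0 (exp t * 3))"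
      unfolding has_integral_restrict[OF sub] by (rule hi)
    fix x assume x: "x \<in> half_cube x0 (exp t * 3)"
    show "f x \<le> (if x \<in> half_ball x0 (2 * exp t) then 4 * (w x)\<^sup>2 else 0)"
    proof (cases "x \<in> half_ball x0 (2 * exp t)")
      case True
      then show ?thesis unfolding f_def by (simp add: mult_right_mono \<psi>_bounds)
    next
      case False
      have "0 \<le> x $ None" using x x0 by (simp add: mem_half_cube)
      then have "2 * exp t \<le> norm (x - x0)" using False by (simp add: half_ball_def)
      then have "\<not> norm ((1 / exp t) *\<^sub>R (x - x0)) \<le> 3 / 2"
        using exp_gt_zero[of t] by (simp add: pos_divide_le_eq del: exp_gt_zero)
      then have "\<theta> 1 ((1 / exp t) *\<^sub>R (x - x0)) = 0" using \<theta>1_facts(2) by blast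
      then show ?thesis using False by (simp add: f_def \<psi>_def)
    qed
  qed
  finally show ?thesis .
qed

text \<open>A power lower bound for the masses becomes a geometric one for the samples of G, as
  \<open>G_doubling\<close> requires; the doubling of G is then carried back from the sampled scales
  to all small radii.\<close>

lemma doubling_of_lower_bound:
  assumes c: "0 < c" and K: "0 \<le> K" and low: "\<And>r. 0 < r \<Longrightarrow> r \<le> R \<Longrightarrow> c * r powr K \<le> J r"
  shows "\<exists>r0>0. \<exists>C>0. \<forall>r. 0 < r \<and> r \<le> r0 \<longrightarrow> J (2 * r) \<le> C * J r"
proof -
  let ?d = "CARD('n option)"
  have \<tau>: "0 < \<tau>" by (rule exp_\<tau>(2))
  define \<mu> where "\<mu> = exp (- (\<tau> * K))"
  have \<mu>: "0 < \<mu>" "\<mu> \<le> 1" using \<tau> K by (auto simp: \<mu>_def)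
  define c' where "c' = c * (3 * exp (T0 - \<tau>)) powr K / (exp T0 ^ ?d * exp \<tau> ^ ?d)"
  have c': "0 < c'" using c by (simp add: c'_def)
  have lower: "c' * \<mu> ^ k \<le> G (T0 - real k * \<tau>)" for k
  proof -
    \<comment> \<open>One step further down than the sample, because \<open>Mass_le_G\<close> bounds
      the mass at t by G at t + \<tau>.\<close>
    define t where "t = T0 - real (k + 1) * \<tau>"
    have t\<tau>: "t + \<tau> = T0 - real k * \<tau>" by (simp add: t_def algebra_simps)
    have t1: "t + \<tau> \<le> T0" using \<tau> by (simp add: t\<tau>)
    then have t0: "t \<le> T0" using \<tau> by simp
    have M0: "0 \<le> Mass t" using G_le_Mass[OF t0] by linarith
    have "exp t = exp (T0 - \<tau>) * exp (- (real k * \<tau>))" by (simp add: t_def exp_add[symmetric] algebra_simps)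
    moreover have "exp (- (real k * \<tau>)) powr K = \<mu> ^ k"
    proof -
      have "exp (- (real k * \<tau>)) powr K = exp (real k * (- (\<tau> * K)))" by (simp add: powr_def field_simps)
      then show ?thesis unfolding exp_of_nat_mult \<mu>_def .
    qed
    ultimately have pw: "(3 * exp t) powr K = (3 * exp (T0 - \<tau>)) powr K * \<mu> ^ k"
      by (simp add: mult.assoc[symmetric] powr_mult)
    have "c * (3 * exp t) powr K \<le> J (3 * exp t)"
      using exp_T0[OF t0] by (intro low) auto
    also have "\<dots> \<le> exp t ^ ?d * Mass t" by (rule J_le_Mass[OF t0]) simp
    also have "\<dots> \<le> exp T0 ^ ?d * (exp \<tau> ^ ?d * G (t + \<tau>))"
    proof (rule mult_mono)
      show "exp t ^ ?d \<le> exp T0 ^ ?d" using t0 by (intro power_mono) auto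
      show "Mass t \<le> exp \<tau> ^ ?d * G (t + \<tau>)" using Mass_le_G[OF t1] M0 by linarith
    qed (use M0 in auto)
    finally have "c * ((3 * exp (T0 - \<tau>)) powr K * \<mu> ^ k) \<le> (exp T0 ^ ?d * exp \<tau> ^ ?d) * G (t + \<tau>)"
      unfolding pw by (simp only: mult.assoc)
    then have "c * ((3 * exp (T0 - \<tau>)) powr K * \<mu> ^ k) / (exp T0 ^ ?d * exp \<tau> ^ ?d) \<le> G (t + \<tau>)"
      by (subst pos_divide_le_eq) (simp_all only: mult.commute mult_pos_pos zero_less_power exp_gt_zero)
    then show ?thesis by (simp add: c'_def t\<tau> mult.assoc)
  qed
  obtain L k where L: "1 \<le> L" and dbl: "\<And>j. j \<ge> k \<Longrightarrow> G (T0 - real j * \<tau>) \<le> L * G (T0 - real (j + 1) * \<tau>)"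
    using G_doubling[OF c' \<mu> lower] by metis
  have dbl3: "G (T0 - real i * \<tau>) \<le> L ^ 3 * G (T0 - real (i + 3) * \<tau>)" if i: "i \<ge> k" for i
  proof -
    have "G (T0 - real i * \<tau>) \<le> L * G (T0 - real (i + 1) * \<tau>)" using i by (rule dbl)
    also have "\<dots> \<le> L * (L * G (T0 - real (i + 1 + 1) * \<tau>))" using i L by (intro mult_left_mono dbl) auto
    also have "\<dots> \<le> L * (L * (L * G (T0 - real (i + 1 + 1 + 1) * \<tau>)))" using i L by (intro mult_left_mono dbl) auto
    also have "\<dots> = L ^ 3 * G (T0 - real (i + 3) * \<tau>)" by (simp add: power3_eq_cube mult.assoc add.commute)
    finally show ?thesis .
  qed
  define r0 where "r0 = 2 * exp (T0 - real (k + 3) * \<tau>)"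
  define C where "C = 4 * (exp (3 * \<tau>) ^ ?d * L ^ 3)"
  have "J (2 * r) \<le> C * J r" if r: "0 < r" "r \<le> r0" for r
  proof -
    define z where "z = (T0 - ln (r / 2)) / \<tau>"
    \<comment> \<open>Rounding up selects a sampled scale with 2 exp (T0 - j \<tau>) \<le> r, while
      the preceding scale is already too large or just equal.\<close>
    define j where "j = nat \<lceil>z\<rceil>"
    have "ln (r / 2) \<le> ln (exp (T0 - real (k + 3) * \<tau>))" using r by (subst ln_le_cancel_iff) (auto simp: r0_def)
    then have "real (k + 3) * \<tau> \<le> T0 - ln (r / 2)" by simp
    then have z: "real (k + 3) \<le> z" using \<tau> by (simp add: z_def pos_le_divide_eq)
    have j1: "z \<le> real j" and j2: "real j < z + 1"
      using z unfolding j_def by linarith+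
    have "real (k + 3) \<le> real j" using z j1 by linarith
    then have jk: "k + 3 \<le> j" by linarith
    \<comment> \<open>Three steps are lost: one in rounding r, one for a half cube containing the
      half ball of radius 2 r, and one in \<open>Mass_le_G\<close>. This is also the 3 in the choice
      of r0.\<close>
    define i where "i = j - 3"
    have i: "j = i + 3" "k \<le> i" using jk by (auto simp: i_def)
    have zt: "z * \<tau> = T0 - ln (r / 2)" using \<tau> by (simp add: z_def)
    have lower_t: "2 * exp (T0 - real j * \<tau>) \<le> r"
    proof -
      have "z * \<tau> \<le> real j * \<tau>" using j1 \<tau> by (intro mult_right_mono) auto
      then have "T0 - real j * \<tau> \<le> ln (r / 2)" using zt by linarith
      then have "exp (T0 - real j * \<tau>) \<le> exp (ln (r / 2))" by simp
      then show ?thesis using r by simp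
    qed
    define t where "t = T0 - real (i + 1) * \<tau>"
    have t0: "t + \<tau> \<le> T0" "t \<le> T0" using \<tau> by (auto simp: t_def algebra_simps)
    have upper_t: "2 * r \<le> 3 * exp t"
    proof -
      have "real j * \<tau> \<le> (z + 1) * \<tau>" using j2 \<tau> by (intro mult_right_mono) auto
      then have "ln (r / 2) \<le> T0 - real j * \<tau> + \<tau>" using zt by (simp add: algebra_simps)
      then have "exp (ln (r / 2)) \<le> exp (T0 - real j * \<tau> + \<tau>)" by simp
      then have "r \<le> 2 * exp (T0 - real j * \<tau> + \<tau>)" using r by simp
      moreover have "t = (T0 - real j * \<tau> + \<tau>) + \<tau>" by (simp add: t_def i algebra_simps)
      then have "exp t = exp (T0 - real j * \<tau> + \<tau>) * exp \<tau>" by (simp only: exp_add)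
      moreover have "exp \<tau> \<ge> 6 * 1" unfolding exp_\<tau>(1) by (intro mult_left_mono) auto
      then have "exp (T0 - real j * \<tau> + \<tau>) * 6 \<le> exp (T0 - real j * \<tau> + \<tau>) * exp \<tau>"
        by (intro mult_left_mono) auto
      ultimately show ?thesis using exp_gt_zero[of "T0 - real j * \<tau> + \<tau>"] by linarith
    qed
    have tj: "T0 - real j * \<tau> \<le> T0" using \<tau> by simp
    have Gj: "0 \<le> G (T0 - real j * \<tau>)" by (rule G_le_Mass(1)[OF tj])
    have M0: "0 \<le> Mass t" using G_le_Mass[OF t0(2)] by linarith
    have rR: "r \<le> R"
      using upper_t exp_T0[OF t0(2)] r by linarith
    have rR2: "2 * exp (T0 - real j * \<tau>) \<le> R" using lower_t rR by linarith
    have "J (2 * r) \<le> exp t ^ ?d * Mass t" by (rule J_le_Mass[OF t0(2) upper_t])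
    also have "\<dots> \<le> exp t ^ ?d * (exp \<tau> ^ ?d * G (t + \<tau>))"
      using Mass_le_G[OF t0(1)] M0 by (intro mult_left_mono) auto
    also have "\<dots> \<le> exp t ^ ?d * (exp \<tau> ^ ?d * (L ^ 3 * G (T0 - real j * \<tau>)))"
    proof -
      have "t + \<tau> = T0 - real i * \<tau>" by (simp add: t_def algebra_simps)
      then show ?thesis using dbl3[OF i(2)] unfolding i(1) by (intro mult_left_mono) auto
    qed
    also have "\<dots> = (exp t * exp \<tau>) ^ ?d * L ^ 3 * G (T0 - real j * \<tau>)"
      by (simp only: power_mult_distrib mult.assoc)
    also have "exp t * exp \<tau> = exp (3 * \<tau>) * exp (T0 - real j * \<tau>)"
      by (simp add: exp_add[symmetric] t_def i(1) algebra_simps)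
    also have "(exp (3 * \<tau>) * exp (T0 - real j * \<tau>)) ^ ?d * L ^ 3 * G (T0 - real j * \<tau>)
        = (exp (3 * \<tau>) ^ ?d * L ^ 3) * (exp (T0 - real j * \<tau>) ^ ?d * G (T0 - real j * \<tau>))"
      by (simp only: power_mult_distrib mult_ac)
    also have "\<dots> \<le> (exp (3 * \<tau>) ^ ?d * L ^ 3) * (4 * J (2 * exp (T0 - real j * \<tau>)))"
      using L by (intro mult_left_mono G_le_J tj) auto
    also have "\<dots> \<le> (exp (3 * \<tau>) ^ ?d * L ^ 3) * (4 * J r)"
    proof -
      have "J (2 * exp (T0 - real j * \<tau>)) \<le> J r"
        unfolding J_eq[OF rR] J_eq[OF rR2]
        by (rule integral_subset_le) (use lower_t J_integrable rR rR2 in \<open>auto simp: half_ball_def\<close>)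
      then show ?thesis using L by (intro mult_left_mono) auto
    qed
    finally show ?thesis by (simp add: C_def)
  qed
  moreover have "0 < r0" "0 < C" using L by (auto simp: r0_def C_def)
  ultimately show ?thesis by metis
qed

end

section \<open>Morrey's estimate at a flat point\<close>

lemma lborel_integral_affine:
  fixes f :: "'a::euclidean_space \<Rightarrow> real"
  assumes "continuous_on UNIV f" "\<And>x. x \<notin> cbox a b \<Longrightarrow> f x = 0" "0 < m"
  shows "(\<integral>z. f (y + m *\<^sub>R z) \<partial>lborel) = (\<integral>x. f x \<partial>lborel) / m ^ DIM('a)"
proof -
  let ?B = "cbox ((a - y) /\<^sub>R m) ((b - y) /\<^sub>R m)"
  have cf: "continuous_on (cbox a b) f" by (rule continuous_on_subset[OF assms(1)]) simp
  have "(f has_integral integral (cbox a b) f) (cbox a b)"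
    by (rule integrable_integral[OF integrable_continuous[OF cf]])
  from has_integral_affinity'[OF this assms(3), of y]
  have 1: "integral ?B (\<lambda>x. f (m *\<^sub>R x + y)) = integral (cbox a b) f /\<^sub>R m ^ DIM('a)"
    by (rule integral_unique)
  have out: "f (m *\<^sub>R x + y) = 0" if "x \<notin> ?B" for x
  proof (rule assms(2), rule notI)
    assume "m *\<^sub>R x + y \<in> cbox a b"
    then have "x \<in> ?B"
      using assms(3) by (auto simp: mem_box inner_simps field_simps)
    then show False using that by simp
  qed
  have "(\<integral>z. f (m *\<^sub>R z + y) \<partial>lborel) = integral ?B (\<lambda>x. f (m *\<^sub>R x + y))"
    by (rule lborel_integral_eq_cbox_integral(2))
      (auto intro!: continuous_on_compose2[OF assms(1)] continuous_intros out)
  moreover have "(\<integral>x. f x \<partial>lborel) = integral (cbox a b) f"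
    by (rule lborel_integral_eq_cbox_integral(2)[OF cf assms(2)])
  ultimately show ?thesis using 1 by (simp add: add.commute divide_inverse mult.commute)
qed

text \<open>Weak derivatives and the equation are formulated with Lebesgue integrals over open sets
  or half balls, while the calculus takes place on boxes; this passes between the two for continuous
  integrands supported in both.\<close>

lemma set_lebesgue_integral_eq_cbox_integral:
  fixes h k :: "'a::euclidean_space \<Rightarrow> real"
  assumes h: "continuous_on (cbox a b) h" "\<And>x. x \<notin> cbox a b \<Longrightarrow> h x = 0"
    and U: "\<And>x. x \<in> U \<Longrightarrow> k x = h x" "\<And>x. x \<notin> U \<Longrightarrow> h x = 0"
  shows "(LINT x:U|lebesgue. k x) = integral (cbox a b) h"
proof -
  have "(\<lambda>x. indicator U x *\<^sub>R k x) = h"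
    using U by (auto simp: indicator_def fun_eq_iff)
  then have "(LINT x:U|lebesgue. k x) = (\<integral>x. h x \<partial>lebesgue)" by (simp only: set_lebesgue_integral_def)
  also have "\<dots> = (\<integral>x. h x \<partial>lborel)"
    using lborel_integral_eq_cbox_integral(1)[OF h] by (intro integral_completion) auto
  also have "\<dots> = integral (cbox a b) h" by (rule lborel_integral_eq_cbox_integral(2)[OF h])
  finally show ?thesis .
qed

text \<open>
  Averages against a bump supported in the ball of radius \<open>1/2\<close> around \<open>axis None 1\<close>, translated by \<open>y\<close> and
  scaled by \<open>\<sigma>\<close>, only see points above \<open>y\<close>, so \<open>y\<close> may lie on the flat boundary. Moving \<open>(y, \<sigma>)\<close> linearly
  changes the kernel by the divergence of a test field.
\<close>

definition cone_bump :: "'n::finite space \<Rightarrow> real" where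
  "cone_bump = bump (axis None 1) (1/2)"

definition cone_bump_grad :: "'n::finite space \<Rightarrow> 'n space" where
  "cone_bump_grad = bump_grad (axis None 1) (1/2)"

lemma cone_bump_deriv: "(cone_bump has_derivative (\<lambda>h. cone_bump_grad x \<bullet> h)) (at x)"
  unfolding cone_bump_def cone_bump_grad_def by (rule bump_has_derivative)

lemma cont_cone_bump: "continuous_on UNIV cone_bump" "continuous_on UNIV cone_bump_grad"
  unfolding cone_bump_def cone_bump_grad_def by (intro continuous_intros)+

lemma cone_bump_bounds: "0 \<le> cone_bump z" "cone_bump z \<le> 1"
  by (auto simp: cone_bump_def bump_def flat_exp_def)

lemma cone_bump_eq_0:
  assumes "1/2 \<le> norm (z - axis None 1)"
  shows "cone_bump z = 0" "cone_bump_grad z = 0"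
  using assms by (auto simp: cone_bump_def cone_bump_grad_def bump_eq_0_iff bump_grad_eq_0)

lemma cone_bump_support:
  fixes z :: "'n::finite space"
  assumes "cone_bump z \<noteq> 0 \<or> cone_bump_grad z \<noteq> 0"
  shows "norm (z - axis None 1) < 1/2" "norm z < 3/2" "1/2 < z $ None"
proof -
  show 1: "norm (z - axis None 1) < 1/2" using assms cone_bump_eq_0[of z] by (meson not_le)
  have "norm z \<le> norm (z - axis None 1) + norm (axis None 1 :: 'n space)" 
    using norm_triangle_ineq[of "z - axis None 1" "axis None 1"] by simp
  then show "norm z < 3/2" using 1 by simp
  have "\<bar>(z - axis None 1) $ None\<bar> < 1/2" using component_le_norm_cart[of "z - axis None 1" None] 1 by linarith
  then have "\<bar>z $ None - 1\<bar> < 1/2" by (simp only: vector_minus_component axis_nth)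
  then show "1/2 < z $ None" by linarith
qed

definition rescale :: "'n::finite space \<Rightarrow> real \<Rightarrow> 'n space \<Rightarrow> 'n space" where
  "rescale y \<sigma> x = (1 / \<sigma>) *\<^sub>R (x - y)"

text \<open>The density of the image of \<open>cone_bump\<close> under z \<mapsto> y + \<sigma>
  z.\<close>

definition cone_kernel :: "'n::finite space \<Rightarrow> real \<Rightarrow> 'n space \<Rightarrow> real" where
  "cone_kernel y \<sigma> x = cone_bump (rescale y \<sigma> x) / \<sigma> ^ CARD('n option)"

definition cone_kernel' :: "'n::finite space \<Rightarrow> real \<Rightarrow> 'n space \<Rightarrow> real \<Rightarrow> 'n space \<Rightarrow> real" where
  "cone_kernel' v r y \<sigma> x = - (real CARD('n option) * r * cone_bump (rescale y \<sigma> x)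
     + cone_bump_grad (rescale y \<sigma> x) \<bullet> (v + r *\<^sub>R rescale y \<sigma> x)) / \<sigma> ^ (CARD('n option) + 1)"

lemma cone_kernel_deriv:
  fixes y v x :: "'n::finite space"
  assumes r: "0 < r" and th: "0 < \<theta>"
  shows "((\<lambda>\<theta>. cone_kernel (y + \<theta> *\<^sub>R v) (\<theta> * r) x) has_real_derivative
    cone_kernel' v r (y + \<theta> *\<^sub>R v) (\<theta> * r) x) (at \<theta>)"
proof -
  let ?d = "CARD('n option)"
  define \<sigma> where "\<sigma> = \<theta> * r"
  define Z where "Z = rescale (y + \<theta> *\<^sub>R v) \<sigma> x"
  have \<sigma>: "\<sigma> > 0" using r th by (simp add: \<sigma>_def)
  have dinv: "((\<lambda>\<theta>. 1 / (\<theta> * r)) has_real_derivative - (1 / \<sigma>) * (r / \<sigma>)) (at \<theta>)"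
    using r th by (auto intro!: derivative_eq_intros simp: \<sigma>_def power2_eq_square field_simps)
  have "((\<lambda>\<theta>. x - (y + \<theta> *\<^sub>R v)) has_vector_derivative - v) (at \<theta>)"
    by (auto intro!: derivative_eq_intros)
  from has_vector_derivative_scaleR[OF dinv this]
  have "((\<lambda>\<theta>. rescale (y + \<theta> *\<^sub>R v) (\<theta> * r) x) has_vector_derivative
      (1 / (\<theta> * r)) *\<^sub>R (- v) + (- (1 / \<sigma>) * (r / \<sigma>)) *\<^sub>R (x - (y + \<theta> *\<^sub>R v))) (at \<theta>)"
    unfolding rescale_def .
  also have "(1 / (\<theta> * r)) *\<^sub>R (- v) + (- (1 / \<sigma>) * (r / \<sigma>)) *\<^sub>R (x - (y + \<theta> *\<^sub>R v)) = (- (1 / \<sigma>)) *\<^sub>R (v + r *\<^sub>R Z)"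
    unfolding Z_def rescale_def \<sigma>_def[symmetric] by (simp add: scaleR_add_right)
  finally have dZ: "((\<lambda>\<theta>. rescale (y + \<theta> *\<^sub>R v) (\<theta> * r) x) has_derivative
      (\<lambda>h. h *\<^sub>R ((- (1 / \<sigma>)) *\<^sub>R (v + r *\<^sub>R Z)))) (at \<theta>)"
    unfolding has_vector_derivative_def .
  have "((\<lambda>\<theta>. cone_bump (rescale (y + \<theta> *\<^sub>R v) (\<theta> * r) x)) has_derivative
      (\<lambda>h. cone_bump_grad Z \<bullet> (h *\<^sub>R ((- (1 / \<sigma>)) *\<^sub>R (v + r *\<^sub>R Z))))) (at \<theta>)"
    using has_derivative_compose[OF dZ cone_bump_deriv] unfolding Z_def \<sigma>_def .
  then have d1: "((\<lambda>\<theta>. cone_bump (rescale (y + \<theta> *\<^sub>R v) (\<theta> * r) x)) has_real_derivative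
      - (cone_bump_grad Z \<bullet> (v + r *\<^sub>R Z)) / \<sigma>) (at \<theta>)"
    unfolding has_field_derivative_def by (rule has_derivative_eq_rhs) (auto simp: fun_eq_iff)
  have d2: "((\<lambda>\<theta>. (1 / (\<theta> * r)) ^ ?d) has_real_derivative
      real ?d * ((- (1 / \<sigma>) * (r / \<sigma>)) * (1 / \<sigma>) ^ (?d - 1))) (at \<theta>)"
    using DERIV_power[OF dinv, of ?d] unfolding \<sigma>_def One_nat_def .
  have pw: "(1 / \<sigma>) ^ (?d - 1) * (1 / \<sigma>) = (1 / \<sigma>) ^ ?d" by (rule power_minus_mult) simp
  have e: "real ?d * ((- (1 / \<sigma>) * (r / \<sigma>)) * (1 / \<sigma>) ^ (?d - 1)) = - (real ?d * r / \<sigma>) * (1 / \<sigma>) ^ ?d"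
    unfolding pw[symmetric] by (simp only: divide_inverse mult_1_left mult_minus_left mult_minus_right mult_ac)
  have "((\<lambda>\<theta>. cone_bump (rescale (y + \<theta> *\<^sub>R v) (\<theta> * r) x) * (1 / (\<theta> * r)) ^ ?d) has_real_derivative
      - (cone_bump_grad Z \<bullet> (v + r *\<^sub>R Z)) / \<sigma> * (1 / \<sigma>) ^ ?d + - (real ?d * r / \<sigma>) * (1 / \<sigma>) ^ ?d * cone_bump Z) (at \<theta>)"
    using DERIV_mult[OF d1 d2] unfolding e unfolding Z_def \<sigma>_def .
  moreover have "cone_kernel (y + \<theta> *\<^sub>R v) (\<theta> * r) x
      = cone_bump (rescale (y + \<theta> *\<^sub>R v) (\<theta> * r) x) * (1 / (\<theta> * r)) ^ ?d" for \<theta>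
    by (simp only: cone_kernel_def power_inverse divide_inverse mult_1_left)
  moreover have "- (cone_bump_grad Z \<bullet> (v + r *\<^sub>R Z)) / \<sigma> * (1 / \<sigma>) ^ ?d + - (real ?d * r / \<sigma>) * (1 / \<sigma>) ^ ?d * cone_bump Z
      = cone_kernel' v r (y + \<theta> *\<^sub>R v) (\<theta> * r) x"
  proof -
    have "(1 / \<sigma>) ^ ?d = 1 / \<sigma> ^ ?d" by (rule power_one_over)
    then show ?thesis
      unfolding cone_kernel'_def Z_def[symmetric] \<sigma>_def[symmetric]
      using \<sigma> by (simp add: add_divide_distrib diff_divide_distrib mult_ac del: card_option)
  qed
  ultimately show ?thesis by simp
qed

text \<open>If (y, \<sigma>) moves with velocity (v, r), the image y + \<sigma> z of z moves with
  velocity v + r z. The field \<phi> is this velocity times the kernel, and the formula for its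
  divergence is the continuity equation of the transported density.\<close>

lemma cone_kernel_test:
  fixes y v :: "'n::finite space" and r \<sigma> :: real
  assumes \<sigma>: "0 < \<sigma>" and sub: "cball (y + \<sigma> *\<^sub>R axis None 1) (\<sigma> / 2) \<subseteq> U"
  defines "\<phi> \<equiv> \<lambda>k x. (v + r *\<^sub>R rescale y \<sigma> x) \<bullet> axis k 1 * cone_bump (rescale y \<sigma> x) / \<sigma> ^ CARD('n option)"
  shows "test_function U (\<phi> k)"
    "(\<Sum>k\<in>UNIV. partial k UNIV (\<phi> k) x) = - cone_kernel' v r y \<sigma> x"
    "continuous_on UNIV (partial k UNIV (\<phi> k))"
    "x \<notin> cball (y + \<sigma> *\<^sub>R axis None 1) (\<sigma> / 2) \<Longrightarrow> \<phi> k x = 0 \<and> partial k UNIV (\<phi> k) x = 0"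
proof -
  let ?d = "CARD('n option)"
  let ?K = "cball (y + \<sigma> *\<^sub>R axis None 1) (\<sigma> / 2)"
  have resc: "rescale y \<sigma> = (\<lambda>x. (1 / \<sigma>) *\<^sub>R x + - ((1 / \<sigma>) *\<^sub>R y))"
    by (simp add: rescale_def fun_eq_iff scaleR_diff_right)
  have out: "cone_bump (rescale y \<sigma> x) = 0 \<and> cone_bump_grad (rescale y \<sigma> x) = 0" if "x \<notin> ?K" for x
  proof -
    have "rescale y \<sigma> x - axis None 1 = (1 / \<sigma>) *\<^sub>R (x - (y + \<sigma> *\<^sub>R axis None 1))"
      using \<sigma> by (simp add: rescale_def algebra_simps)
    then have "norm (rescale y \<sigma> x - axis None 1) = norm (x - (y + \<sigma> *\<^sub>R axis None 1)) / \<sigma>"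
      using \<sigma> by (simp add: divide_inverse mult.commute)
    moreover have "\<sigma> / 2 < norm (x - (y + \<sigma> *\<^sub>R axis None 1))"
      using that by (simp add: dist_norm norm_minus_commute)
    ultimately have "1/2 \<le> norm (rescale y \<sigma> x - axis None 1)" using \<sigma> by (simp add: pos_le_divide_eq)
    then show ?thesis using cone_bump_eq_0 by blast
  qed
  have ck: "Ck m (\<phi> k)" for m k
  proof -
    have "Ck m (\<lambda>z. ((v \<bullet> axis k 1 + r * (z \<bullet> axis k 1)) * cone_bump z) * (1 / \<sigma> ^ ?d))"
      unfolding cone_bump_def by (intro Ck_mult Ck_add Ck_const Ck_inner Ck_bump)
    from Ck_affine[OF this, of "1 / \<sigma>" "- ((1 / \<sigma>) *\<^sub>R y)"]
    show ?thesis unfolding \<phi>_def resc by (simp add: inner_add_left del: card_option)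
  qed
  show "test_function U (\<phi> k)"
    by (rule test_function_if_support[OF ck _ compact_cball sub]) (use out in \<open>simp add: \<phi>_def\<close>)
  show "continuous_on UNIV (partial k UNIV (\<phi> k))"
    using ck[of "Suc 0" k] by simp
  have dr: "(rescale y \<sigma> has_derivative (\<lambda>h. (1 / \<sigma>) *\<^sub>R h)) (at x)" for x
    unfolding resc by (auto intro!: derivative_eq_intros)
  have p: "partial k UNIV (\<phi> k) x
      = (r * cone_bump (rescale y \<sigma> x) + ((v + r *\<^sub>R rescale y \<sigma> x) \<bullet> axis k 1) * (cone_bump_grad (rescale y \<sigma> x) \<bullet> axis k 1)) / \<sigma> ^ (?d + 1)" for k x
  proof -
    have d1: "((\<lambda>x. (v + r *\<^sub>R rescale y \<sigma> x) \<bullet> axis k 1) has_derivative (\<lambda>h. (r *\<^sub>R ((1 / \<sigma>) *\<^sub>R h)) \<bullet> axis k 1)) (at x)"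
      by (rule has_derivative_eq_rhs, (rule derivative_intros dr)+) simp
    have d2: "((\<lambda>x. cone_bump (rescale y \<sigma> x)) has_derivative (\<lambda>h. cone_bump_grad (rescale y \<sigma> x) \<bullet> ((1 / \<sigma>) *\<^sub>R h))) (at x)"
      by (rule has_derivative_compose[OF dr cone_bump_deriv])
    have "((\<lambda>x. ((v + r *\<^sub>R rescale y \<sigma> x) \<bullet> axis k 1 * cone_bump (rescale y \<sigma> x)) * (1 / \<sigma> ^ ?d)) has_derivative
        (\<lambda>h. (((v + r *\<^sub>R rescale y \<sigma> x) \<bullet> axis k 1) * (cone_bump_grad (rescale y \<sigma> x) \<bullet> ((1 / \<sigma>) *\<^sub>R h))
          + ((r *\<^sub>R ((1 / \<sigma>) *\<^sub>R h)) \<bullet> axis k 1) * cone_bump (rescale y \<sigma> x)) * (1 / \<sigma> ^ ?d))) (at x)"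
      by (intro has_derivative_mult_left has_derivative_mult d1 d2)
    then have "(\<phi> k has_derivative
        (\<lambda>h. (((v + r *\<^sub>R rescale y \<sigma> x) \<bullet> axis k 1) * (cone_bump_grad (rescale y \<sigma> x) \<bullet> ((1 / \<sigma>) *\<^sub>R h))
          + ((r *\<^sub>R ((1 / \<sigma>) *\<^sub>R h)) \<bullet> axis k 1) * cone_bump (rescale y \<sigma> x)) * (1 / \<sigma> ^ ?d))) (at x)"
      unfolding \<phi>_def by (simp only: times_divide_eq_right mult_1_right)
    from partial_UNIV_eq[OF this, of k] show ?thesis
      using \<sigma> by (simp add: inner_axis_axis field_simps del: card_option)
  qed
  show "(\<Sum>k\<in>UNIV. partial k UNIV (\<phi> k) x) = - cone_kernel' v r y \<sigma> x"
  proof -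
    let ?a = "v + r *\<^sub>R rescale y \<sigma> x" and ?g = "cone_bump_grad (rescale y \<sigma> x)"
    have "(\<Sum>k\<in>(UNIV::'n option set). r * cone_bump (rescale y \<sigma> x) + (?a \<bullet> axis k 1) * (?g \<bullet> axis k 1))
        = real ?d * (r * cone_bump (rescale y \<sigma> x)) + (\<Sum>k\<in>UNIV. ?a $ k * ?g $ k)"
      by (simp only: sum.distrib sum_constant inner_axis inner_real_def mult_1_right)
    also have "(\<Sum>k\<in>UNIV. ?a $ k * ?g $ k) = ?g \<bullet> ?a"
      by (simp only: inner_vec_def inner_real_def mult.commute)
    finally show ?thesis
      unfolding p sum_divide_distrib[symmetric] cone_kernel'_def divide_minus_left minus_minus by (simp only: mult.assoc)
  qed
  show "\<phi> k x = 0 \<and> partial k UNIV (\<phi> k) x = 0" if "x \<notin> ?K"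
    using out[OF that] unfolding p by (simp add: \<phi>_def)
qed


section \<open>A localised Hoelder inequality\<close>

lemma measure_cball_le_cube:
  fixes c :: "real^'m"
  assumes "0 < s"
  shows "measure lebesgue (cball c (s / 2)) \<le> s ^ CARD('m)"
proof -
  let ?a = "c - (\<chi> i. s / 2)" and ?b = "c + (\<chi> i. s / 2)"
  have "cball c (s / 2) \<subseteq> cbox ?a ?b"
  proof
    fix x assume x: "x \<in> cball c (s / 2)"
    have "?a $ i \<le> x $ i \<and> x $ i \<le> ?b $ i" for i
    proof -
      have "\<bar>x $ i - c $ i\<bar> \<le> s / 2"
        using component_le_norm_cart[of "x - c" i] x by (simp add: dist_norm norm_minus_commute)
      then have "x $ i - c $ i \<le> s / 2" "- (x $ i - c $ i) \<le> s / 2" unfolding abs_le_iff by blast+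
      then show ?thesis by simp
    qed
    then show "x \<in> cbox ?a ?b" unfolding mem_box_cart by blast
  qed
  then have "measure lebesgue (cball c (s / 2)) \<le> measure lebesgue (cbox ?a ?b)"
    by (intro measure_mono_fmeasurable) auto
  also have "\<dots> = measure lborel (cbox ?a ?b)" by simp
  also have "\<dots> = (\<Prod>i\<in>UNIV. ?b $ i - ?a $ i)"
  proof (rule content_cbox_cart)
    have "c \<in> cbox ?a ?b" using assms by (simp add: mem_box_cart)
    then show "cbox ?a ?b \<noteq> {}" by blast
  qed
  also have "\<dots> = s ^ CARD('m)" by simp
  finally show ?thesis .
qed

text \<open>A pointwise substitute for Hoelder's inequality: where \<bar>g\<bar> exceeds the level
  m, the factor (\<bar>g\<bar> / m) powr (P - 1) is at least 1.\<close>

lemma split_power_bound: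
  fixes g m P :: real
  assumes "0 < m" "1 < P"
  shows "\<bar>g\<bar> \<le> m + m powr (1 - P) * \<bar>g\<bar> powr P"
proof (cases "\<bar>g\<bar> \<le> m")
  case True
  have "0 \<le> m powr (1 - P) * \<bar>g\<bar> powr P" by simp
  with True show ?thesis by linarith
next
  case False
  then have g: "0 < \<bar>g\<bar>" using assms by linarith
  have "\<bar>g\<bar> = \<bar>g\<bar> powr (1 - P) * \<bar>g\<bar> powr P"
    using g by (simp add: powr_add[symmetric])
  also have "\<dots> \<le> m powr (1 - P) * \<bar>g\<bar> powr P"
    using False assms by (intro mult_right_mono powr_mono2') auto
  finally show ?thesis using assms by linarith
qed

lemma integral_against_localized_bound:
  fixes g \<psi> :: "'n::finite space \<Rightarrow> real"
  assumes U: "U \<in> sets lebesgue" and P: "1 < P" and \<sigma>: "0 < \<sigma>" and A: "0 \<le> A"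
    and g: "g \<in> borel_measurable (lebesgue_on U)" "integrable (lebesgue_on U) (\<lambda>x. \<bar>g x\<bar> powr P)"
    and I: "(LINT x|lebesgue_on U. \<bar>g x\<bar> powr P) \<le> I"
    and \<psi>: "\<And>x. \<bar>\<psi> x\<bar> \<le> A" "\<And>x. x \<notin> cball c (\<sigma> / 2) \<Longrightarrow> \<psi> x = 0"
  shows "\<bar>LINT x:U|lebesgue. g x * \<psi> x\<bar> \<le> A * \<sigma> ^ CARD('n option) * (1 + I) * \<sigma> powr (- (real CARD('n option) / P))"
proof -
  let ?d = "CARD('n option)" and ?M = "lebesgue_on U" and ?B = "cball c (\<sigma> / 2)"
  \<comment> \<open>This level balances the two parts: m powr (1 - P) equals m times the volume
    bound \<sigma>^d, where d is the dimension.\<close>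
  define m where "m = \<sigma> powr (- (real ?d / P))"
  have m: "0 < m" using \<sigma> by (simp add: m_def)
  define h where "h x = A * (m * indicator ?B x + m powr (1 - P) * \<bar>g x\<bar> powr P)" for x
  have UB: "U \<inter> ?B \<in> fmeasurable lebesgue"
    using fmeasurable_Int_fmeasurable[OF lmeasurable_cball U] by (simp only: Int_commute)
  have eqI: "(\<lambda>x. indicator U x *\<^sub>R (indicator ?B x :: real)) = indicator (U \<inter> ?B)"
    by (auto simp: indicator_def fun_eq_iff)
  have ind: "integrable ?M (indicator ?B :: _ \<Rightarrow> real)"
  proof -
    have "integrable lebesgue (\<lambda>x. indicator U x *\<^sub>R (indicator ?B x :: real))"
      unfolding eqI using UB by (intro integrable_real_indicator) (auto simp: fmeasurable_def)
    then show ?thesis using U by (subst integrable_restrict_space) auto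
  qed
  have ind_le: "(LINT x|?M. indicator ?B x) \<le> \<sigma> ^ ?d"
  proof -
    have "(LINT x|?M. indicator ?B x) = (LINT x|lebesgue. indicator U x *\<^sub>R (indicator ?B x :: real))"
      using U by (intro integral_restrict_space) auto
    also have "\<dots> = measure lebesgue (U \<inter> ?B)" unfolding eqI by simp
    also have "\<dots> \<le> measure lebesgue ?B" using U by (intro measure_mono_fmeasurable) auto
    also have "\<dots> \<le> \<sigma> ^ ?d" by (rule measure_cball_le_cube[OF \<sigma>])
    finally show ?thesis .
  qed
  have ih: "integrable ?M h" unfolding h_def[abs_def]
    by (intro integrable_mult_right Bochner_Integration.integrable_add ind g(2))
  have pt: "\<bar>g x * \<psi> x\<bar> \<le> h x" for x
  proof (cases "x \<in> ?B")
    case True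
    have "\<bar>g x * \<psi> x\<bar> \<le> \<bar>g x\<bar> * A" unfolding abs_mult by (intro mult_left_mono \<psi>) simp
    also have "\<dots> \<le> (m + m powr (1 - P) * \<bar>g x\<bar> powr P) * A"
      by (intro mult_right_mono split_power_bound m P A)
    finally show ?thesis using True by (simp add: h_def mult.commute)
  next
    case False
    then show ?thesis using \<psi>(2)[OF False] A m by (simp add: h_def)
  qed
  have "\<bar>LINT x:U|lebesgue. g x * \<psi> x\<bar> = \<bar>LINT x|?M. g x * \<psi> x\<bar>"
    unfolding set_lebesgue_integral_def using U by (subst integral_restrict_space) auto
  also have "\<dots> \<le> (LINT x|?M. \<bar>g x * \<psi> x\<bar>)" by (rule integral_abs_bound)
  also have "\<dots> \<le> (LINT x|?M. h x)"
    by (rule integral_mono') (use ih pt order_trans[OF abs_ge_zero pt] in auto)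
  also have "\<dots> = A * (m * (LINT x|?M. indicator ?B x) + m powr (1 - P) * (LINT x|?M. \<bar>g x\<bar> powr P))"
    unfolding h_def by (simp add: ind g(2) Bochner_Integration.integral_add)
  also have "\<dots> \<le> A * (m * \<sigma> ^ ?d + m powr (1 - P) * I)"
    by (intro mult_left_mono add_mono ind_le I A) (use m in auto)
  also have "m powr (1 - P) = m * \<sigma> ^ ?d"
  proof -
    have "m powr (1 - P) = \<sigma> powr (- (real ?d / P) * (1 - P))" unfolding m_def by (rule powr_powr)
    also have "- (real ?d / P) * (1 - P) = - (real ?d / P) + real ?d" using P by (simp add: field_simps)
    also have "\<sigma> powr (- (real ?d / P) + real ?d) = m * \<sigma> ^ ?d"
      unfolding powr_add m_def using \<sigma> by (simp add: powr_realpow del: card_option)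
    finally show ?thesis .
  qed
  also have "A * (m * \<sigma> ^ ?d + m * \<sigma> ^ ?d * I) = A * \<sigma> ^ ?d * (1 + I) * m" by (simp add: algebra_simps)
  finally show ?thesis unfolding m_def .
qed

text \<open>The value at y is joined to the average at x0 over scale r along the centres y +
  \<theta> (x0 - y) and scales \<theta> r. That average does not involve y, so two points can be
  compared through it. The derivative in \<theta> is the weak gradient paired with a test field; it
  is O(\<theta> powr (\<gamma> - 1)), hence integrable at 0.\<close>

lemma cone_average_bound:
  fixes f :: "'n::finite space \<Rightarrow> real" and g :: "'n option \<Rightarrow> 'n space \<Rightarrow> real" and x0 y :: "'n space"
  defines "U \<equiv> interior (half_ball (0::'n space) 1)"
  assumes cont: "continuous_on (half_ball 0 1) f"
    and weak: "\<And>k. has_weak_partial k U f (g k)"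
    and g: "\<And>k. g k \<in> borel_measurable (lebesgue_on U)" "\<And>k. integrable (lebesgue_on U) (\<lambda>x. \<bar>g k x\<bar> powr P)"
    and I: "\<And>k. (LINT x|lebesgue_on U. \<bar>g k x\<bar> powr P) \<le> I" "0 \<le> I"
    and P: "real CARD('n option) < P"
    and x0: "x0 $ None = 0" "norm x0 < 1/2" and r: "0 < r" "r \<le> 1/8"
    and y: "0 \<le> y $ None" "norm (y - x0) \<le> r"
  defines "\<gamma> \<equiv> 1 - real CARD('n option) / P"
  shows "\<bar>(\<integral>z. f (x0 + r *\<^sub>R z) * cone_bump z \<partial>lborel) - f y * (\<integral>z. cone_bump (z::'n space) \<partial>lborel)\<bar>
    \<le> 5/2 * real CARD('n option) * (1 + I) * r powr \<gamma> / \<gamma>"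
proof -
  let ?d = "CARD('n option)" and ?e = "axis None 1 :: 'n space"
  let ?o = "(\<chi> i. 1) :: 'n space"
  have d1: "1 \<le> real ?d" by simp
  have P1: "1 < P" using P d1 by linarith
  have \<gamma>: "0 < \<gamma>" using P P1 unfolding \<gamma>_def by (simp add: pos_divide_less_eq del: card_option)
  define v where "v = x0 - y"
  have v: "norm v \<le> r" using y(2) by (simp add: v_def norm_minus_commute)
  define Y where "Y \<theta> = y + \<theta> *\<^sub>R v" for \<theta>
  have YN: "0 \<le> Y \<theta> $ None" if "0 \<le> \<theta>" "\<theta> \<le> 1" for \<theta>
  proof -
    have "Y \<theta> $ None = (1 - \<theta>) * y $ None" by (simp add: Y_def v_def x0 algebra_simps)
    then show ?thesis using that y(1) by simp
  qed
  have Yx0: "norm (Y \<theta> - x0) \<le> (1 - \<theta>) * r" if "0 \<le> \<theta>" "\<theta> \<le> 1" for \<theta>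
  proof -
    have "Y \<theta> - x0 = (1 - \<theta>) *\<^sub>R (y - x0)" by (simp add: Y_def v_def algebra_simps)
    then show ?thesis using that y(2) by (simp add: mult_left_mono)
  qed
  define K where "K = {x :: 'n space. 0 \<le> x $ None} \<inter> cball x0 (1/4)"
  have "closed {x :: 'n space. 0 \<le> x $ None}" by (intro closed_Collect_le continuous_intros)
  then have K: "closed K" unfolding K_def by (intro closed_Int closed_cball)
  have KS: "x \<in> half_ball 0 1" if "x \<in> K" for x
  proof -
    have "norm x \<le> norm (x - x0) + norm x0" using norm_triangle_ineq[of "x - x0" x0] by simp
    then show ?thesis using that x0(2) by (simp add: K_def half_ball_def dist_norm norm_minus_commute)
  qed
  \<comment> \<open>A global continuous extension gives meaning to integrals over boxes that leave
    the half ball; for 0 < \<theta> \<le> 1 the kernels see it only on K, where it equals f.\<close>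
  obtain fh where fh: "continuous_on UNIV fh" "\<And>x. x \<in> K \<Longrightarrow> fh x = f x"
  proof (rule Tietze_unbounded[of K f UNIV])
    show "continuous_on K f" by (rule continuous_on_subset[OF cont]) (use KS in blast)
    show "closedin (top_of_set UNIV) K" using K by simp
  qed blast
  have cfh: "continuous_on S (\<lambda>x. fh (h x))" if "continuous_on S h" for S and h :: "'b::topological_space \<Rightarrow> 'n space"
    by (rule continuous_on_compose2[OF fh(1) that]) simp
  have ccb: "continuous_on S (\<lambda>x. cone_bump (h x))" "continuous_on S (\<lambda>x. cone_bump_grad (h x))"
    if "continuous_on S h" for S and h :: "'b::topological_space \<Rightarrow> 'n space"
    by (rule continuous_on_compose2[OF cont_cone_bump(1) that] continuous_on_compose2[OF cont_cone_bump(2) that]; simp)+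
  have inK: "Y \<theta> + (\<theta> * r) *\<^sub>R z \<in> K" if th: "0 \<le> \<theta>" "\<theta> \<le> 1" and z: "norm z \<le> 3/2" "0 \<le> z $ None" for \<theta> z
  proof -
    have "norm (Y \<theta> + (\<theta> * r) *\<^sub>R z - x0) \<le> norm (Y \<theta> - x0) + norm ((\<theta> * r) *\<^sub>R z)"
      using norm_triangle_ineq[of "Y \<theta> - x0" "(\<theta> * r) *\<^sub>R z"] by (simp add: algebra_simps)
    moreover have "norm ((\<theta> * r) *\<^sub>R z) \<le> (\<theta> * r) * (3/2)"
    proof -
      have "norm ((\<theta> * r) *\<^sub>R z) = (\<theta> * r) * norm z" using th r by simp
      also have "\<dots> \<le> (\<theta> * r) * (3/2)" using th r z by (intro mult_left_mono) auto
      finally show ?thesis .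
    qed
    moreover have "(1 - \<theta>) * r = r - \<theta> * r" by (simp add: algebra_simps)
    moreover have "\<theta> * r \<le> 1 * r" using th r by (intro mult_right_mono) auto
    ultimately have "norm (Y \<theta> + (\<theta> * r) *\<^sub>R z - x0) \<le> 1/4" using Yx0[OF th] r by linarith
    moreover have "0 \<le> (Y \<theta> + (\<theta> * r) *\<^sub>R z) $ None" using YN[OF th] th r z by simp
    ultimately show ?thesis by (simp add: K_def dist_norm norm_minus_commute)
  qed
  \<comment> \<open>Two forms of one average: M, written in z, is continuous down to \<theta> = 0,
    whereas in N the parameter sits in the kernel alone, so N can be differentiated for \<theta> > 0
    although f cannot.\<close>
  define M where "M \<theta> = (\<integral>z. fh (Y \<theta> + (\<theta> * r) *\<^sub>R z) * cone_bump z \<partial>lborel)" for \<theta>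
  have Zout: "cone_bump z = 0" if "z \<notin> cbox (?e - ?o) (?e + ?o)" for z :: "'n space"
  proof (rule ccontr)
    assume "cone_bump z \<noteq> 0"
    then have n: "norm (z - ?e) < 1/2" using cone_bump_support(1) by blast
    have "(?e - ?o) $ i \<le> z $ i \<and> z $ i \<le> (?e + ?o) $ i" for i
    proof -
      have "\<bar>z $ i - ?e $ i\<bar> \<le> 1" using component_le_norm_cart[of "z - ?e" i] n by simp
      then have "z $ i - ?e $ i \<le> 1" "- (z $ i - ?e $ i) \<le> 1" unfolding abs_le_iff by blast+
      then show ?thesis by simp
    qed
    then show False using that unfolding mem_box_cart by blast
  qed
  have M_box: "M \<theta> = integral (cbox (?e - ?o) (?e + ?o)) (\<lambda>z. fh (Y \<theta> + (\<theta> * r) *\<^sub>R z) * cone_bump z)" for \<theta>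
    unfolding M_def
    by (rule lborel_integral_eq_cbox_integral(2)) (auto intro!: continuous_on_mult cfh ccb continuous_intros simp: Zout)
  have contM: "continuous_on {0..1} M"
    unfolding M_box[abs_def] Y_def
    by (intro integral_continuous_on_param) (unfold case_prod_beta, intro continuous_on_mult cfh ccb continuous_intros)
  have M1: "M 1 = (\<integral>z. f (x0 + r *\<^sub>R z) * cone_bump z \<partial>lborel)"
    unfolding M_def
  proof (rule Bochner_Integration.integral_cong[OF refl])
    fix z :: "'n space"
    have Y1: "Y 1 = x0" by (simp add: Y_def v_def)
    show "fh (Y 1 + (1 * r) *\<^sub>R z) * cone_bump z = f (x0 + r *\<^sub>R z) * cone_bump z"
    proof (cases "cone_bump z = 0")
      case False
      then have "norm z \<le> 3/2" "0 \<le> z $ None" using cone_bump_support[of z] by auto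
      from fh(2)[OF inK[of 1, OF _ _ this]] show ?thesis by (simp add: Y1)
    qed simp
  qed
  have M0: "M 0 = f y * (\<integral>z. cone_bump (z::'n space) \<partial>lborel)"
  proof -
    have "fh y = f y" using fh(2)[OF inK[of 0 0]] by (simp add: Y_def)
    then show ?thesis by (simp add: M_def Y_def)
  qed
  let ?X = "cbox (x0 - ?o) (x0 + ?o)"
  have near_X: "x \<in> ?X" if "norm (x - x0) \<le> 1" for x
  proof -
    have "(x0 - ?o) $ i \<le> x $ i \<and> x $ i \<le> (x0 + ?o) $ i" for i
    proof -
      have "\<bar>x $ i - x0 $ i\<bar> \<le> 1" using component_le_norm_cart[of "x - x0" i] that by simp
      then have "x $ i - x0 $ i \<le> 1" "- (x $ i - x0 $ i) \<le> 1" unfolding abs_le_iff by blast+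
      then show ?thesis by simp
    qed
    then show ?thesis unfolding mem_box_cart by blast
  qed
  define N where "N \<theta> = integral ?X (\<lambda>x. fh x * cone_kernel (Y \<theta>) (\<theta> * r) x)" for \<theta>
  have ballK: "x \<in> K \<and> x \<in> U" if th: "0 < \<theta>" "\<theta> \<le> 1" and x: "x \<in> cball (Y \<theta> + (\<theta> * r) *\<^sub>R ?e) (\<theta> * r / 2)" for \<theta> x
  proof -
    have s: "0 < \<theta> * r" using th r by simp
    define z where "z = rescale (Y \<theta>) (\<theta> * r) x"
    have xz: "x = Y \<theta> + (\<theta> * r) *\<^sub>R z" using th r by (simp add: z_def rescale_def)
    have "(\<theta> * r) * norm (z - ?e) = norm ((\<theta> * r) *\<^sub>R (z - ?e))" using th r by simp
    also have "\<dots> = norm (x - (Y \<theta> + (\<theta> * r) *\<^sub>R ?e))" by (simp add: xz algebra_simps)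
    also have "\<dots> \<le> (\<theta> * r) * (1/2)" using x by (simp add: dist_norm norm_minus_commute)
    finally have n: "norm (z - ?e) \<le> 1/2" using s by (simp only: mult_le_cancel_left_pos)
    have "norm z \<le> norm (z - ?e) + norm ?e" using norm_triangle_ineq[of "z - ?e" ?e] by simp
    then have n2: "norm z \<le> 3/2" using n by simp
    have "\<bar>(z - ?e) $ None\<bar> \<le> 1/2" using component_le_norm_cart[of "z - ?e" None] n by linarith
    then have "\<bar>z $ None - 1\<bar> \<le> 1/2" by (simp only: vector_minus_component axis_nth)
    then have zN: "0 < z $ None" by linarith
    have xK: "x \<in> K" unfolding xz using th n2 zN by (intro inK) auto
    moreover have "x \<in> U"
    proof -
      have op: "open ({x :: 'n space. 0 < x $ None} \<inter> ball 0 1)"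
        by (intro open_Int open_ball open_Collect_less continuous_intros)
      have "{x :: 'n space. 0 < x $ None} \<inter> ball 0 1 \<subseteq> half_ball 0 1"
        by (auto simp: half_ball_def)
      then have "{x :: 'n space. 0 < x $ None} \<inter> ball 0 1 \<subseteq> U"
        unfolding U_def using op by (rule interior_maximal)
      moreover have "0 < x $ None" unfolding xz using YN[of \<theta>] th s zN by (simp add: add_nonneg_pos)
      moreover have "norm x < 1" using KS[OF xK] by (simp add: half_ball_def)
      ultimately show ?thesis by auto
    qed
    ultimately show ?thesis by blast
  qed
  have KX: "x \<in> ?X" if "x \<in> K" for x
    using that by (intro near_X) (simp add: K_def dist_norm norm_minus_commute)
  have MN: "M \<theta> = N \<theta>" if th: "0 < \<theta>" "\<theta> \<le> 1" for \<theta>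
  proof -
    define \<sigma> where "\<sigma> = \<theta> * r"
    have \<sigma>: "0 < \<sigma>" using th r by (simp add: \<sigma>_def)
    define h where "h x = fh x * cone_bump (rescale (Y \<theta>) \<sigma> x)" for x
    have ch: "continuous_on S h" for S
      unfolding h_def[abs_def] rescale_def by (intro continuous_on_mult cfh ccb continuous_intros)
    have hout: "h x = 0" if "x \<notin> ?X" for x
    proof (rule ccontr)
      assume "h x \<noteq> 0"
      then have nz: "cone_bump (rescale (Y \<theta>) \<sigma> x) \<noteq> 0" by (auto simp: h_def)
      have "x = Y \<theta> + \<sigma> *\<^sub>R rescale (Y \<theta>) \<sigma> x" using \<sigma> by (simp add: rescale_def)
      also have "\<dots> \<in> K" unfolding \<sigma>_def using th cone_bump_support[of "rescale (Y \<theta>) \<sigma> x"] nz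
        by (intro inK) (auto simp: \<sigma>_def)
      finally show False using KX that by blast
    qed
    have "h (Y \<theta> + \<sigma> *\<^sub>R z) = fh (Y \<theta> + \<sigma> *\<^sub>R z) * cone_bump z" for z
      using \<sigma> by (simp add: h_def rescale_def)
    then have "M \<theta> = (\<integral>z. h (Y \<theta> + \<sigma> *\<^sub>R z) \<partial>lborel)" by (simp add: M_def \<sigma>_def)
    also have "\<dots> = (\<integral>x. h x \<partial>lborel) / \<sigma> ^ DIM('n space)"
      by (rule lborel_integral_affine[OF ch hout \<sigma>])
    also have "(\<integral>x. h x \<partial>lborel) = integral ?X h" by (rule lborel_integral_eq_cbox_integral(2)[OF ch hout])
    also have "integral ?X h / \<sigma> ^ DIM('n space) = integral ?X (\<lambda>x. h x * (1 / \<sigma> ^ ?d))"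
      by (simp del: card_option)
    also have "(\<lambda>x. h x * (1 / \<sigma> ^ ?d)) = (\<lambda>x. fh x * cone_kernel (Y \<theta>) \<sigma> x)"
      by (simp add: h_def cone_kernel_def fun_eq_iff del: card_option)
    finally show ?thesis by (simp only: N_def \<sigma>_def)
  qed
  define N' where "N' \<theta> = integral ?X (\<lambda>x. fh x * cone_kernel' v r (Y \<theta>) (\<theta> * r) x)" for \<theta>
  have dN: "(N has_real_derivative N' \<theta>) (at \<theta>)" if th: "0 < \<theta>" "\<theta> \<le> 1" for \<theta>
  proof -
    \<comment> \<open>Parameters beyond 1 make the derivative at \<theta> = 1 two-sided, and the
      extension fh gives a meaning to N there.\<close>
    let ?T = "{\<theta> / 2..2}"
    have "((\<lambda>\<theta>. integral ?X (\<lambda>x. fh x * cone_kernel (Y \<theta>) (\<theta> * r) x)) has_real_derivative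
        integral ?X (\<lambda>x. fh x * cone_kernel' v r (Y \<theta>) (\<theta> * r) x)) (at \<theta> within ?T)"
    proof (rule leibniz_rule_field_derivative)
      show "((\<lambda>\<theta>. fh x * cone_kernel (Y \<theta>) (\<theta> * r) x) has_real_derivative fh x * cone_kernel' v r (Y \<theta>') (\<theta>' * r) x) (at \<theta>' within ?T)"
        if "\<theta>' \<in> ?T" for \<theta>' x
        unfolding Y_def using that th
        by (intro DERIV_cmult has_field_derivative_at_within[OF cone_kernel_deriv[OF r(1)]]) auto
      show "(\<lambda>x. fh x * cone_kernel (Y \<theta>') (\<theta>' * r) x) integrable_on ?X" if "\<theta>' \<in> ?T" for \<theta>'
        unfolding cone_kernel_def rescale_def using that th r
        by (intro integrable_continuous continuous_on_mult continuous_on_divide cfh ccb continuous_intros) auto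
      show "continuous_on (?T \<times> ?X) (\<lambda>(\<theta>, x). fh x * cone_kernel' v r (Y \<theta>) (\<theta> * r) x)"
        unfolding case_prod_beta cone_kernel'_def rescale_def Y_def using th r
        by (intro continuous_on_mult continuous_on_divide continuous_on_minus continuous_on_add continuous_on_inner
            continuous_on_scaleR continuous_on_diff continuous_on_power continuous_on_fst continuous_on_snd continuous_on_id
            continuous_on_const cfh ccb) auto
    qed (use th in auto)
    moreover have "at \<theta> within ?T = at \<theta>" by (rule at_within_interior) (use th in simp)
    ultimately show ?thesis unfolding N_def[abs_def] N'_def by simp
  qed
  define c1 where "c1 = 5/2 * real ?d * (1 + I) * r powr \<gamma>"
  have c1: "0 \<le> c1" using I(2) by (simp add: c1_def)
  have N'_bound: "\<bar>N' \<theta>\<bar> \<le> c1 * \<theta> powr (\<gamma> - 1)" if th: "0 < \<theta>" "\<theta> \<le> 1" for \<theta>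
  proof -
    define \<sigma> where "\<sigma> = \<theta> * r"
    have \<sigma>: "0 < \<sigma>" using th r by (simp add: \<sigma>_def)
    define \<phi> where "\<phi> k x = (v + r *\<^sub>R rescale (Y \<theta>) \<sigma> x) \<bullet> axis k 1 * cone_bump (rescale (Y \<theta>) \<sigma> x) / \<sigma> ^ ?d" for k x
    let ?K = "cball (Y \<theta> + \<sigma> *\<^sub>R ?e) (\<sigma> / 2)"
    have sub: "?K \<subseteq> U" using ballK[OF th] unfolding \<sigma>_def by blast
    note T = cone_kernel_test[OF \<sigma> sub, where v=v and r=r, folded \<phi>_def]
    \<comment> \<open>The kernel only sees z of norm below 3/2, and norm v \<le> r, so the velocity
      v + r z has norm at most 5/2 r.\<close>
    have each: "\<bar>integral ?X (\<lambda>x. fh x * partial k UNIV (\<phi> k) x)\<bar> \<le> 5/2 * r * (1 + I) * \<sigma> powr (- (real ?d / P))" for k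
    proof -
      have e1: "(LINT x:U|lebesgue. f x * partial k UNIV (\<phi> k) x) = integral ?X (\<lambda>x. fh x * partial k UNIV (\<phi> k) x)"
      proof (rule set_lebesgue_integral_eq_cbox_integral)
        show "continuous_on ?X (\<lambda>x. fh x * partial k UNIV (\<phi> k) x)"
          by (intro continuous_on_mult continuous_on_subset[OF T(3)] continuous_on_subset[OF fh(1)]) auto
        show "fh x * partial k UNIV (\<phi> k) x = 0" if "x \<notin> ?X" for x
        proof -
          have "x \<notin> ?K" using ballK[OF th, of x] KX that unfolding \<sigma>_def by blast
          then show ?thesis using T(4) by simp
        qed
        show "fh x * partial k UNIV (\<phi> k) x = 0" if "x \<notin> U" for x
        proof -
          have "x \<notin> ?K" using sub that by blast
          then show ?thesis using T(4) by simp
        qed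
        show "f x * partial k UNIV (\<phi> k) x = fh x * partial k UNIV (\<phi> k) x" for x
        proof (cases "x \<in> ?K")
          case True
          then have "x \<in> K" using ballK[OF th] unfolding \<sigma>_def by blast
          then show ?thesis using fh(2) by simp
        next
          case False
          then show ?thesis using T(4) by simp
        qed
      qed
      have e2: "(LINT x:U|lebesgue. f x * partial k UNIV (\<phi> k) x) = - (LINT x:U|lebesgue. g k x * \<phi> k x)"
        using weak[of k] T(1) unfolding has_weak_partial_def by blast
      have e3: "\<bar>LINT x:U|lebesgue. g k x * \<phi> k x\<bar>
          \<le> (5/2 * r / \<sigma> ^ ?d) * \<sigma> ^ ?d * (1 + I) * \<sigma> powr (- (real ?d / P))"
      proof (rule integral_against_localized_bound[OF _ P1 \<sigma> _ g I(1)])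
        show "U \<in> sets lebesgue" unfolding U_def by (intro sets_completionI_sets) simp
        show "0 \<le> 5/2 * r / \<sigma> ^ ?d" using r \<sigma> by simp
        show "\<phi> k x = 0" if "x \<notin> ?K" for x using T(4)[OF that] by simp
        show "\<bar>\<phi> k x\<bar> \<le> 5/2 * r / \<sigma> ^ ?d" for x
        proof (cases "cone_bump (rescale (Y \<theta>) \<sigma> x) = 0")
          case True
          then show ?thesis using r \<sigma> by (simp add: \<phi>_def)
        next
          case False
          then have z: "norm (rescale (Y \<theta>) \<sigma> x) < 3/2" using cone_bump_support(2) by blast
          have "\<bar>(v + r *\<^sub>R rescale (Y \<theta>) \<sigma> x) \<bullet> axis k 1\<bar> \<le> norm (v + r *\<^sub>R rescale (Y \<theta>) \<sigma> x)"
            using component_le_norm_cart[of "v + r *\<^sub>R rescale (Y \<theta>) \<sigma> x" k] by (simp add: inner_axis)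
          also have "\<dots> \<le> norm v + norm (r *\<^sub>R rescale (Y \<theta>) \<sigma> x)" by (rule norm_triangle_ineq)
          also have "\<dots> \<le> r + r * (3/2)" using v r z by (intro add_mono) (auto intro: mult_left_mono)
          finally have "\<bar>(v + r *\<^sub>R rescale (Y \<theta>) \<sigma> x) \<bullet> axis k 1\<bar> * cone_bump (rescale (Y \<theta>) \<sigma> x) \<le> (5/2 * r) * 1"
            using cone_bump_bounds[of "rescale (Y \<theta>) \<sigma> x"] r by (intro mult_mono) auto
          then have "\<bar>(v + r *\<^sub>R rescale (Y \<theta>) \<sigma> x) \<bullet> axis k 1\<bar> * cone_bump (rescale (Y \<theta>) \<sigma> x) / \<sigma> ^ ?d
              \<le> (5/2 * r) * 1 / \<sigma> ^ ?d"
            using \<sigma> by (intro divide_right_mono) auto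
          moreover have "\<bar>\<phi> k x\<bar> = \<bar>(v + r *\<^sub>R rescale (Y \<theta>) \<sigma> x) \<bullet> axis k 1\<bar> * cone_bump (rescale (Y \<theta>) \<sigma> x) / \<sigma> ^ ?d"
            using \<sigma> cone_bump_bounds(1)[of "rescale (Y \<theta>) \<sigma> x"]
            by (simp add: \<phi>_def abs_mult del: card_option)
          ultimately show ?thesis by (simp only: mult_1_right)
        qed
      qed
      have e4: "(5/2 * r / \<sigma> ^ ?d) * \<sigma> ^ ?d = 5/2 * r" using \<sigma> by (simp del: card_option)
      show ?thesis using e3 unfolding e4 e1[symmetric] e2 abs_minus_cancel .
    qed
    have int: "(\<lambda>x. fh x * partial k UNIV (\<phi> k) x) integrable_on ?X" for k
      by (intro integrable_continuous continuous_on_mult continuous_on_subset[OF T(3)] continuous_on_subset[OF fh(1)]) auto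
    have "fh x * cone_kernel' v r (Y \<theta>) \<sigma> x = - (\<Sum>k\<in>UNIV. fh x * partial k UNIV (\<phi> k) x)" for x
      unfolding sum_distrib_left[symmetric] T(2) by simp
    then have "N' \<theta> = - (\<Sum>k\<in>UNIV. integral ?X (\<lambda>x. fh x * partial k UNIV (\<phi> k) x))"
      unfolding N'_def \<sigma>_def[symmetric] using int by (simp add: integral_sum)
    then have "\<bar>N' \<theta>\<bar> \<le> (\<Sum>k\<in>UNIV. \<bar>integral ?X (\<lambda>x. fh x * partial k UNIV (\<phi> k) x)\<bar>)"
      using sum_abs by simp
    also have "\<dots> \<le> (\<Sum>k\<in>(UNIV::'n option set). 5/2 * r * (1 + I) * \<sigma> powr (- (real ?d / P)))"
      by (intro sum_mono each)
    also have "\<dots> = real ?d * (5/2 * r * (1 + I) * \<sigma> powr (- (real ?d / P)))" by (simp only: sum_constant)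
    also have "\<sigma> powr (- (real ?d / P)) = \<theta> powr (\<gamma> - 1) * r powr (\<gamma> - 1)"
      unfolding \<sigma>_def \<gamma>_def using th r by (simp add: powr_mult)
    also have "real ?d * (5/2 * r * (1 + I) * (\<theta> powr (\<gamma> - 1) * r powr (\<gamma> - 1)))
        = 5/2 * real ?d * (1 + I) * (r * r powr (\<gamma> - 1)) * \<theta> powr (\<gamma> - 1)" by (simp only: mult_ac)
    also have "r * r powr (\<gamma> - 1) = r powr \<gamma>"
      using r powr_add[of r 1 "\<gamma> - 1"] by simp
    finally show ?thesis unfolding c1_def .
  qed
  have bound: "norm (M 1 - M \<theta>1) \<le> c1 / \<gamma>" if th: "\<theta>1 \<in> {0<..<1}" for \<theta>1
  proof -
    \<comment> \<open>N is compared on [\<theta>1, 1] with a primitive of the bound for its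
      derivative; the case \<theta>1 = 0 then follows from the continuity of M.\<close>
    have dp: "((\<lambda>\<theta>. c1 * (\<theta> powr \<gamma> / \<gamma>)) has_real_derivative c1 * \<theta> powr (\<gamma> - 1)) (at \<theta>)" if "0 < \<theta>" for \<theta>
      using that \<gamma> by (auto intro!: derivative_eq_intros)
    define p where "p \<theta> = c1 * (\<theta> powr \<gamma> / \<gamma>)" for \<theta>
    define a where "a \<theta> = N \<theta> - p \<theta>" for \<theta>
    define b where "b \<theta> = N \<theta> + p \<theta>" for \<theta>
    have "a 1 \<le> a \<theta>1"
    proof (rule DERIV_nonpos_imp_nonincreasing[of \<theta>1 1 a])
      fix \<theta> assume t: "\<theta>1 \<le> \<theta>" "\<theta> \<le> 1"
      then have t0: "0 < \<theta>" using th by simp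
      have "(a has_real_derivative N' \<theta> - c1 * \<theta> powr (\<gamma> - 1)) (at \<theta>)"
        unfolding a_def[abs_def] p_def by (intro DERIV_diff dN dp t0 t)
      moreover have "N' \<theta> - c1 * \<theta> powr (\<gamma> - 1) \<le> 0" using N'_bound[OF t0 t(2)] by simp
      ultimately show "\<exists>D. (a has_real_derivative D) (at \<theta>) \<and> D \<le> 0" by blast
    qed (use th in simp)
    moreover have "b \<theta>1 \<le> b 1"
    proof (rule DERIV_nonneg_imp_nondecreasing[of \<theta>1 1 b])
      fix \<theta> assume t: "\<theta>1 \<le> \<theta>" "\<theta> \<le> 1"
      then have t0: "0 < \<theta>" using th by simp
      have "(b has_real_derivative N' \<theta> + c1 * \<theta> powr (\<gamma> - 1)) (at \<theta>)"
        unfolding b_def[abs_def] p_def by (intro DERIV_add dN dp t0 t)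
      moreover have "0 \<le> N' \<theta> + c1 * \<theta> powr (\<gamma> - 1)" using N'_bound[OF t0 t(2)] by simp
      ultimately show "\<exists>D. (b has_real_derivative D) (at \<theta>) \<and> 0 \<le> D" by blast
    qed (use th in simp)
    moreover have "0 \<le> p \<theta>1" "p 1 = c1 / \<gamma>" using c1 \<gamma> by (auto simp: p_def)
    ultimately have "\<bar>N 1 - N \<theta>1\<bar> \<le> c1 / \<gamma>" unfolding a_def b_def by linarith
    then show ?thesis using MN[of 1] MN[of \<theta>1] th by simp
  qed
  have cl: "closure {0<..<1::real} = {0..1}" by simp
  have "norm (M 1 - M 0) \<le> c1 / \<gamma>"
  proof (rule continuous_on_closure_norm_le[where s="{0<..<1}" and f="\<lambda>\<theta>. M 1 - M \<theta>"])
    show "continuous_on (closure {0<..<1}) (\<lambda>\<theta>. M 1 - M \<theta>)"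
      unfolding cl by (intro continuous_on_diff continuous_on_const contM)
    show "\<forall>\<theta>\<in>{0<..<1}. norm (M 1 - M \<theta>) \<le> c1 / \<gamma>" using bound by blast
    show "(0::real) \<in> closure {0<..<1}" unfolding cl by simp
  qed
  then show ?thesis unfolding M1 M0 c1_def by simp
qed

section \<open>Doubling at points of finite vanishing order\<close>

lemma cone_bump_mass_pos: "0 < (\<integral>z. cone_bump (z::'n::finite space) \<partial>lborel)"
proof -
  have "continuous_on UNIV (bump (0::'n space) (1/2))" by (intro continuous_intros)
  then have "(\<integral>z. bump (0::'n space) (1/2) (- axis None 1 + z) \<partial>lborel) = bump_mass TYPE('n option) (1/2)"
    unfolding bump_mass_def by (intro lborel_integral_translate borel_measurable_continuous_onI)
  moreover have "(\<lambda>z. bump (0::'n space) (1/2) (- axis None 1 + z)) = cone_bump"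
    by (simp add: fun_eq_iff cone_bump_def bump_def)
  ultimately show ?thesis using bump_mass_pos[of "1/2", where 'm="'n option"] by simp
qed

text \<open>An essentially bounded function on a set of finite measure has integrable powers, which
  reduces p = \<infinity> to a finite exponent.\<close>

lemma in_Lp_imp_integrable:
  assumes U: "U \<in> lmeasurable" and g: "in_Lp (lebesgue_on U) p g" and p: "0 < p"
    and P: "P = (if p = \<infinity> then Q else real_of_ereal p)" "0 < Q"
  shows "integrable (lebesgue_on U) (\<lambda>x. \<bar>g x\<bar> powr P)"
proof (cases "p = \<infinity>")
  case False
  then show ?thesis using g P by (simp add: in_Lp_def)
next
  case True
  then have m: "g \<in> borel_measurable (lebesgue_on U)" and e: "esssup (lebesgue_on U) (\<lambda>x. ereal \<bar>g x\<bar>) < \<infinity>"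
    using g by (auto simp: in_Lp_def)
  from e obtain n :: nat where n: "esssup (lebesgue_on U) (\<lambda>x. ereal \<bar>g x\<bar>) < ereal (real n)"
    using less_PInf_Ex_of_nat by auto
  interpret finite_measure "lebesgue_on U" by (rule finite_measure_lebesgue_on[OF U])
  have "AE x in lebesgue_on U. ereal \<bar>g x\<bar> \<le> esssup (lebesgue_on U) (\<lambda>x. ereal \<bar>g x\<bar>)"
    by (rule esssup_AE)
  then have "AE x in lebesgue_on U. norm (\<bar>g x\<bar> powr P) \<le> real n powr P"
  proof eventually_elim
    case (elim x)
    then have "ereal \<bar>g x\<bar> < ereal (real n)" using n by (rule le_less_trans)
    then show ?case using P True by (simp add: powr_mono2)
  qed
  then show ?thesis using m by (intro integrable_const_bound[where B="real n powr P"]) auto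
qed

text \<open>Both f y and f x0 are close to the same average at x0 over the scale r = norm (y - x0).
  For p = \<infinity> twice the dimension serves as exponent: any value above the dimension yields a
  positive \<gamma>, and positivity is what makes the errors summable.\<close>

lemma W1p_Hoelder_at_flat_point:
  fixes f :: "'n::finite space \<Rightarrow> real" and x0 :: "'n space"
  assumes cont: "continuous_on (half_ball 0 1) f"
    and W: "W1p (interior (half_ball 0 1)) p f" and p: "ereal (real CARD('n) + 1) < p"
    and x0: "x0 $ None = 0" "norm x0 < 1/2"
    and P: "P = (if p = \<infinity> then 2 * real CARD('n option) else real_of_ereal p)"
    and \<gamma>: "\<gamma> = 1 - real CARD('n option) / P"
  shows "\<exists>H\<ge>0. \<forall>y. 0 \<le> y $ None \<and> norm (y - x0) \<le> 1/8 \<longrightarrow> \<bar>f y - f x0\<bar> \<le> H * norm (y - x0) powr \<gamma>"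
proof -
  let ?U = "interior (half_ball (0::'n space) 1)" and ?d = "real CARD('n option)"
  have d1: "0 < ?d" by simp
  have dn: "?d = real CARD('n) + 1" by simp
  have dP: "?d < P"
  proof (cases p)
    case (real q)
    then show ?thesis using p P dn by simp
  next
    case PInf
    then show ?thesis using P d1 by simp
  next
    case MInf
    then show ?thesis using p by simp
  qed
  have \<gamma>p: "0 < \<gamma>" using dP d1 unfolding \<gamma> by (simp add: pos_divide_less_eq del: card_option)
  have Ul: "?U \<in> lmeasurable"
  proof (rule lmeasurable_open)
    have "half_ball (0::'n space) 1 \<subseteq> ball 0 1" by (auto simp: half_ball_def)
    then show "bounded ?U" by (meson bounded_ball bounded_subset interior_subset order_trans)
  qed simp
  have "\<forall>k. \<exists>g. has_weak_partial k ?U f g \<and> in_Lp (lebesgue_on ?U) p g"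
    using W unfolding W1p_def by blast
  then obtain g where g: "\<And>k. has_weak_partial k ?U f (g k)" "\<And>k. in_Lp (lebesgue_on ?U) p (g k)"
    by metis
  have p0: "0 < p" using p by (metis dn d1 ereal_less(2) less_trans)
  have gm: "g k \<in> borel_measurable (lebesgue_on ?U)" for k using g(2)[of k] by (simp add: in_Lp_def)
  have gi: "integrable (lebesgue_on ?U) (\<lambda>x. \<bar>g k x\<bar> powr P)" for k
    by (rule in_Lp_imp_integrable[OF Ul g(2) p0 P]) (use d1 in simp)
  define I where "I = (\<Sum>k\<in>UNIV. LINT x|lebesgue_on ?U. \<bar>g k x\<bar> powr P)"
  have I: "(LINT x|lebesgue_on ?U. \<bar>g k x\<bar> powr P) \<le> I" "0 \<le> I" for k
    unfolding I_def by (auto intro!: member_le_sum sum_nonneg integral_nonneg_AE)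
  define c where "c = (\<integral>z. cone_bump (z::'n space) \<partial>lborel)"
  have c: "0 < c" unfolding c_def by (rule cone_bump_mass_pos)
  define C where "C = 5/2 * ?d * (1 + I) / \<gamma>"
  have C: "0 \<le> C" using I(2) \<gamma>p by (simp add: C_def)
  have "\<bar>f y - f x0\<bar> \<le> (2 * C / c) * norm (y - x0) powr \<gamma>" if y: "0 \<le> y $ None" "norm (y - x0) \<le> 1/8" for y
  proof (cases "y = x0")
    case False
    define r where "r = norm (y - x0)"
    have r: "0 < r" "r \<le> 1/8" using False y by (auto simp: r_def)
    define A where "A = (\<integral>z. f (x0 + r *\<^sub>R z) * cone_bump z \<partial>lborel)"
    have 1: "\<bar>A - f y * c\<bar> \<le> 5/2 * ?d * (1 + I) * r powr \<gamma> / \<gamma>"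
      unfolding A_def c_def \<gamma>
      by (rule cone_average_bound[OF cont g(1) gm gi I dP x0 r]) (use y in \<open>auto simp: r_def\<close>)
    have 2: "\<bar>A - f x0 * c\<bar> \<le> 5/2 * ?d * (1 + I) * r powr \<gamma> / \<gamma>"
      unfolding A_def c_def \<gamma>
      by (rule cone_average_bound[OF cont g(1) gm gi I dP x0 r]) (use x0 r in auto)
    have 3: "5/2 * ?d * (1 + I) * r powr \<gamma> / \<gamma> = C * r powr \<gamma>" by (simp add: C_def)
    have "\<bar>f y * c - f x0 * c\<bar> \<le> 2 * (C * r powr \<gamma>)" using 1 2 unfolding 3 by linarith
    then have "\<bar>f y - f x0\<bar> * c \<le> 2 * (C * r powr \<gamma>)"
      using c by (simp add: left_diff_distrib[symmetric] abs_mult)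
    then have "\<bar>f y - f x0\<bar> \<le> 2 * (C * r powr \<gamma>) / c" using c by (simp add: pos_le_divide_eq)
    then show ?thesis by (simp add: r_def mult_ac)
  qed simp
  moreover have "0 \<le> 2 * C / c" using C c by simp
  ultimately show ?thesis by blast
qed

section \<open>A power lower bound from finite vanishing order\<close>

lemma half_annulus_measure_lower:
  fixes x0 :: "'n::finite space"
  assumes x0: "x0 $ None = 0" and r: "0 < r"
  shows "(r / (4 * real CARD('n option))) ^ CARD('n option) \<le> measure lebesgue (half_annulus x0 (r/2) r)"
proof -
  let ?d = "CARD('n option)"
  \<comment> \<open>In dimension d the cube of half side s around the point at height 3/4 r stays
    within d s = r / 8 of it, hence between the radii r / 2 and r and above the flat face.\<close>
  define s where "s = r / (8 * real ?d)"
  have s: "0 < s" using r by (simp add: s_def)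
  define c where "c = x0 + (3/4 * r) *\<^sub>R axis None 1"
  let ?o = "(\<chi> i. s) :: 'n space"
  have sub: "cbox (c - ?o) (c + ?o) \<subseteq> half_annulus x0 (r/2) r"
  proof
    fix x assume x: "x \<in> cbox (c - ?o) (c + ?o)"
    have comp: "\<bar>(x - c) $ i\<bar> \<le> s" for i
    proof -
      have "(c - ?o) $ i \<le> x $ i \<and> x $ i \<le> (c + ?o) $ i" using x unfolding mem_box_cart by blast
      then have "c $ i - s \<le> x $ i" "x $ i \<le> c $ i + s" by simp_all
      then show ?thesis by (simp add: abs_le_iff)
    qed
    have "norm (x - c) \<le> (\<Sum>i\<in>UNIV. \<bar>(x - c) $ i\<bar>)" by (rule norm_le_l1_cart)
    also have "\<dots> \<le> (\<Sum>i\<in>(UNIV::'n option set). s)" by (intro sum_mono comp)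
    also have "\<dots> = real ?d * s" by (simp only: sum_constant)
    also have "\<dots> = r / 8" by (simp add: s_def del: card_option)
    finally have n: "norm (x - c) \<le> r / 8" .
    have nc: "norm (c - x0) = 3/4 * r" using r by (simp add: c_def)
    have "norm (x - x0) \<le> norm (x - c) + norm (c - x0)" using norm_triangle_ineq[of "x - c" "c - x0"] by simp
    moreover have "norm (c - x0) \<le> norm (x - c) + norm (x - x0)"
      using norm_triangle_ineq[of "c - x" "x - x0"] by (simp add: norm_minus_commute)
    moreover have "0 \<le> x $ None"
    proof -
      have "\<bar>(x - c) $ None\<bar> \<le> r / 8" using component_le_norm_cart[of "x - c" None] n by linarith
      then have "\<bar>x $ None - 3/4 * r\<bar> \<le> r / 8" by (simp add: c_def x0)
      then show ?thesis using r by linarith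
    qed
    ultimately show "x \<in> half_annulus x0 (r/2) r"
      using n nc r unfolding half_annulus_def half_ball_def by simp
  qed
  have bd: "half_annulus x0 (r/2) r \<in> lmeasurable"
  proof (rule bounded_set_imp_lmeasurable)
    have "half_annulus x0 (r/2) r \<subseteq> ball x0 r"
      by (auto simp: half_annulus_def half_ball_def dist_norm norm_minus_commute)
    then show "bounded (half_annulus x0 (r/2) r)" by (rule bounded_subset[OF bounded_ball])
    show "half_annulus x0 (r/2) r \<in> sets lebesgue"
      unfolding half_annulus_def by (intro sets.Diff half_ball_measurable)
  qed
  have "measure lebesgue (cbox (c - ?o) (c + ?o)) \<le> measure lebesgue (half_annulus x0 (r/2) r)"
    by (rule measure_mono_fmeasurable[OF sub _ bd]) simp
  moreover have "measure lebesgue (cbox (c - ?o) (c + ?o)) = (r / (4 * real ?d)) ^ ?d"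
  proof -
    have "c \<in> cbox (c - ?o) (c + ?o)" using s by (simp add: mem_box_cart)
    then have ne: "cbox (c - ?o) (c + ?o) \<noteq> {}" by blast
    have "measure lebesgue (cbox (c - ?o) (c + ?o)) = measure lborel (cbox (c - ?o) (c + ?o))" by simp
    also have "\<dots> = (\<Prod>i\<in>UNIV. (c + ?o) $ i - (c - ?o) $ i)" by (rule content_cbox_cart[OF ne])
    also have "\<dots> = (2 * s) ^ ?d" by simp
    finally show ?thesis by (simp add: s_def del: card_option)
  qed
  ultimately show ?thesis by simp
qed

text \<open>For r < 1 the logarithm of r is negative, so an upper bound k for the quotient of
  logarithms is a lower bound r^k for the root mean square of w on the annulus. Squaring and
  multiplying by the volume of the annulus gives K = d + 2 k in dimension d.\<close>

lemma finite_vanishing_order_lower_bound: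
  fixes w :: "'n::finite space \<Rightarrow> real"
  assumes x0: "x0 $ None = 0" and R: "0 < R" and cont: "continuous_on (half_cube x0 R) w"
    and vo: "vanishing_order w x0 < \<infinity>"
  shows "\<exists>c>0. \<exists>K\<ge>0. \<exists>r1>0. \<forall>r. 0 < r \<and> r \<le> r1 \<longrightarrow> c * r powr K \<le> (LINT x:half_ball x0 r|lebesgue. (w x)\<^sup>2)"
proof -
  let ?d = "CARD('n option)"
  let ?A = "\<lambda>r. LINT x:half_annulus x0 (r/2) r|lebesgue. (w x)\<^sup>2"
  let ?m = "\<lambda>r. measure lebesgue (half_annulus x0 (r/2) r)"
  obtain k :: nat where k: "vanishing_order w x0 < ereal (real k)"
    using vo less_PInf_Ex_of_nat by auto
  then have "\<forall>\<^sub>F r in at_right 0. ln_ext (sqrt (1 / ?m r * ?A r)) / ereal (ln r) < ereal (real k)"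
    unfolding vanishing_order_def by (rule Limsup_lessD)
  then obtain b where b: "0 < b" "\<And>r. 0 < r \<Longrightarrow> r < b \<Longrightarrow> ln_ext (sqrt (1 / ?m r * ?A r)) / ereal (ln r) < ereal (real k)"
    unfolding eventually_at_right_field by blast
  define r1 where "r1 = min (min (b / 2) (1 / 2)) R"
  have r1: "0 < r1" "r1 < b" "r1 < 1" "r1 \<le> R" using b R by (auto simp: r1_def)
  define c where "c = (1 / (4 * real ?d)) ^ ?d"
  have c: "0 < c" by (simp add: c_def)
  have "c * r powr (real ?d + 2 * real k) \<le> (LINT x:half_ball x0 r|lebesgue. (w x)\<^sup>2)" if r: "0 < r" "r \<le> r1" for r
  proof -
    have rb: "r < b" "r < 1" "r \<le> R" using r r1 by auto
    have lnr: "ln r < 0" using r rb by simp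
    define s where "s = sqrt (1 / ?m r * ?A r)"
    have F: "ln_ext s / ereal (ln r) < ereal (real k)" unfolding s_def by (rule b(2)[OF r(1) rb(1)])
    \<comment> \<open>A vanishing mean would make \<open>ln_ext\<close> equal to - \<infinity> and
      its quotient by a negative number + \<infinity>, against F.\<close>
    have s: "0 < s"
    proof (rule ccontr)
      assume "\<not> 0 < s"
      then have "ln_ext s = - \<infinity>" by (simp add: ln_ext_def)
      then have "ln_ext s / ereal (ln r) = \<infinity>" using lnr by (simp add: divide_ereal_def)
      then show False using F by simp
    qed
    have "ln s / ln r < real k" using F s lnr by (simp add: ln_ext_def)
    then have "real k * ln r < ln s" using lnr by (simp add: neg_divide_less_eq)
    then have "exp (real k * ln r) < exp (ln s)" by simp
    then have "r powr real k < s" using s r by (simp add: powr_def)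
    then have "(r powr real k)\<^sup>2 \<le> s\<^sup>2" by (intro power_mono) auto
    also have "s\<^sup>2 = 1 / ?m r * ?A r" using s unfolding s_def by (simp add: real_sqrt_gt_0_iff)
    finally have 1: "(r powr real k)\<^sup>2 \<le> 1 / ?m r * ?A r" .
    have m: "(r / (4 * real ?d)) ^ ?d \<le> ?m r" by (rule half_annulus_measure_lower[OF x0 r(1)])
    have cr: "(r / (4 * real ?d)) ^ ?d = c * r ^ ?d" by (simp add: c_def power_divide del: card_option)
    have mpos: "0 < ?m r" using m c r unfolding cr by (smt (verit) mult_pos_pos zero_less_power)
    have "(r powr real k)\<^sup>2 * ?m r \<le> ?A r" using 1 mpos by (simp add: pos_le_divide_eq)
    moreover have "(r powr real k)\<^sup>2 * (c * r ^ ?d) \<le> (r powr real k)\<^sup>2 * ?m r"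
      using m unfolding cr by (intro mult_left_mono) auto
    moreover have "(r powr real k)\<^sup>2 * (c * r ^ ?d) = c * r powr (real ?d + 2 * real k)"
    proof -
      have "r powr (real ?d + 2 * real k) = r powr real ?d * (r powr real k * r powr real k)"
        unfolding mult_2 by (simp only: powr_add)
      moreover have "r powr real ?d = r ^ ?d" using r by (simp add: powr_realpow del: card_option of_nat_Suc)
      ultimately show ?thesis by (simp only: power2_eq_square mult_ac)
    qed
    moreover have "?A r \<le> (LINT x:half_ball x0 r|lebesgue. (w x)\<^sup>2)"
    proof -
      have cw: "continuous_on (half_cube x0 R) (\<lambda>x. (w x)\<^sup>2)" by (intro continuous_on_power cont)
      note hb = continuous_on_half_cube_half_ball_integral[OF cw x0 rb(3)]
      have sub: "half_annulus x0 (r/2) r \<subseteq> half_ball x0 r" by (auto simp: half_annulus_def)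
      have ai: "(\<lambda>x. (w x)\<^sup>2) absolutely_integrable_on half_annulus x0 (r/2) r"
        by (rule set_integrable_subset[OF hb(1) _ sub])
          (unfold half_annulus_def, intro sets.Diff half_ball_measurable)
      show ?thesis
        unfolding hb(2) set_lebesgue_integral_eq_integral(2)[OF ai]
        by (rule integral_subset_le[OF sub set_lebesgue_integral_eq_integral(1)[OF ai] set_lebesgue_integral_eq_integral(1)[OF hb(1)]]) simp
    qed
    ultimately show ?thesis by linarith
  qed
  moreover have "0 \<le> real ?d + 2 * real k" by simp
  ultimately show ?thesis using c r1(1) by blast
qed

section \<open>From the thin obstacle problem to the local setting\<close>

lemma C1_holder_loc_continuous_partial:
  assumes f: "C1_holder_loc \<alpha> S f" and \<alpha>: "0 < \<alpha>" and K: "compact K" "K \<subseteq> S"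
  shows "continuous_on K (partial k S f)"
proof -
  have "\<forall>K. compact K \<and> K \<subseteq> S \<longrightarrow> (\<exists>L. \<forall>k. \<forall>x\<in>K. \<forall>y\<in>K. \<bar>partial k S f x - partial k S f y\<bar> \<le> L * dist x y powr \<alpha>)"
    using f unfolding C1_holder_loc_def by (rule conjunct2)
  from this[rule_format, OF conjI[OF K]]
  obtain L where "\<forall>k. \<forall>x\<in>K. \<forall>y\<in>K. \<bar>partial k S f x - partial k S f y\<bar> \<le> L * dist x y powr \<alpha>" ..
  then have L: "\<bar>partial k S f x - partial k S f y\<bar> \<le> L * dist x y powr \<alpha>" if "x \<in> K" "y \<in> K" for x y
    using that by simp
  show ?thesis
    unfolding continuous_on_def
  proof
    fix x assume x: "x \<in> K"
    have "((\<lambda>y. dist y x) \<longlongrightarrow> dist x x) (at x within K)" by (intro tendsto_intros)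
    then have "((\<lambda>y. dist y x powr \<alpha>) \<longlongrightarrow> 0) (at x within K)"
      using \<alpha> by (intro tendsto_zero_powrI[where b=\<alpha>]) auto
    then have "((\<lambda>y. L * dist y x powr \<alpha>) \<longlongrightarrow> 0) (at x within K)" by (rule tendsto_mult_right_zero)
    then have "((\<lambda>y. partial k S f y - partial k S f x) \<longlongrightarrow> 0) (at x within K)"
      by (rule Lim_null_comparison[rotated]) (use L x in \<open>auto simp: eventually_at_filter\<close>)
    then show "(partial k S f \<longlongrightarrow> partial k S f x) (at x within K)" by (simp add: LIM_zero_iff)
  qed
qed

lemma gradient_within:
  fixes f :: "'n::finite space \<Rightarrow> real"
  assumes "f differentiable_on S" "x \<in> S" "T \<subseteq> S"
  shows "(f has_derivative (\<lambda>h. (\<chi> k. partial k S f x) \<bullet> h)) (at x within T)"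
proof -
  let ?D = "frechet_derivative f (at x within S)"
  have d: "(f has_derivative ?D) (at x within S)"
    using assms(1,2) by (simp add: differentiable_on_def frechet_derivative_works)
  have lin: "linear ?D" using d by (simp add: has_derivative_def bounded_linear.linear)
  have "?D h = (\<chi> k. partial k S f x) \<bullet> h" for h
  proof -
    have "?D h = ?D (\<Sum>k\<in>UNIV. (h $ k) *\<^sub>R axis k 1)"
      using basis_expansion[of h] by (simp add: scalar_mult_eq_scaleR)
    also have "\<dots> = (\<Sum>k\<in>UNIV. h $ k * ?D (axis k 1))"
      by (simp add: linear_sum[OF lin] linear_cmul[OF lin])
    finally show ?thesis by (simp add: inner_vec_def partial_def mult.commute)
  qed
  then have "?D = (\<lambda>h. (\<chi> k. partial k S f x) \<bullet> h)" by (rule ext)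
  then show ?thesis using has_derivative_subset[OF d assms(3)] by simp
qed

lemma partial_zero_outside_support:
  assumes "x \<notin> closure {x. \<psi> x \<noteq> 0}"
  shows "partial k UNIV \<psi> x = 0"
proof -
  have "((\<lambda>_. 0) has_derivative (\<lambda>h. 0)) (at x)" by simp
  then have "(\<psi> has_derivative (\<lambda>h. 0)) (at x)"
  proof (rule has_derivative_transform_within_open[of _ _ _ _ "- closure {x. \<psi> x \<noteq> 0}"])
    show "0 = \<psi> y" if "y \<in> - closure {x. \<psi> x \<noteq> 0}" for y
      using that closure_subset[of "{x. \<psi> x \<noteq> 0}"] by auto
  qed (use assms in auto)
  then show ?thesis by (rule partial_UNIV_eq)
qed

text \<open>The bound on R keeps the half cube within distance 1/8 of x0, where Morrey's estimate
  applies to each entry. Test functions of its interior are test functions of the half ball and have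
  no gradient outside the half cube, so the equation restricts to it.\<close>

lemma signorini_of_thin_obstacle_solution:
  fixes w :: "'n::finite space \<Rightarrow> real" and a :: "'n coeff"
  assumes w: "C1_holder_loc \<alpha> (half_ball 0 1) w" "0 < \<alpha>"
    and p: "ereal (real CARD('n) + 1) < p" and a: "admissible_coeff p a" and sol: "thin_obstacle_solution a w"
    and x0: "x0 $ None = 0" "norm x0 < 1/2"
    and R: "0 < R" "R \<le> 1 / (8 * real CARD('n option))"
  shows "\<exists>H \<gamma>. signorini w (\<lambda>x. \<chi> k. partial k (half_ball 0 1) w x) a x0 R H \<gamma>"
proof -
  let ?S = "half_ball (0::'n space) 1" and ?d = "real CARD('n option)"
  let ?gw = "\<lambda>x. \<chi> k. partial k ?S w x"
  have d1: "0 < ?d" by simp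
  have near: "norm (x - x0) \<le> 1/8 \<and> 0 \<le> x $ None" if x: "x \<in> half_cube x0 R" for x
  proof -
    have "norm (x - x0) \<le> (\<Sum>i\<in>UNIV. \<bar>(x - x0) $ i\<bar>)" by (rule norm_le_l1_cart)
    also have "\<dots> \<le> (\<Sum>i\<in>(UNIV::'n option set). R)"
      using x unfolding mem_half_cube by (intro sum_mono) auto
    also have "\<dots> = ?d * R" by (simp only: sum_constant)
    also have "\<dots> \<le> ?d * (1 / (8 * ?d))" using R d1 by (intro mult_left_mono) auto
    also have "\<dots> = 1/8" using d1 by (simp del: card_option)
    finally have "norm (x - x0) \<le> 1/8" .
    moreover have "0 \<le> x $ None" using x x0(1) unfolding mem_half_cube by auto
    ultimately show ?thesis by blast
  qed
  have sub: "half_cube x0 R \<subseteq> ?S"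
  proof
    fix x assume "x \<in> half_cube x0 R"
    then have x: "norm (x - x0) \<le> 1/8" "0 \<le> x $ None" using near by blast+
    have "norm x \<le> norm (x - x0) + norm x0" using norm_triangle_ineq[of "x - x0" x0] by simp
    then show "x \<in> ?S" using x x0(2) by (simp add: half_ball_def)
  qed
  have x0S: "x0 \<in> ?S" using x0 by (simp add: half_ball_def)
  have a_sym: "transpose (a x) = a x" if "x \<in> ?S" for x
    using a that unfolding admissible_coeff_def by blast
  have a_ev: "1/2 \<le> \<mu> \<and> \<mu> \<le> 2" if "x \<in> ?S" "v \<noteq> 0" "a x *v v = \<mu> *\<^sub>R v" for x \<mu> v
    using a that unfolding admissible_coeff_def by blast
  have cont_a: "continuous_on ?S a" using a unfolding admissible_coeff_def by blast
  define P where "P = (if p = \<infinity> then 2 * ?d else real_of_ereal p)"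
  define \<gamma> where "\<gamma> = 1 - ?d / P"
  have "\<forall>i j. \<exists>H\<ge>0. \<forall>y. 0 \<le> y $ None \<and> norm (y - x0) \<le> 1/8 \<longrightarrow> \<bar>a y $ i $ j - a x0 $ i $ j\<bar> \<le> H * norm (y - x0) powr \<gamma>"
  proof (intro allI)
    fix i j
    have "continuous_on ?S (\<lambda>x. a x $ i $ j)" by (intro continuous_on_component cont_a)
    moreover have "W1p (interior ?S) p (\<lambda>x. a x $ i $ j)" using a unfolding admissible_coeff_def by blast
    ultimately show "\<exists>H\<ge>0. \<forall>y. 0 \<le> y $ None \<and> norm (y - x0) \<le> 1/8 \<longrightarrow> \<bar>a y $ i $ j - a x0 $ i $ j\<bar> \<le> H * norm (y - x0) powr \<gamma>"
      by (rule W1p_Hoelder_at_flat_point[OF _ _ p x0 P_def \<gamma>_def])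
  qed
  then obtain Hf where Hf: "\<And>i j. 0 \<le> Hf i j"
    "\<And>i j y. 0 \<le> y $ None \<Longrightarrow> norm (y - x0) \<le> 1/8 \<Longrightarrow> \<bar>a y $ i $ j - a x0 $ i $ j\<bar> \<le> Hf i j * norm (y - x0) powr \<gamma>"
    by metis
  \<comment> \<open>The summand 1 keeps H positive even for constant coefficients.\<close>
  define H where "H = 1 + (\<Sum>i\<in>UNIV. \<Sum>j\<in>UNIV. Hf i j)"
  have Hs: "0 \<le> (\<Sum>i\<in>UNIV. \<Sum>j\<in>UNIV. Hf i j)" by (intro sum_nonneg Hf)
  have dn: "?d = real CARD('n) + 1" by simp
  have dP: "?d < P"
  proof (cases p)
    case (real q)
    then show ?thesis using p P_def dn by simp
  next
    case PInf
    then show ?thesis using P_def d1 by simp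
  next
    case MInf
    then show ?thesis using p by simp
  qed
  have \<gamma>p: "0 < \<gamma>" using dP d1 unfolding \<gamma>_def by (simp add: pos_divide_less_eq del: card_option)
  have "signorini w ?gw a x0 R H \<gamma>"
  proof
    show "0 < R" by (rule R)
    show "0 < H" using Hs by (simp add: H_def)
    show "0 < \<gamma>" by (rule \<gamma>p)
    show "x0 $ None = 0" by (rule x0)
    show "(w has_derivative (\<lambda>h. ?gw x \<bullet> h)) (at x within half_cube x0 R)" if "x \<in> half_cube x0 R" for x
      using w(1) sub that unfolding C1_holder_loc_def by (intro gradient_within) auto
    show "continuous_on (half_cube x0 R) ?gw"
      by (intro continuous_on_vec_lambda C1_holder_loc_continuous_partial[OF w compact_half_cube sub, unfolded eta_contract_eq])
    show "continuous_on (half_cube x0 R) a" by (rule continuous_on_subset[OF cont_a sub])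
    fix x assume x: "x \<in> half_cube x0 R"
    then have xS: "x \<in> ?S" using sub by blast
    show "transpose (a x) = a x" by (rule a_sym[OF xS])
    note form = eigenvalue_bounds_imp_form_bounds[of "a x" "1/2" 2, OF a_sym[OF xS]]
    show "v \<bullet> v / 2 \<le> v \<bullet> (a x *v v)" for v
      using form(1)[of v] a_ev[OF xS] by fastforce
    show "v \<bullet> (a x *v v) \<le> 2 * (v \<bullet> v)" for v
      using form(2)[of v] a_ev[OF xS] by fastforce
    show "norm (a x *v v - a x0 *v v) \<le> H * norm (x - x0) powr \<gamma> * norm v" for v
    proof -
      let ?q = "norm (x - x0) powr \<gamma> * norm v"
      have "norm (a x *v v - a x0 *v v) \<le> (\<Sum>i\<in>UNIV. \<bar>(a x *v v - a x0 *v v) $ i\<bar>)" by (rule norm_le_l1_cart)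
      also have "\<dots> \<le> (\<Sum>i\<in>UNIV. \<Sum>j\<in>UNIV. Hf i j * ?q)"
      proof (rule sum_mono)
        fix i
        have "(a x *v v - a x0 *v v) $ i = (\<Sum>j\<in>UNIV. (a x $ i $ j - a x0 $ i $ j) * v $ j)"
          by (simp add: matrix_vector_mult_def sum_subtractf left_diff_distrib)
        also have "\<bar>\<dots>\<bar> \<le> (\<Sum>j\<in>UNIV. \<bar>(a x $ i $ j - a x0 $ i $ j) * v $ j\<bar>)" by (rule sum_abs)
        also have "\<dots> \<le> (\<Sum>j\<in>UNIV. Hf i j * ?q)"
        proof (rule sum_mono)
          fix j
          have "\<bar>a x $ i $ j - a x0 $ i $ j\<bar> * \<bar>v $ j\<bar> \<le> (Hf i j * norm (x - x0) powr \<gamma>) * norm v"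
            using near[OF x] Hf by (intro mult_mono component_le_norm_cart) auto
          then show "\<bar>(a x $ i $ j - a x0 $ i $ j) * v $ j\<bar> \<le> Hf i j * ?q" by (simp add: abs_mult mult.assoc)
        qed
        finally show "\<bar>(a x *v v - a x0 *v v) $ i\<bar> \<le> (\<Sum>j\<in>UNIV. Hf i j * ?q)" .
      qed
      also have "\<dots> = (\<Sum>i\<in>UNIV. \<Sum>j\<in>UNIV. Hf i j) * ?q" by (simp only: sum_distrib_right)
      also have "\<dots> \<le> H * ?q" unfolding H_def by (intro mult_right_mono) auto
      finally show ?thesis by (simp add: mult.assoc)
    qed
    show "a x $ None $ Some i = 0" if "x $ None = 0" for i
    proof -
      have "x \<in> flat_ball 1" using that xS by (simp add: flat_ball_def)
      \<comment> \<open>The entries known to vanish lie in the column \<open>None\<close>; symmetry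
        moves them to the row \<open>None\<close>, which is the one that enters the flux.\<close>
      then have "a x $ Some i $ None = 0" using a unfolding admissible_coeff_def by blast
      moreover have "transpose (a x) $ Some i $ None = a x $ None $ Some i" by (simp add: transpose_def)
      ultimately show ?thesis unfolding a_sym[OF xS] by simp
    qed
    show "0 \<le> w x \<and> ?gw x $ None \<le> 0 \<and> w x * ?gw x $ None = 0" if "x $ None = 0"
    proof -
      have "x \<in> flat_ball 1" using that xS by (simp add: flat_ball_def)
      then have "w x \<ge> 0 \<and> - partial None ?S w x \<ge> 0 \<and> w x * partial None ?S w x = 0"
        using sol unfolding thin_obstacle_solution_def by blast
      then show ?thesis by simp
    qed
  next
    fix r :: real and \<psi> :: "'n space \<Rightarrow> real"
    assume r: "0 < r" "r \<le> R"
      and \<psi>: "test_function (box (x0 - r *\<^sub>R (\<chi> i. if i = None then 0 else 1)) (x0 + r *\<^sub>R (\<chi> i. 1))) \<psi>"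
    let ?lo = "x0 - r *\<^sub>R (\<chi> i. if i = None then 0 else 1)" and ?hi = "x0 + r *\<^sub>R (\<chi> i. 1)"
    have cubeS: "half_cube x0 r \<subseteq> ?S" using half_cube_mono[OF r(2)] sub by blast
    have boxcube: "box ?lo ?hi \<subseteq> half_cube x0 r" unfolding half_cube_def by (rule box_subset_cbox)
    have "box ?lo ?hi \<subseteq> interior ?S" by (intro interior_maximal open_box order_trans[OF boxcube cubeS])
    then have t: "test_function (interior ?S) \<psi>" using \<psi> unfolding test_function_def by blast
    have pz: "partial i UNIV \<psi> x = 0" if "x \<notin> half_cube x0 r" for i x
    proof (rule partial_zero_outside_support)
      show "x \<notin> closure {x. \<psi> x \<noteq> 0}" using \<psi> boxcube that unfolding test_function_def by blast
    qed
    have pc: "continuous_on UNIV (partial i UNIV \<psi>)" for i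
    proof -
      have "Ck (Suc 0) \<psi>" using \<psi> unfolding test_function_def by blast
      then show ?thesis by simp
    qed
    define k where "k x = (\<Sum>i\<in>UNIV. \<Sum>j\<in>UNIV. a x $ i $ j * partial j ?S w x * partial i UNIV \<psi> x)" for x
    have keq: "k x = (\<Sum>i\<in>UNIV. (a x *v ?gw x) $ i * partial i UNIV \<psi> x)" for x
      by (simp add: k_def matrix_vector_mult_def sum_distrib_right)
    define h where "h x = (if x \<in> half_cube x0 r then k x else 0)" for x
    have "continuous_on (half_cube x0 r) k"
      unfolding keq[abs_def]
      by (intro continuous_on_sum continuous_on_mult continuous_on_component continuous_on_matrix_vector_mult
          continuous_on_subset[OF cont_a cubeS] continuous_on_subset[OF pc] continuous_on_vec_lambda
          C1_holder_loc_continuous_partial[OF w compact_half_cube cubeS, unfolded eta_contract_eq]) auto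
    then have ch: "continuous_on (half_cube x0 r) h"
      by (rule continuous_on_eq) (simp add: h_def)
    have "(LINT x:?S|lebesgue. k x) = integral (cbox ?lo ?hi) h"
    proof (rule set_lebesgue_integral_eq_cbox_integral)
      show "continuous_on (cbox ?lo ?hi) h" using ch unfolding half_cube_def .
      show "h x = 0" if "x \<notin> cbox ?lo ?hi" for x using that unfolding h_def half_cube_def by simp
      show "k x = h x" for x using pz[of x] by (simp add: h_def k_def)
      show "h x = 0" if "x \<notin> ?S" for x using cubeS that by (auto simp: h_def)
    qed
    also have "\<dots> = integral (half_cube x0 r) k"
      unfolding half_cube_def[symmetric] by (rule integral_cong) (simp add: h_def)
    finally have "integral (half_cube x0 r) k = (LINT x:?S|lebesgue. k x)" by simp
    also have "\<dots> = 0" using sol t unfolding thin_obstacle_solution_def k_def by blast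
    finally show "integral (half_cube x0 r) (\<lambda>x. \<Sum>i\<in>UNIV. (a x *v ?gw x) $ i * partial i UNIV \<psi> x) = 0"
      unfolding keq[abs_def] .
  qed
  then show ?thesis by blast
qed

theorem proposition4p3:
  fixes w :: "('n::finite) space \<Rightarrow> real" and x0 :: "'n space" and \<gamma> M :: real
  assumes "in_Lp (lebesgue_on (half_ball 0 1)) 2 w"
    and "Lp_norm (lebesgue_on (half_ball 0 1)) 2 w = 1"
    and "\<exists>\<alpha>. 0 < \<alpha> \<and> \<alpha> \<le> 1/2 \<and> C1_holder_loc \<alpha> (half_ball 0 1) w"
    and "x0 \<in> free_boundary w \<inter> flat_ball (1/2)"
    and "vanishing_order w x0 < \<infinity>"
  shows "\<exists>r0>0. \<exists>C>0. \<forall>(p::ereal) (a::'n coeff).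
           ereal (real CARD('n) + 1) < p \<and>
           ereal \<gamma> = 1 - ereal (real CARD('n) + 1) / p \<and>
           admissible_coeff p a \<and>
           grad_coeff_norm (interior (half_ball 0 1)) p a = M \<and>
           thin_obstacle_solution a w \<longrightarrow>
             (\<forall>r. 0 < r \<and> r \<le> r0 \<longrightarrow>
                (LINT x:half_ball x0 (2*r)|lebesgue. (w x)\<^sup>2)
                  \<le> C * (LINT x:half_ball x0 r|lebesgue. (w x)\<^sup>2))"
proof (cases "\<exists>(p::ereal) (a::'n coeff). ereal (real CARD('n) + 1) < p \<and> admissible_coeff p a \<and> thin_obstacle_solution a w")
  case False
  \<comment> \<open>Without any coefficients the claim is vacuous, and every positive pair of
    constants will do.\<close>
  show ?thesis
    by (rule exI[of _ 1], rule conjI[OF zero_less_one], rule exI[of _ 1], rule conjI[OF zero_less_one])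
      (use False in blast)
next
  case True
  then obtain p and a :: "'n coeff" where pa: "ereal (real CARD('n) + 1) < p" "admissible_coeff p a" "thin_obstacle_solution a w"
    by blast
  obtain \<alpha> where \<alpha>: "0 < \<alpha>" "C1_holder_loc \<alpha> (half_ball 0 1) w" using assms(3) by blast
  have x0: "x0 $ None = 0" "norm x0 < 1/2" using assms(4) by (auto simp: flat_ball_def half_ball_def)
  define R0 where "R0 = 1 / (8 * real CARD('n option))"
  have R0: "0 < R0" by (simp add: R0_def)
  note sig = signorini_of_thin_obstacle_solution[OF \<alpha>(2,1) pa x0]
  \<comment> \<open>On the largest half cube this only provides the continuity of w. It yields a
    radius r1 for the lower bound, and the setting is then built again on a half cube of size at
    most r1, so that the bound holds at all its scales.\<close>
  obtain H0 \<gamma>0 where "signorini w (\<lambda>x. \<chi> k. partial k (half_ball 0 1) w x) a x0 R0 H0 \<gamma>0"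
    using sig[OF R0] unfolding R0_def by blast
  then have cw: "continuous_on (half_cube x0 R0) w" by (rule signorini.cont_w)
  obtain c K r1 where c: "0 < c" and K: "0 \<le> K" and r1: "0 < r1"
    and low: "\<And>r. 0 < r \<Longrightarrow> r \<le> r1 \<Longrightarrow> c * r powr K \<le> (LINT x:half_ball x0 r|lebesgue. (w x)\<^sup>2)"
    using finite_vanishing_order_lower_bound[OF x0(1) R0 cw assms(5)] by metis
  define R where "R = min R0 r1"
  have R: "0 < R" "R \<le> 1 / (8 * real CARD('n option))" using R0 r1 by (auto simp: R_def R0_def)
  obtain H \<gamma>' where S: "signorini w (\<lambda>x. \<chi> k. partial k (half_ball 0 1) w x) a x0 R H \<gamma>'"
    using sig[OF R] by blast
  note J = signorini.J_def[OF S]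
  have lowR: "c * r powr K \<le> signorini.J w x0 r" if "0 < r" "r \<le> R" for r
    unfolding J using that by (intro low) (simp_all add: R_def)
  have "\<exists>r0>0. \<exists>C>0. \<forall>r. 0 < r \<and> r \<le> r0 \<longrightarrow>
      (LINT x:half_ball x0 (2*r)|lebesgue. (w x)\<^sup>2) \<le> C * (LINT x:half_ball x0 r|lebesgue. (w x)\<^sup>2)"
    using signorini.doubling_of_lower_bound[OF S c K lowR] unfolding J .
  then obtain r0 C where "0 < r0" "0 < C" and dbl: "\<And>r. 0 < r \<Longrightarrow> r \<le> r0 \<Longrightarrow>
      (LINT x:half_ball x0 (2*r)|lebesgue. (w x)\<^sup>2) \<le> C * (LINT x:half_ball x0 r|lebesgue. (w x)\<^sup>2)"
    by (elim exE conjE) simp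
  show ?thesis
    by (rule exI[of _ r0], rule conjI[OF \<open>0 < r0\<close>], rule exI[of _ C], rule conjI[OF \<open>0 < C\<close>])
      (intro allI impI dbl; elim conjE; assumption)
qed

end
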